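(* Let $\Delta$ be a non-perfect hyperbolic profinite $F$-group. Then $\Delta$ is not derived perfect, and $\Delta$ admits solvable quotients of derived length $k$ for every integer $k\ge0$.
   Context: A profinite group $\Delta$ is a profinite $F$-group if it admits a topological presentation $$\Bigl\langle \alpha_1,\beta_1,\dots,\alpha_g,\beta_g,\gamma_1,\dots,\gamma_r,\delta_1,\dots,\delta_s\ \Bigm|\ \prod_{i=1}^g[\alpha_i,\beta_i]\prod_{j=1}^r\gamma_j\prod_{\ell=1}^s\delta_\ell=1,\ \delta_1^{n_1}=\cdots=\delta_s^{n_s}=1\Bigr\rangle$$ with integers $g,r,s\ge0$ and $n_i\ge2$; it is hyperbolic if $2-2g-r-\sum_{i=1}^s(1-\frac1{n_i})<0$. For a profinite group $G$, $G^{(0)}=G$ and $G^{(m)}$ is the closure of $[G^{(m-1)},G^{(m-1)}]$ for $m\ge1$; the derived length, if it exists, is the minimal $m$ with $G^{(m)}=1$; $G$ is perfect if $G=G^{(1)}$; $G$ is $m$-derived perfect if $G^{(m)}$ is perfect, and derived perfect if it is $m$-derived perfect for some $m\ge0$. *)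

theory Defs
  imports "HOL-Analysis.Analysis" "HOL-Algebra.Solvable_Groups" "HOL-Algebra.Product_Groups"
begin

section \<open>Profinite groups\<close>

locale topological_group = group G for G :: "('a, 'b) monoid_scheme" (structure) +
  fixes T :: "'a topology"
  assumes topspace_eq: "topspace T = carrier G"
    and continuous_mult: "continuous_map (prod_topology T T) T (\<lambda>(x, y). x \<otimes> y)"
    and continuous_inv: "continuous_map T T (\<lambda>x. inv x)"

locale profinite_group = topological_group G T
  for G :: "('a, 'b) monoid_scheme" (structure) and T :: "'a topology" +
  assumes compact: "compact_space T"
    and Hausdorff: "Hausdorff_space T"
    and totally_disconnected: "connectedin T S \<Longrightarrow> \<exists>a. S \<subseteq> {a}"

definition quotient_topology :: "'a topology \<Rightarrow> ('a \<Rightarrow> 'c) \<Rightarrow> 'c topology" where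
  "quotient_topology T f =
     topology (\<lambda>U. U \<subseteq> f ` topspace T \<and> openin T {x \<in> topspace T. f x \<in> U})"

lemma openin_quotient_topology:
  "openin (quotient_topology T f) U \<longleftrightarrow>
     U \<subseteq> f ` topspace T \<and> openin T {x \<in> topspace T. f x \<in> U}"
proof -
  let ?P = "\<lambda>U. U \<subseteq> f ` topspace T \<and> openin T {x \<in> topspace T. f x \<in> U}"
  have "istopology ?P"
    unfolding istopology_def
  proof (intro conjI allI impI)
    fix S U assume SU: "?P S" "?P U"
    have "{x \<in> topspace T. f x \<in> S \<inter> U} = {x \<in> topspace T. f x \<in> S} \<inter> {x \<in> topspace T. f x \<in> U}"
      by auto
    then show "S \<inter> U \<subseteq> f ` topspace T" "openin T {x \<in> topspace T. f x \<in> S \<inter> U}"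
      using SU by auto
  next
    fix K assume K: "\<forall>U\<in>K. ?P U"
    have "{x \<in> topspace T. f x \<in> \<Union>K} = (\<Union>U\<in>K. {x \<in> topspace T. f x \<in> U})"
      by auto
    then show "\<Union>K \<subseteq> f ` topspace T" "openin T {x \<in> topspace T. f x \<in> \<Union>K}"
      using K by auto
  qed
  then show ?thesis
    by (simp add: quotient_topology_def)
qed

lemma topspace_quotient_topology: "topspace (quotient_topology T f) = f ` topspace T"
proof (rule antisym)
  show "topspace (quotient_topology T f) \<subseteq> f ` topspace T"
    using openin_topspace[of "quotient_topology T f"] by (simp only: openin_quotient_topology)
  have "{x \<in> topspace T. f x \<in> f ` topspace T} = topspace T"
    by auto
  then show "f ` topspace T \<subseteq> topspace (quotient_topology T f)"
    by (intro openin_subset) (simp add: openin_quotient_topology)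
qed

lemma quotient_map_quotient_topology: "quotient_map T (quotient_topology T f) f"
  by (simp add: quotient_map_def topspace_quotient_topology openin_quotient_topology)

definition factor_topology :: "('a, 'b) monoid_scheme \<Rightarrow> 'a topology \<Rightarrow> 'a set \<Rightarrow> 'a set topology" where
  "factor_topology G T N = quotient_topology T (\<lambda>x. N #>\<^bsub>G\<^esub> x)"


section \<open>The derived series\<close>

fun derived_term :: "('a, 'b) monoid_scheme \<Rightarrow> 'a topology \<Rightarrow> nat \<Rightarrow> 'a set" where
  "derived_term G T 0 = carrier G"
| "derived_term G T (Suc m) = T closure_of (derived G (derived_term G T m))"

definition has_derived_length :: "('a, 'b) monoid_scheme \<Rightarrow> 'a topology \<Rightarrow> nat \<Rightarrow> bool" where
  "has_derived_length G T k \<longleftrightarrow>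
     derived_term G T k = {\<one>\<^bsub>G\<^esub>} \<and> (\<forall>j<k. derived_term G T j \<noteq> {\<one>\<^bsub>G\<^esub>})"

definition perfect :: "('a, 'b) monoid_scheme \<Rightarrow> 'a topology \<Rightarrow> bool" where
  "perfect G T \<longleftrightarrow> carrier G = derived_term G T 1"

definition m_derived_perfect :: "nat \<Rightarrow> ('a, 'b) monoid_scheme \<Rightarrow> 'a topology \<Rightarrow> bool" where
  "m_derived_perfect m G T \<longleftrightarrow>
     perfect (G\<lparr>carrier := derived_term G T m\<rparr>) (subtopology T (derived_term G T m))"

definition derived_perfect :: "('a, 'b) monoid_scheme \<Rightarrow> 'a topology \<Rightarrow> bool" where
  "derived_perfect G T \<longleftrightarrow> (\<exists>m. m_derived_perfect m G T)"


section \<open>Free groups\<close>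

text \<open>A word is a list of letters \<^term>\<open>(x, b)\<close>, standing for \<open>x\<close> if \<open>b\<close> is true and for the
  inverse of \<open>x\<close> otherwise. Elements of the free group are the reduced words.\<close>

fun reduced_word :: "('x \<times> bool) list \<Rightarrow> bool" where
  "reduced_word [] \<longleftrightarrow> True"
| "reduced_word [a] \<longleftrightarrow> True"
| "reduced_word (a # b # w) \<longleftrightarrow> b \<noteq> (fst a, \<not> snd a) \<and> reduced_word (b # w)"

fun reduced_cons :: "'x \<times> bool \<Rightarrow> ('x \<times> bool) list \<Rightarrow> ('x \<times> bool) list" where
  "reduced_cons a [] = [a]"
| "reduced_cons a (b # w) = (if b = (fst a, \<not> snd a) then w else a # b # w)"

definition free_group :: "'x set \<Rightarrow> ('x \<times> bool) list monoid" where
  "free_group X = \<lparr>carrier = {w. reduced_word w \<and> fst ` set w \<subseteq> X},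
                   monoid.mult = foldr reduced_cons, one = []\<rparr>"

lemma reduced_Cons_D: "reduced_word (a # w) \<Longrightarrow> reduced_word w"
  by (cases w) auto

lemma reduced_reduced_cons: "reduced_word w \<Longrightarrow> reduced_word (reduced_cons a w)"
  by (cases w) (auto dest: reduced_Cons_D)

lemma reduced_cons_inverse:
  assumes "reduced_word w" shows "reduced_cons a (reduced_cons (fst a, \<not> snd a) w) = w"
  using assms by (cases w rule: reduced_word.cases) auto

lemma reduced_foldr: "reduced_word w \<Longrightarrow> reduced_word (foldr reduced_cons v w)"
  by (induction v) (auto simp: reduced_reduced_cons)

lemma foldr_reduced_cons:
  assumes "reduced_word w"
  shows "foldr reduced_cons (reduced_cons a v) w = reduced_cons a (foldr reduced_cons v w)"
proof (cases v)
  case (Cons b u)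
  show ?thesis
  proof (cases "b = (fst a, \<not> snd a)")
    case True
    then show ?thesis
      using Cons reduced_cons_inverse[OF reduced_foldr[OF assms, of u], of a] by simp
  qed (use Cons in auto)
qed auto

lemma foldr_reduced_cons_assoc:
  assumes "reduced_word w"
  shows "foldr reduced_cons (foldr reduced_cons u v) w = foldr reduced_cons u (foldr reduced_cons v w)"
  by (induction u) (auto simp: foldr_reduced_cons assms)

lemma foldr_reduced_cons_Nil: "reduced_word w \<Longrightarrow> foldr reduced_cons w [] = w"
  by (induction w rule: reduced_word.induct) auto

lemma set_reduced_cons: "fst ` set (reduced_cons a w) \<subseteq> insert (fst a) (fst ` set w)"
  by (cases w) auto

lemma set_foldr_reduced_cons: "fst ` set (foldr reduced_cons v w) \<subseteq> fst ` set v \<union> fst ` set w"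
proof (induction v)
  case (Cons a v)
  then show ?case
    using set_reduced_cons[of a "foldr reduced_cons v w"] by (simp del: image_subset_iff) blast
qed auto

lemma ex_inverse_word:
  "\<exists>v. reduced_word v \<and> fst ` set v \<subseteq> fst ` set w \<and> foldr reduced_cons v w = []" if "reduced_word w"
  using that
proof (induction w)
  case (Cons a w)
  then obtain v where v: "reduced_word v" "fst ` set v \<subseteq> fst ` set w" "foldr reduced_cons v w = []"
    using reduced_Cons_D by blast
  let ?a = "(fst a, \<not> snd a)"
  let ?v = "foldr reduced_cons v [?a]"
  have "foldr reduced_cons ?v (a # w) = foldr reduced_cons v (reduced_cons ?a (a # w))"
    using foldr_reduced_cons_assoc[OF Cons.prems, of v "[?a]"] by simp
  also have "\<dots> = []"
    using v by simp
  finally have "foldr reduced_cons ?v (a # w) = []" .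
  moreover have "reduced_word ?v"
    by (simp add: reduced_foldr)
  moreover have "fst ` set ?v \<subseteq> fst ` set (a # w)"
    using set_foldr_reduced_cons[of v "[?a]"] v(2) by auto
  ultimately show ?case
    by blast
qed auto

lemma group_free_group: "group (free_group X)"
proof (rule groupI)
  fix x y z assume "x \<in> carrier (free_group X)" "y \<in> carrier (free_group X)" "z \<in> carrier (free_group X)"
  then show "x \<otimes>\<^bsub>free_group X\<^esub> y \<otimes>\<^bsub>free_group X\<^esub> z = x \<otimes>\<^bsub>free_group X\<^esub> (y \<otimes>\<^bsub>free_group X\<^esub> z)"
    by (simp add: free_group_def foldr_reduced_cons_assoc)
next
  fix x y assume "x \<in> carrier (free_group X)" "y \<in> carrier (free_group X)"
  then show "x \<otimes>\<^bsub>free_group X\<^esub> y \<in> carrier (free_group X)"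
    using set_foldr_reduced_cons[of x y] unfolding free_group_def
    by (simp add: reduced_foldr) blast
next
  fix x assume "x \<in> carrier (free_group X)"
  then show "\<exists>y\<in>carrier (free_group X). y \<otimes>\<^bsub>free_group X\<^esub> x = \<one>\<^bsub>free_group X\<^esub>"
    using ex_inverse_word[of x] by (simp add: free_group_def) blast
qed (auto simp: free_group_def)


section \<open>Profinite completions and topological presentations\<close>

definition finite_index_normal :: "('a, 'b) monoid_scheme \<Rightarrow> 'a set set" where
  "finite_index_normal G = {N. N \<lhd> G \<and> finite (rcosets\<^bsub>G\<^esub> N)}"

text \<open>The inverse limit of the quotients \<^term>\<open>G Mod N\<close>. For \<^prop>\<open>M \<subseteq> N\<close> the transition map
  sends a coset of \<open>M\<close> to the unique coset of \<open>N\<close> containing it, so a family of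
  cosets is compatible iff it is monotone.\<close>

definition profinite_completion ::
    "('a, 'b) monoid_scheme \<Rightarrow> ('a set \<Rightarrow> 'a set) monoid" where
  "profinite_completion G =
     (product_group (finite_index_normal G) (\<lambda>N. G Mod N))
       \<lparr>carrier := {f \<in> \<Pi>\<^sub>E N\<in>finite_index_normal G. rcosets\<^bsub>G\<^esub> N.
           \<forall>M\<in>finite_index_normal G. \<forall>N\<in>finite_index_normal G. M \<subseteq> N \<longrightarrow> f M \<subseteq> f N}\<rparr>"

definition completion_topology :: "('a, 'b) monoid_scheme \<Rightarrow> ('a set \<Rightarrow> 'a set) topology" where
  "completion_topology G =
     subtopology (product_topology (\<lambda>N. discrete_topology (rcosets\<^bsub>G\<^esub> N)) (finite_index_normal G))
       (carrier (profinite_completion G))"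

definition completion_map :: "('a, 'b) monoid_scheme \<Rightarrow> 'a \<Rightarrow> ('a set \<Rightarrow> 'a set)" where
  "completion_map G x = (\<lambda>N\<in>finite_index_normal G. N #>\<^bsub>G\<^esub> x)"

text \<open>For a finite set \<open>X\<close>, the profinite completion of the free group on \<open>X\<close> is the free
  profinite group on \<open>X\<close>.\<close>

type_synonym 'x free_profinite = "('x \<times> bool) list set \<Rightarrow> ('x \<times> bool) list set"

abbreviation free_profinite_group :: "'x set \<Rightarrow> 'x free_profinite monoid" where
  "free_profinite_group X \<equiv> profinite_completion (free_group X)"

abbreviation free_profinite_topology :: "'x set \<Rightarrow> 'x free_profinite topology" where
  "free_profinite_topology X \<equiv> completion_topology (free_group X)"

definition free_profinite_gen :: "'x set \<Rightarrow> 'x \<Rightarrow> 'x free_profinite" where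
  "free_profinite_gen X x = completion_map (free_group X) [(x, True)]"

definition closed_normal_closure ::
    "('a, 'b) monoid_scheme \<Rightarrow> 'a topology \<Rightarrow> 'a set \<Rightarrow> 'a set" where
  "closed_normal_closure G T R = \<Inter>{N. N \<lhd> G \<and> closedin T N \<and> R \<subseteq> N}"

text \<open>\<open>G\<close> has the topological presentation with finite generating set \<open>X\<close> and relators \<open>R\<close>. By
  compactness, the bijective homomorphism from the quotient of the free profinite group onto \<open>G\<close>
  induced by \<open>p\<close> is a homeomorphism when \<open>G\<close> is profinite.\<close>

definition topological_presentation ::
    "('a, 'b) monoid_scheme \<Rightarrow> 'a topology \<Rightarrow> 'x set \<Rightarrow> 'x free_profinite set \<Rightarrow> bool" where
  "topological_presentation G T X R \<longleftrightarrow>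
     (\<exists>p. p \<in> epi (free_profinite_group X) G \<and>
          continuous_map (free_profinite_topology X) T p \<and>
          kernel (free_profinite_group X) G p =
            closed_normal_closure (free_profinite_group X) (free_profinite_topology X) R)"


section \<open>Profinite F-groups\<close>

text \<open>Indices start at 0.\<close>

datatype F_gen = Alpha nat | Beta nat | Gamma nat | Delta nat

definition F_gens :: "nat \<Rightarrow> nat \<Rightarrow> nat \<Rightarrow> F_gen set" where
  "F_gens g r s = Alpha ` {..<g} \<union> Beta ` {..<g} \<union> Gamma ` {..<r} \<union> Delta ` {..<s}"

definition commutator :: "('a, 'b) monoid_scheme \<Rightarrow> 'a \<Rightarrow> 'a \<Rightarrow> 'a" where
  "commutator G x y = x \<otimes>\<^bsub>G\<^esub> y \<otimes>\<^bsub>G\<^esub> inv\<^bsub>G\<^esub> x \<otimes>\<^bsub>G\<^esub> inv\<^bsub>G\<^esub> y"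

definition F_relators :: "nat \<Rightarrow> nat \<Rightarrow> nat list \<Rightarrow> F_gen free_profinite set" where
  "F_relators g r ns =
    (let s = length ns;
         F = free_profinite_group (F_gens g r s);
         gen = free_profinite_gen (F_gens g r s)
     in insert
          (foldr (\<otimes>\<^bsub>F\<^esub>)
             (map (\<lambda>i. commutator F (gen (Alpha i)) (gen (Beta i))) [0..<g]
              @ map (\<lambda>j. gen (Gamma j)) [0..<r]
              @ map (\<lambda>l. gen (Delta l)) [0..<s])
             \<one>\<^bsub>F\<^esub>)
          {gen (Delta l) [^]\<^bsub>F\<^esub> (ns ! l) | l. l < s})"

definition F_presentation ::
    "('a, 'b) monoid_scheme \<Rightarrow> 'a topology \<Rightarrow> nat \<Rightarrow> nat \<Rightarrow> nat list \<Rightarrow> bool" where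
  "F_presentation G T g r ns \<longleftrightarrow>
     (\<forall>n\<in>set ns. 2 \<le> n) \<and>
     topological_presentation G T (F_gens g r (length ns)) (F_relators g r ns)"

definition profinite_F_group :: "('a, 'b) monoid_scheme \<Rightarrow> 'a topology \<Rightarrow> bool" where
  "profinite_F_group G T \<longleftrightarrow> profinite_group G T \<and> (\<exists>g r ns. F_presentation G T g r ns)"

definition hyperbolic_profinite_F_group :: "('a, 'b) monoid_scheme \<Rightarrow> 'a topology \<Rightarrow> bool" where
  "hyperbolic_profinite_F_group G T \<longleftrightarrow> profinite_F_group G T \<and>
     (\<exists>g r ns. F_presentation G T g r ns \<and>
        2 - 2 * real g - real r - (\<Sum>n\<leftarrow>ns. 1 - 1 / real n) < 0)"

end

theory Submission
  imports Defs "HOL-Library.Function_Algebras" "HOL-Algebra.Weak_Morphisms"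
    "HOL-Algebra.Multiplicative_Group" "HOL-Algebra.Elementary_Groups" "HOL-Algebra.Zassenhaus"
begin

text \<open>It suffices to find, for every \<open>k\<close>, a finite solvable quotient of \<open>\<Delta>\<close> of derived length at least
  \<open>k\<close>: a continuous surjection onto a discrete group \<open>S\<close> maps \<open>\<Delta>\<^sup>(\<^sup>m\<^sup>)\<close> onto \<open>S\<^sup>(\<^sup>m\<^sup>)\<close>, so the
  derived series of \<open>\<Delta>\<close> never becomes stationary, and \<open>\<Delta>/\<Delta>\<^sup>(\<^sup>k\<^sup>)\<close> has derived length \<open>k\<close>.

  A finite quotient is a generating tuple of a finite group satisfying the defining relations. Let \<open>S\<close>
  be a solvable quotient in which each \<open>\<delta>\<^sub>l\<close> has order exactly \<open>n\<^sub>l\<close>, let \<open>A\<close> be the last nontrivial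
  term of its derived series, \<open>q\<close> prime to \<open>|S|\<close>, and \<open>M\<close> the part of \<open>(\<int>/q)[S]\<close> killed by the norm
  of \<open>A\<close>. Tuples in \<open>M \<rtimes> S\<close> above the given one in which \<open>\<delta>\<^sub>l\<close> is replaced by an \<open>M\<close>-conjugate keep
  the orders, and the product relation is a single linear condition with values in \<open>M\<close>. As
  \<open>|M\<^sup>\<delta>| \<le> |M|\<^sup>1\<^sup>/\<^sup>n\<close> for \<open>\<delta>\<close> of order \<open>n\<close>, hyperbolicity leaves more than \<open>|M|\<close> solutions, so one of them is
  not conjugate to the given tuple under \<open>M\<close>. Since \<open>M\<^sup>A = 0\<close> and \<open>H\<^sup>1(A, M) = 0\<close>, the group generated by
  that solution has larger derived length.

  To start, take a cyclic quotient, which exists unless \<open>g = r = 0\<close> and the \<open>n\<^sub>l\<close> are pairwise coprime,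
  when \<open>\<Delta>\<close> is perfect. The order of \<open>\<delta>\<^sub>k\<close> is multiplied by \<open>q\<close> inside \<open>(\<int>/q)[S] \<rtimes> S\<close>: if
  \<open>y \<notin> \<langle>\<delta>\<^sub>k\<rangle>\<close>, replace \<open>\<delta>\<^sub>k\<close> by \<open>(1 - y) \<delta>\<^sub>k\<close>; the error in the product relation lies in the augmentation
  ideal, hence can be corrected by conjugating the other generators.\<close>


section \<open>The group of rationals modulo integers\<close>

text \<open>A single type that contains cyclic groups of every order.\<close>

quotient_type circ = rat / "\<lambda>x y::rat. x - y \<in> \<int>"
proof (rule equivpI)
  show "reflp (\<lambda>x y::rat. x - y \<in> \<int>)" by (simp add: reflp_def)
  show "symp (\<lambda>x y::rat. x - y \<in> \<int>)"
    unfolding symp_def using Ints_minus by fastforce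
  show "transp (\<lambda>x y::rat. x - y \<in> \<int>)"
    unfolding transp_def using Ints_add by fastforce
qed

instantiation circ :: ab_group_add
begin
lift_definition zero_circ :: circ is 0 .
lift_definition plus_circ :: "circ \<Rightarrow> circ \<Rightarrow> circ" is "(+)"
  using Ints_add by (metis add_diff_add)
lift_definition uminus_circ :: "circ \<Rightarrow> circ" is uminus
  using Ints_minus by fastforce
lift_definition minus_circ :: "circ \<Rightarrow> circ \<Rightarrow> circ" is "(-)"
  by (metis Ints_diff add_diff_add diff_conv_add_uminus minus_add_distrib minus_diff_eq)
instance
  by standard (transfer; simp)+
end

lift_definition smul :: "nat \<Rightarrow> circ \<Rightarrow> circ" is "\<lambda>n x. of_nat n * x"
  by (metis Ints_mult Ints_of_nat right_diff_distrib)

lemma smul_0 [simp]: "smul 0 c = 0"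
  by transfer simp

lemma smul_zero [simp]: "smul n 0 = 0"
  by transfer simp

lemma smul_Suc: "smul (Suc n) c = c + smul n c"
  by transfer (simp add: algebra_simps)

lemma smul_add: "smul n (b + c) = smul n b + smul n c"
  by transfer (simp add: algebra_simps)

lemma smul_diff: "smul n (b - c) = smul n b - smul n c"
  by transfer (simp add: algebra_simps)

lemma smul_minus: "smul n (- c) = - smul n c"
  by transfer simp

lemma smul_mult: "smul (m * n) c = smul m (smul n c)"
  by transfer (simp add: algebra_simps)

lemma smul_sum: "smul n (\<Sum>i\<in>I. f i) = (\<Sum>i\<in>I. smul n (f i))"
  by (induction I rule: infinite_finite_induct) (simp_all add: smul_add)

lemma sum_const_circ: "(\<Sum>i\<in>I. c) = smul (card I) (c :: circ)"
  by (induction I rule: infinite_finite_induct) (simp_all add: smul_Suc)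

text \<open>For positive q this is a copy of Z/q inside Q/Z. All moduli share one type, so q can
  change from step to step.\<close>

definition tors :: "nat \<Rightarrow> circ set" where
  "tors q = {c. smul q c = 0}"

lift_definition unit_frac :: "nat \<Rightarrow> circ" is "\<lambda>q. 1 / of_nat q" .

lemma abs_circ_eq_0_iff: "abs_circ x = 0 \<longleftrightarrow> x \<in> \<int>"
  by (simp add: zero_circ_def circ.abs_eq_iff)

lemma smul_abs_circ: "smul n (abs_circ x) = abs_circ (of_nat n * x)"
  by (simp add: smul.abs_eq)

lemma of_nat_div_in_Ints_iff:
  "q > 0 \<Longrightarrow> (of_nat n / of_nat q :: rat) \<in> \<int> \<longleftrightarrow> q dvd n"
proof
  assume q: "q > 0" and "(of_nat n / of_nat q :: rat) \<in> \<int>"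
  then obtain z where "(of_nat n / of_nat q :: rat) = of_int z"
    by (auto elim: Ints_cases)
  then have "(of_int (int n) :: rat) = of_int (z * int q)"
    using q by (simp add: field_simps)
  then have "int n = z * int q"
    by (simp only: of_int_eq_iff)
  then show "q dvd n"
    by (metis dvd_triv_right int_dvd_int_iff)
next
  assume "q > 0" "q dvd n"
  then show "(of_nat n / of_nat q :: rat) \<in> \<int>"
    by (auto elim!: dvdE)
qed

lemma smul_unit_frac_eq_0_iff: "q > 0 \<Longrightarrow> smul n (unit_frac q) = 0 \<longleftrightarrow> q dvd n"
  by (simp add: unit_frac_def smul_abs_circ abs_circ_eq_0_iff of_nat_div_in_Ints_iff)

lemma unit_frac_in_tors: "q > 0 \<Longrightarrow> unit_frac q \<in> tors q"
  by (simp add: tors_def smul_unit_frac_eq_0_iff)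

lemma tors_closed:
  "0 \<in> tors q" "a \<in> tors q \<Longrightarrow> b \<in> tors q \<Longrightarrow> a + b \<in> tors q"
  "a \<in> tors q \<Longrightarrow> b \<in> tors q \<Longrightarrow> a - b \<in> tors q"
  "a \<in> tors q \<Longrightarrow> - a \<in> tors q" "a \<in> tors q \<Longrightarrow> smul n a \<in> tors q"
  by (auto simp: tors_def smul_add smul_diff smul_minus simp flip: smul_mult)
     (simp add: mult.commute smul_mult)

text \<open>If q x is an integer z, then x is (z mod q)/q up to an integer; injectivity holds
  because \<open>unit_frac q\<close> has order exactly q.\<close>

lemma bij_betw_tors:
  assumes "q > 0"
  shows "bij_betw (\<lambda>j. smul j (unit_frac q)) {..<q} (tors q)"
proof (rule bij_betw_imageI)
  show "inj_on (\<lambda>j. smul j (unit_frac q)) {..<q}"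
  proof (rule linorder_inj_onI)
    fix i j assume ij: "i < j" "i \<in> {..<q}" "j \<in> {..<q}"
    have "smul j (unit_frac q) = smul (j - i) (unit_frac q) + smul i (unit_frac q)"
      using ij(1) by (simp add: unit_frac_def smul_abs_circ plus_circ.abs_eq of_nat_diff algebra_simps
        flip: add_divide_distrib diff_divide_distrib)
    moreover have "\<not> q dvd j - i"
      using ij by (auto dest!: dvd_imp_le)
    ultimately show "smul i (unit_frac q) \<noteq> smul j (unit_frac q)"
      using assms by (simp add: smul_unit_frac_eq_0_iff)
  qed auto
  show "(\<lambda>j. smul j (unit_frac q)) ` {..<q} = tors q"
  proof (intro equalityI subsetI)
    fix c assume c: "c \<in> tors q"
    obtain x where x: "c = abs_circ x"
      by (metis Quotient_circ Quotient_abs_rep)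
    from c have "of_nat q * x \<in> \<int>"
      by (simp add: tors_def x smul_abs_circ abs_circ_eq_0_iff)
    then obtain z where z: "of_nat q * x = of_int z"
      by (auto elim: Ints_cases)
    define j where "j = nat (z mod int q)"
    have j: "j < q" "int j = z mod int q"
      using assms by (simp_all add: j_def nat_less_iff)
    have "of_int z = (of_nat j + of_nat q * of_int (z div int q) :: rat)"
      using j(2) mult_div_mod_eq[of "int q" z]
      by (metis add.commute of_int_add of_int_mult of_int_of_nat_eq)
    then have "x = of_nat j / of_nat q + of_int (z div int q)"
      using z assms by (simp add: field_simps)
    then have "c = smul j (unit_frac q)"
      by (simp add: x unit_frac_def smul_abs_circ circ.abs_eq_iff)
    then show "c \<in> (\<lambda>j. smul j (unit_frac q)) ` {..<q}"
      using j by blast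
  qed (use assms in \<open>auto simp: tors_closed unit_frac_in_tors\<close>)
qed

lemma card_tors: "q > 0 \<Longrightarrow> card (tors q) = q"
  using bij_betw_same_card[OF bij_betw_tors] by simp

lemma finite_tors: "q > 0 \<Longrightarrow> finite (tors q)"
  using bij_betw_finite[OF bij_betw_tors] by simp

section \<open>Semidirect products and Fox derivatives\<close>

text \<open>\<open>M\<close> is a subset of a type and \<open>act\<close> is additive on the whole
  type, so a submodule can reuse the same \<open>act\<close>. The identity acts trivially only on
  \<open>M\<close>, because translation of functions will erase values outside the group.\<close>

locale group_action_on_module = group S for S :: "('s, 'b) monoid_scheme" (structure) +
  fixes M :: "'m::ab_group_add set" and act :: "'s \<Rightarrow> 'm \<Rightarrow> 'm"
  assumes zero_closed [simp]: "0 \<in> M"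
    and diff_closed [simp]: "\<lbrakk>f \<in> M; g \<in> M\<rbrakk> \<Longrightarrow> f - g \<in> M"
    and act_closed [simp]: "\<lbrakk>s \<in> carrier S; f \<in> M\<rbrakk> \<Longrightarrow> act s f \<in> M"
    and act_add: "act s (f + g) = act s f + act s g"
    and act_mult: "\<lbrakk>s \<in> carrier S; t \<in> carrier S\<rbrakk> \<Longrightarrow> act (s \<otimes> t) f = act s (act t f)"
    and act_one [simp]: "f \<in> M \<Longrightarrow> act \<one> f = f"
begin

lemma minus_closed [simp]: "f \<in> M \<Longrightarrow> - f \<in> M"
  using diff_closed[OF zero_closed] by simp

lemma add_closed [simp]: "\<lbrakk>f \<in> M; g \<in> M\<rbrakk> \<Longrightarrow> f + g \<in> M"
  using diff_closed[of f "- g"] by simp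

lemma act_zero [simp]: "act s 0 = 0"
  using act_add[of s 0 0] by simp

lemma act_minus: "act s (- f) = - act s f"
  using act_add[of s f "- f"] by (simp add: eq_neg_iff_add_eq_0 add.commute)

lemma act_diff: "act s (f - g) = act s f - act s g"
  using act_add[of s f "- g"] by (simp add: act_minus)

definition sd :: "('m \<times> 's) monoid" where
  "sd = \<lparr>carrier = M \<times> carrier S,
         monoid.mult = \<lambda>x y. (fst x + act (snd x) (fst y), snd x \<otimes> snd y), one = (0, \<one>)\<rparr>"

lemma carrier_sd [simp]: "carrier sd = M \<times> carrier S"
  and one_sd [simp]: "\<one>\<^bsub>sd\<^esub> = (0, \<one>)"
  and mult_sd [simp]: "x \<otimes>\<^bsub>sd\<^esub> y = (fst x + act (snd x) (fst y), snd x \<otimes> snd y)"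
  by (simp_all add: sd_def)

lemma act_inv_cancel [simp]:
  "\<lbrakk>s \<in> carrier S; f \<in> M\<rbrakk> \<Longrightarrow> act s (act (inv s) f) = f"
  "\<lbrakk>s \<in> carrier S; f \<in> M\<rbrakk> \<Longrightarrow> act (inv s) (act s f) = f"
  using act_mult[of s "inv s" f] act_mult[of "inv s" s f] by simp_all

lemma group_sd: "group sd"
proof (rule groupI)
  fix x assume "x \<in> carrier sd"
  then show "\<exists>y\<in>carrier sd. y \<otimes>\<^bsub>sd\<^esub> x = \<one>\<^bsub>sd\<^esub>"
    by (intro bexI[of _ "(- act (inv (snd x)) (fst x), inv (snd x))"]) auto
qed (auto simp: act_add act_mult m_assoc add.assoc)

lemma inv_sd: "\<lbrakk>f \<in> M; s \<in> carrier S\<rbrakk> \<Longrightarrow> inv\<^bsub>sd\<^esub> (f, s) = (- act (inv s) f, inv s)"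
  by (rule group.inv_equality[OF group_sd]) auto

lemma hom_snd: "snd \<in> hom sd S"
  by (auto simp: hom_def)

lemma group_hom_snd: "group_hom sd S snd"
  by (simp add: group_hom_def group_hom_axioms_def group_sd hom_snd group_axioms)

text \<open>The pair \<open>(f - act s f, s)\<close> is the conjugate of \<open>(0, s)\<close> by
  \<open>(f, \<one>)\<close>, and conjugation commutes with powers.\<close>

lemma conj_pow:
  assumes "s \<in> carrier S" "f \<in> M"
  shows "(f - act s f, s) [^]\<^bsub>sd\<^esub> (n::nat) = (f - act (s [^] n) f, s [^] n)"
  using assms by (induction n) (simp_all add: act_diff act_mult act_add group_sd)

lemma conj_pow_eq_one_iff:
  assumes "s \<in> carrier S" "f \<in> M"
  shows "(f - act s f, s) [^]\<^bsub>sd\<^esub> (n::nat) = \<one>\<^bsub>sd\<^esub> \<longleftrightarrow> s [^] n = \<one>"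
  using assms by (auto simp: conj_pow)

end

text \<open>Cuts the product relation into blocks: a whole commutator is attached to
  \<open>Alpha i\<close>, so that each block occurs only once.\<close>

fun factor :: "('a, 'b) monoid_scheme \<Rightarrow> (F_gen \<Rightarrow> 'a) \<Rightarrow> F_gen \<Rightarrow> 'a" where
  "factor G x (Alpha i) = commutator G (x (Alpha i)) (x (Beta i))"
| "factor G x (Beta i) = x (Beta i)"
| "factor G x (Gamma i) = x (Gamma i)"
| "factor G x (Delta i) = x (Delta i)"

definition eval_word :: "('a, 'b) monoid_scheme \<Rightarrow> (F_gen \<Rightarrow> 'a) \<Rightarrow> F_gen list \<Rightarrow> 'a" where
  "eval_word G x ws = foldr (\<otimes>\<^bsub>G\<^esub>) (map (factor G x) ws) \<one>\<^bsub>G\<^esub>"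

lemma eval_word_Nil [simp]: "eval_word G x [] = \<one>\<^bsub>G\<^esub>"
  and eval_word_Cons [simp]: "eval_word G x (w # ws) = factor G x w \<otimes>\<^bsub>G\<^esub> eval_word G x ws"
  by (simp_all add: eval_word_def)

text \<open>A commutator \<open>[\<alpha>\<^sub>i, \<beta>\<^sub>i]\<close> is abbreviated by the single letter \<open>Alpha i\<close>.\<close>

definition relator_word :: "nat \<Rightarrow> nat \<Rightarrow> nat \<Rightarrow> F_gen list" where
  "relator_word g r s = map Alpha [0..<g] @ map Gamma [0..<r] @ map Delta [0..<s]"

lemma (in group) commutator_closed [simp]:
  "\<lbrakk>a \<in> carrier G; b \<in> carrier G\<rbrakk> \<Longrightarrow> commutator G a b \<in> carrier G"
  by (simp add: commutator_def)

lemma (in group) factor_closed [simp]: "range x \<subseteq> carrier G \<Longrightarrow> factor G x w \<in> carrier G"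
  by (cases w) (auto simp: image_subset_iff)

lemma (in group) eval_word_closed [simp]: "range x \<subseteq> carrier G \<Longrightarrow> eval_word G x ws \<in> carrier G"
  by (induction ws) auto

lemma (in group_hom) hom_commutator:
  "\<lbrakk>a \<in> carrier G; b \<in> carrier G\<rbrakk> \<Longrightarrow> h (commutator G a b) = commutator H (h a) (h b)"
  by (simp add: commutator_def)

lemma (in group_hom) hom_factor: "range x \<subseteq> carrier G \<Longrightarrow> h (factor G x w) = factor H (h \<circ> x) w"
  by (cases w) (auto simp: image_subset_iff hom_commutator)

lemma (in group_hom) hom_eval_word:
  "range x \<subseteq> carrier G \<Longrightarrow> h (eval_word G x ws) = eval_word H (h \<circ> x) ws"
  by (induction ws) (simp_all add: hom_factor)

section \<open>Fox derivatives of the product relation\<close>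

context group_action_on_module
begin

text \<open>For the commutator of a and b the Fox derivatives are \<open>1 - a b a^-1\<close> with
  respect to a and \<open>a - [a,b]\<close> with respect to b.\<close>

fun fox_factor :: "(F_gen \<Rightarrow> 's) \<Rightarrow> (F_gen \<Rightarrow> 'm) \<Rightarrow> F_gen \<Rightarrow> 'm" where
  "fox_factor s v (Alpha i) =
     v (Alpha i) - act (s (Alpha i) \<otimes> s (Beta i) \<otimes> inv (s (Alpha i))) (v (Alpha i))
     + (act (s (Alpha i)) (v (Beta i)) - act (commutator S (s (Alpha i)) (s (Beta i))) (v (Beta i)))"
| "fox_factor s v (Beta i) = v (Beta i)"
| "fox_factor s v (Gamma i) = v (Gamma i)"
| "fox_factor s v (Delta i) = v (Delta i)"

text \<open>The product rule d(u w) = du + u dw, applied block by block.\<close>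

fun fox :: "(F_gen \<Rightarrow> 's) \<Rightarrow> (F_gen \<Rightarrow> 'm) \<Rightarrow> F_gen list \<Rightarrow> 'm" where
  "fox s v [] = 0"
| "fox s v (w # ws) = fox_factor s v w + act (factor S s w) (fox s v ws)"

lemma fox_factor_add: "fox_factor s (v + v') w = fox_factor s v w + fox_factor s v' w"
  by (cases w) (simp_all add: act_add)

lemma fox_add: "fox s (v + v') ws = fox s v ws + fox s v' ws"
  by (induction ws) (simp_all only: fox.simps act_add fox_factor_add add_0 add.assoc add.left_commute)

lemma fox_zero [simp]: "fox s 0 ws = 0"
  using fox_add[of s 0 0 ws] by simp

lemma fox_minus: "fox s (- v) ws = - fox s v ws"
  using fox_add[of s v "- v" ws] by (simp add: eq_neg_iff_add_eq_0 add.commute)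

lemma fox_diff: "fox s (v - v') ws = fox s v ws - fox s v' ws"
  using fox_add[of s v "- v'" ws] by (simp add: fox_minus)

context
  fixes s :: "F_gen \<Rightarrow> 's" and v :: "F_gen \<Rightarrow> 'm"
  assumes s: "range s \<subseteq> carrier S" and v: "range v \<subseteq> M"
begin

lemma s_closed [simp]: "s y \<in> carrier S" and v_closed [simp]: "v y \<in> M"
  using s v by auto

lemma fox_factor_closed [simp]: "fox_factor s v w \<in> M"
  by (cases w) simp_all

lemma fox_closed [simp]: "fox s v ws \<in> M"
  by (induction ws) (simp_all add: s)

lemma factor_sd: "factor sd (\<lambda>y. (v y, s y)) w = (fox_factor s v w, factor S s w)"
proof (cases w)
  case (Alpha i)
  then show ?thesis
    by (simp add: commutator_def inv_sd act_minus act_mult)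
qed simp_all

text \<open>Lifting a solution of the product relation from \<open>S\<close> thus amounts to the
  condition \<open>fox s v ws = 0\<close>, which is additive in \<open>v\<close>.\<close>

lemma eval_word_sd: "eval_word sd (\<lambda>y. (v y, s y)) ws = (fox s v ws, eval_word S s ws)"
  by (induction ws) (simp_all add: factor_sd)

end

end

section \<open>Finite quotients as generating systems\<close>

text \<open>The divisibility clause says that the l-th elliptic generator has order exactly
  \<open>os ! l\<close>; during the construction \<open>os\<close> may contain proper divisors of
  the target orders. Letters outside the generating set go to the identity, so
  \<open>range s\<close> generates the same subgroup as the actual generators.\<close>

definition system ::
    "('s, 'b) monoid_scheme \<Rightarrow> nat \<Rightarrow> nat \<Rightarrow> nat list \<Rightarrow> (F_gen \<Rightarrow> 's) \<Rightarrow> bool" where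
  "system S g r os s \<longleftrightarrow> group S \<and> finite (carrier S) \<and> range s \<subseteq> carrier S \<and>
     (\<forall>y. y \<notin> F_gens g r (length os) \<longrightarrow> s y = \<one>\<^bsub>S\<^esub>) \<and>
     eval_word S s (relator_word g r (length os)) = \<one>\<^bsub>S\<^esub> \<and>
     (\<forall>l<length os. \<forall>n. s (Delta l) [^]\<^bsub>S\<^esub> (n::nat) = \<one>\<^bsub>S\<^esub> \<longleftrightarrow> os ! l dvd n)"

definition generating :: "('s, 'b) monoid_scheme \<Rightarrow> (F_gen \<Rightarrow> 's) \<Rightarrow> bool" where
  "generating S s \<longleftrightarrow> generate S (range s) = carrier S"

text \<open>An injective homomorphism preserves and reflects equations, hence also exact orders.
  This serves both for shrinking the ambient group and for renaming its elements.\<close>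

lemma system_group_hom:
  assumes "group_hom G H h" "inj_on h (carrier G)" "finite (carrier H)" "range x \<subseteq> carrier G"
  shows "system H g r os (h \<circ> x) \<longleftrightarrow> system G g r os x"
proof -
  interpret group_hom G H h by fact
  have fin: "finite (carrier G)"
    using assms(2,3) finite_imageD finite_subset hom_closed by (metis image_subsetI)
  have xc: "x y \<in> carrier G" for y
    using assms(4) by auto
  have one: "h z = \<one>\<^bsub>H\<^esub> \<longleftrightarrow> z = \<one>\<^bsub>G\<^esub>" if "z \<in> carrier G" for z
    using assms(2) that inj_on_eq_iff[OF assms(2) that G.one_closed] by simp
  have pow: "h (x y) [^]\<^bsub>H\<^esub> n = h (x y [^]\<^bsub>G\<^esub> (n::nat))" for y n
    using xc by (simp add: hom_nat_pow)
  have ev: "eval_word H (h \<circ> x) ws = h (eval_word G x ws)" for ws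
    using hom_eval_word[OF assms(4)] by simp
  have "range (h \<circ> x) \<subseteq> carrier H"
    using xc by auto
  then show ?thesis
    unfolding system_def ev using assms(3,4) fin xc
    by (simp add: pow one)
qed

text \<open>A semidirect product has a larger carrier type; moving back to \<^typ>\<open>nat\<close> makes extensions iterable.\<close>

lemma system_transport:
  fixes G :: "('a, 'b) monoid_scheme"
  assumes sys: "system G g r os x"
  obtains S :: "nat monoid" and y where "system S g r os y" "generating S y"
    "card (carrier S) = card (generate G (range x))"
    "\<And>n. (derived S ^^ n) (carrier S) = {\<one>\<^bsub>S\<^esub>} \<longleftrightarrow> (derived G ^^ n) (generate G (range x)) = {\<one>\<^bsub>G\<^esub>}"
proof -
  interpret G: group G using sys by (simp add: system_def)
  define H where "H = generate G (range x)"
  have xc: "range x \<subseteq> carrier G" and fin: "finite (carrier G)"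
    using sys by (auto simp: system_def)
  have H: "subgroup H G"
    unfolding H_def by (rule G.generate_is_subgroup[OF xc])
  have finH: "finite H"
    using fin H subgroup.subset finite_subset by metis
  define K where "K = G\<lparr>carrier := H\<rparr>"
  have K: "group K"
    unfolding K_def by (rule G.subgroup_imp_group[OF H])
  interpret K: group K by fact
  obtain f :: "'a \<Rightarrow> nat" where f: "inj_on f H"
    using finite_imp_inj_to_nat_seg[OF finH] by blast
  define S where "S = image_group f K"
  have "f \<in> iso K (image_group f K) \<and> group (image_group f K)"
  proof -
    have cK: "carrier K = H" by (simp add: K_def)
    have S: "carrier S = f ` H" "\<one>\<^bsub>S\<^esub> = f \<one>\<^bsub>K\<^esub>"
      "\<And>a b. a \<in> H \<Longrightarrow> b \<in> H \<Longrightarrow> f a \<otimes>\<^bsub>S\<^esub> f b = f (a \<otimes>\<^bsub>K\<^esub> b)"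
      using f by (auto simp: S_def image_group_def cK)
    have iso: "f \<in> iso K S"
      using f by (intro isoI homI) (auto simp: S cK bij_betw_def)
    have "group S"
      using K.iso_imp_img_group[OF iso] unfolding S(2)[symmetric] by simp
    then show ?thesis using iso by (simp add: S_def)
  qed
  then have iso: "f \<in> iso K S" and gS: "group S"
    by (simp_all add: S_def)
  interpret f: group_hom K S f
    using iso gS K by (simp add: group_hom_def group_hom_axioms_def iso_def)
  have fK: "f ` carrier K = carrier S" "inj_on f (carrier K)"
    using iso by (auto simp: iso_def bij_betw_def)
  have cK [simp]: "carrier K = H" by (simp add: K_def)
  have xH: "range x \<subseteq> H"
    unfolding H_def using generate.incl by (metis subsetI)
  have finS: "finite (carrier S)"
    using finH fK(1) by (metis cK finite_imageI)
  have idhom: "group_hom K G id"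
    using K H by (auto simp: group_hom_def group_hom_axioms_def G.group_axioms hom_def K_def subgroup.mem_carrier)
  have "system K g r os x"
    using system_group_hom[OF idhom _ fin, of x g r os] xH sys by simp
  then have sS: "system S g r os (f \<circ> x)"
    using system_group_hom[OF f.group_hom_axioms fK(2) finS, of x g r os] xH by simp
  have gen: "generating S (f \<circ> x)"
    unfolding generating_def image_comp[symmetric] using xH H
    by (simp add: f.generate_img fK(1)[symmetric] K_def G.generate_consistent H_def[symmetric])
  have card: "card (carrier S) = card H"
    using fK card_image by fastforce
  have der: "(derived S ^^ n) (carrier S) = f ` ((derived G ^^ n) H)" for n
  proof -
    have "(derived K ^^ n) H = (derived G ^^ n) H"
    proof (induction n)
      case (Suc n)
      have "(derived G ^^ n) H \<subseteq> H"
        by (induction n) (auto intro: G.derived_incl[OF _ H, THEN subsetD])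
      then show ?case
        using Suc by (simp add: K_def G.derived_consistent[OF _ H])
    qed simp
    then show ?thesis
      using f.exp_of_derived_img[of H n] fK by simp
  qed
  have sub: "(derived G ^^ n) H \<subseteq> H" for n
    by (induction n) (auto intro: G.derived_incl[OF _ H, THEN subsetD])
  have "(derived S ^^ n) (carrier S) = {\<one>\<^bsub>S\<^esub>} \<longleftrightarrow> (derived G ^^ n) H = {\<one>\<^bsub>G\<^esub>}" for n
  proof -
    have "\<one>\<^bsub>S\<^esub> = f \<one>\<^bsub>G\<^esub>"
      using f.hom_one by (simp add: K_def)
    then have "f ` ((derived G ^^ n) H) = {\<one>\<^bsub>S\<^esub>} \<longleftrightarrow> f ` ((derived G ^^ n) H) = f ` {\<one>\<^bsub>G\<^esub>}"
      by simp
    also have "\<dots> \<longleftrightarrow> (derived G ^^ n) H = {\<one>\<^bsub>G\<^esub>}"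
      using fK(2) sub subgroup.one_closed[OF H] by (intro inj_on_image_eq_iff[of _ H]) auto
    finally show ?thesis by (simp add: der)
  qed
  with sS gen card show thesis
    by (intro that) (auto simp: H_def)
qed

section \<open>Lifting generating systems\<close>

fun letters :: "F_gen \<Rightarrow> F_gen set" where
  "letters (Alpha i) = {Alpha i, Beta i}"
| "letters (Beta i) = {Beta i}"
| "letters (Gamma i) = {Gamma i}"
| "letters (Delta i) = {Delta i}"

definition word_letters :: "F_gen list \<Rightarrow> F_gen set" where
  "word_letters ws = (\<Union>w\<in>set ws. letters w)"

lemma word_letters_simps [simp]:
  "word_letters [] = {}" "word_letters (w # ws) = letters w \<union> word_letters ws"
  by (auto simp: word_letters_def)

lemma word_letters_relator_word: "word_letters (relator_word g r s) = F_gens g r s"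
  by (auto simp: word_letters_def relator_word_def F_gens_def)

lemma finite_F_gens [simp]: "finite (F_gens g r s)"
  by (simp add: F_gens_def)

text \<open>Each generator belongs to at most one block: \<open>Alpha i\<close> already accounts for
  \<open>Beta i\<close>, which is therefore excluded as a block of its own.\<close>

definition separated :: "F_gen list \<Rightarrow> bool" where
  "separated ws \<longleftrightarrow> distinct ws \<and> (\<forall>i. Beta i \<notin> set ws)"

lemma separated_relator_word: "separated (relator_word g r s)"
  by (auto simp: separated_def relator_word_def distinct_map inj_on_def)

lemma separated_Cons:
  "separated (w # ws) \<Longrightarrow> separated ws \<and> letters w \<inter> word_letters ws = {} \<and> (\<forall>i. w \<noteq> Beta i)"
proof -
  assume sep: "separated (w # ws)"
  have "letters w \<inter> letters w' = {}" if "w' \<in> set ws" for w'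
    using sep that by (cases w; cases w') (auto simp: separated_def)
  then show ?thesis
    using sep by (auto simp: separated_def word_letters_def)
qed

lemma (in group) inv_cancel:
  "\<lbrakk>x \<in> carrier G; y \<in> carrier G\<rbrakk> \<Longrightarrow> inv x \<otimes> (x \<otimes> y) = y"
  "\<lbrakk>x \<in> carrier G; y \<in> carrier G\<rbrakk> \<Longrightarrow> x \<otimes> (inv x \<otimes> y) = y"
  by (simp_all flip: m_assoc)

lemma factor_in_subgroup:
  "\<lbrakk>subgroup H G; \<And>y. y \<in> letters w \<Longrightarrow> x y \<in> H\<rbrakk> \<Longrightarrow> factor G x w \<in> H"
  by (cases w) (simp_all add: commutator_def subgroup.m_closed subgroup.m_inv_closed)

context group_action_on_module
begin

text \<open>The elements \<open>(m - s m, s)\<close> are the \<open>M\<close>-conjugates of \<open>s\<close>, so lifts preserve the orders of the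
  elliptic generators.\<close>

definition lifts :: "(F_gen \<Rightarrow> 's) \<Rightarrow> F_gen set \<Rightarrow> (F_gen \<Rightarrow> 'm) set" where
  "lifts s X = {v. (\<forall>y. v y \<in> M) \<and> (\<forall>y. y \<notin> X \<longrightarrow> v y = 0) \<and>
     (\<forall>l. v (Delta l) \<in> (\<lambda>m. m - act (s (Delta l)) m) ` M)}"

lemma liftsI:
  assumes "\<And>y. v y \<in> M" "\<And>y. y \<notin> X \<Longrightarrow> v y = 0"
    "\<And>l. v (Delta l) \<in> (\<lambda>m. m - act (s (Delta l)) m) ` M"
  shows "v \<in> lifts s X"
  using assms by (simp add: lifts_def)

lemma liftsD:
  assumes "v \<in> lifts s X"
  shows "v y \<in> M" "y \<notin> X \<Longrightarrow> v y = 0" "v (Delta l) \<in> (\<lambda>m. m - act (s (Delta l)) m) ` M"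
  using assms unfolding lifts_def by blast+

lemma lifts_zero [simp]: "0 \<in> lifts s X"
  by (intro liftsI image_eqI[of _ _ 0]) simp_all

lemma lifts_diff:
  assumes v: "v \<in> lifts s X" "v' \<in> lifts s X"
  shows "v - v' \<in> lifts s X"
proof (rule liftsI)
  fix l
  obtain m m' where m: "m \<in> M" "v (Delta l) = m - act (s (Delta l)) m"
    "m' \<in> M" "v' (Delta l) = m' - act (s (Delta l)) m'"
    using liftsD(3)[OF v(1), of l] liftsD(3)[OF v(2), of l] by auto
  show "(v - v') (Delta l) \<in> (\<lambda>m. m - act (s (Delta l)) m) ` M"
    using m(1,3) by (intro image_eqI[of _ _ "m - m'"]) (simp_all add: act_diff m(2,4))
qed (use v in \<open>simp_all add: liftsD\<close>)

lemma lifts_minus: "v \<in> lifts s X \<Longrightarrow> - v \<in> lifts s X"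
  using lifts_diff[OF lifts_zero, of v s X] by simp

lemma lifts_add: "\<lbrakk>v \<in> lifts s X; v' \<in> lifts s X\<rbrakk> \<Longrightarrow> v + v' \<in> lifts s X"
  using lifts_diff[OF _ lifts_minus, of v s X v'] by simp

lemma lifts_mono: "X \<subseteq> Y \<Longrightarrow> lifts s X \<subseteq> lifts s Y"
  by (auto intro!: liftsI dest: liftsD)

section \<open>The image of the Fox map on lifts\<close>

lemma fox_factor_eq_0: "(\<And>y. y \<in> letters w \<Longrightarrow> v y = 0) \<Longrightarrow> fox_factor s v w = 0"
  by (cases w) simp_all

lemma fox_eq_0: "(\<And>y. y \<in> word_letters ws \<Longrightarrow> v y = 0) \<Longrightarrow> fox s v ws = 0"
  by (induction ws) (simp_all add: fox_factor_eq_0)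

text \<open>The errors in the product relation that lifts can correct.\<close>

definition fox_span :: "(F_gen \<Rightarrow> 's) \<Rightarrow> F_gen list \<Rightarrow> 'm set" where
  "fox_span s ws = (\<lambda>v. fox s v ws) ` lifts s (word_letters ws)"

lemma fox_span_add: "\<lbrakk>a \<in> fox_span s ws; b \<in> fox_span s ws\<rbrakk> \<Longrightarrow> a + b \<in> fox_span s ws"
  unfolding fox_span_def by (auto simp flip: fox_add intro!: imageI lifts_add)

lemma fox_span_minus: "a \<in> fox_span s ws \<Longrightarrow> - a \<in> fox_span s ws"
  unfolding fox_span_def by (auto simp flip: fox_minus intro!: imageI lifts_minus)

text \<open>Disjoint blocks can be lifted independently: the two lifts are added, and neither
  contributes to the part of the other.\<close>

lemma fox_span_Cons:
  assumes sep: "separated (w # ws)" and v: "v \<in> lifts s (letters w)" and a: "a \<in> fox_span s ws"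
  shows "fox_factor s v w + act (factor S s w) a \<in> fox_span s (w # ws)"
proof -
  obtain u where u: "u \<in> lifts s (word_letters ws)" "a = fox s u ws"
    using a by (auto simp: fox_span_def)
  note disj = separated_Cons[OF sep]
  have "fox_factor s u w = 0" "fox s v ws = 0"
    using disj liftsD(2)[OF u(1)] liftsD(2)[OF v] by (auto intro!: fox_factor_eq_0 fox_eq_0)
  then have "fox s (v + u) (w # ws) = fox_factor s v w + act (factor S s w) a"
    by (simp only: fox.simps fox_factor_add fox_add u(2) add_0 add_0_right)
  moreover have "v + u \<in> lifts s (word_letters (w # ws))"
    using subsetD[OF lifts_mono u(1)] subsetD[OF lifts_mono v] by (intro lifts_add) auto
  ultimately show ?thesis
    unfolding fox_span_def by (metis imageI)
qed

text \<open>Collects the h for which \<open>1 - h\<close> sends \<open>M\<close> into the image of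
  the Fox map. Once this is all of \<open>S\<close>, every error coming from the augmentation ideal
  is correctable.\<close>

definition span_group :: "(F_gen \<Rightarrow> 's) \<Rightarrow> F_gen list \<Rightarrow> 's set" where
  "span_group s ws = {h \<in> carrier S. \<forall>m\<in>M. m - act h m \<in> fox_span s ws}"

text \<open>Follows from \<open>1 - h k = (1 - k) + (1 - h) k\<close> and
  \<open>1 - h^-1 = -(1 - h) h^-1\<close>.\<close>

lemma subgroup_span_group: "subgroup (span_group s ws) S"
proof
  show "span_group s ws \<subseteq> carrier S"
    by (auto simp: span_group_def)
  show "\<one> \<in> span_group s ws"
    by (auto simp: span_group_def fox_span_def intro!: image_eqI[of _ _ 0])
next
  fix h k assume h: "h \<in> span_group s ws" and k: "k \<in> span_group s ws"
  have "m - act (h \<otimes> k) m \<in> fox_span s ws" if m: "m \<in> M" for m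
  proof -
    have "m - act (h \<otimes> k) m = (m - act k m) + (act k m - act h (act k m))"
      using h k by (simp add: span_group_def act_mult)
    also have "\<dots> \<in> fox_span s ws"
      using h k m by (intro fox_span_add) (auto simp: span_group_def)
    finally show ?thesis .
  qed
  then show "h \<otimes> k \<in> span_group s ws"
    using h k by (simp add: span_group_def)
next
  fix h assume h: "h \<in> span_group s ws"
  have "m - act (inv h) m \<in> fox_span s ws" if m: "m \<in> M" for m
  proof -
    have "m - act (inv h) m = - (act (inv h) m - act h (act (inv h) m))"
      using h m by (simp add: span_group_def)
    also have "\<dots> \<in> fox_span s ws"
      using h m by (intro fox_span_minus) (simp add: span_group_def del: act_inv_cancel)
    finally show ?thesis .
  qed
  then show "inv h \<in> span_group s ws"
    using h by (simp add: span_group_def)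
qed

text \<open>Contributions of the tail are multiplied by the value w of the first block, and
  \<open>w (1 - h) w^-1 = 1 - w h w^-1\<close>.\<close>

lemma span_group_conj:
  assumes sep: "separated (w # ws)" and s: "range s \<subseteq> carrier S" and h: "h \<in> span_group s ws"
  shows "factor S s w \<otimes> h \<otimes> inv (factor S s w) \<in> span_group s (w # ws)"
proof -
  let ?w = "factor S s w"
  have w: "?w \<in> carrier S" and hc: "h \<in> carrier S"
    using s h by (auto simp: span_group_def)
  have "m - act (?w \<otimes> h \<otimes> inv ?w) m \<in> fox_span s (w # ws)" if m: "m \<in> M" for m
  proof -
    let ?n = "act (inv ?w) m"
    have "m - act (?w \<otimes> h \<otimes> inv ?w) m = fox_factor s 0 w + act ?w (?n - act h ?n)"
      using m w hc by (simp add: act_diff act_mult m_assoc fox_factor_eq_0)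
    also have "\<dots> \<in> fox_span s (w # ws)"
      using h m w by (intro fox_span_Cons[OF sep]) (auto simp: span_group_def)
    finally show ?thesis .
  qed
  then show ?thesis
    using w hc by (simp add: span_group_def)
qed

lemma lifts_single:
  assumes "m \<in> M" "y \<in> X" "\<And>l. y = Delta l \<Longrightarrow> m \<in> (\<lambda>m. m - act (s (Delta l)) m) ` M"
  shows "0(y := m) \<in> lifts s X"
proof (rule liftsI)
  fix l show "(0(y := m)) (Delta l) \<in> (\<lambda>m. m - act (s (Delta l)) m) ` M"
  proof (cases "y = Delta l")
    case False
    then show ?thesis
      by (intro image_eqI[of _ _ 0]) simp_all
  qed (use assms(3) in simp)
qed (use assms in auto)

lemma fox_factor_in_span:
  assumes "separated (w # ws)" "v \<in> lifts s (letters w)"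
  shows "fox_factor s v w \<in> fox_span s (w # ws)"
proof -
  have "0 \<in> fox_span s ws"
    by (auto simp: fox_span_def intro!: image_eqI[of _ _ 0])
  from fox_span_Cons[OF assms this] show ?thesis
    by simp
qed

text \<open>For gamma and delta blocks all changes \<open>m - act h m\<close> with h the generator
  itself are allowed. For a commutator block the two Fox derivatives give two group elements from
  which both generators are recovered.\<close>

lemma letters_in_span_group_Cons:
  assumes s: "range s \<subseteq> carrier S" and sep: "separated (w # ws)"
  shows "letters w \<subseteq> {y. s y \<in> span_group s (w # ws)}"
proof -
  let ?H = "span_group s (w # ws)"
  interpret H: subgroup ?H S
    by (rule subgroup_span_group)
  have sc [simp]: "s z \<in> carrier S" for z
    using s by auto
  have in_H: "h \<in> ?H"
    if "h \<in> carrier S" "\<And>m. m \<in> M \<Longrightarrow> \<exists>v\<in>lifts s (letters w). m - act h m = fox_factor s v w" for h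
    unfolding span_group_def mem_Collect_eq
  proof (intro conjI ballI)
    fix m assume "m \<in> M"
    from that(2)[OF this] show "m - act h m \<in> fox_span s (w # ws)"
      using fox_factor_in_span[OF sep] by auto
  qed fact
  show ?thesis
  proof (cases w)
    case (Alpha i)
    let ?a = "s (Alpha i)" and ?b = "s (Beta i)"
    have c: "?a \<otimes> ?b \<otimes> inv ?a \<in> ?H"
    proof (rule in_H)
      fix m assume m: "m \<in> M"
      then have "0(Alpha i := m) \<in> lifts s (letters w)"
        using Alpha by (intro lifts_single) auto
      then show "\<exists>v\<in>lifts s (letters w). m - act (?a \<otimes> ?b \<otimes> inv ?a) m = fox_factor s v w"
        by (rule rev_bexI) (simp add: Alpha)
    qed simp
    \<comment> \<open>Evaluating the derivative \<open>a - [a,b]\<close> at \<open>a^-1 m\<close>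
      turns it into \<open>1 - [a,b] a^-1\<close>.\<close>
    have c': "commutator S ?a ?b \<otimes> inv ?a \<in> ?H"
    proof (rule in_H)
      fix m assume m: "m \<in> M"
      then have "0(Beta i := act (inv ?a) m) \<in> lifts s (letters w)"
        using Alpha by (intro lifts_single) auto
      then show "\<exists>v\<in>lifts s (letters w). m - act (commutator S ?a ?b \<otimes> inv ?a) m = fox_factor s v w"
        by (rule rev_bexI) (simp add: Alpha act_mult m)
    qed simp
    have eq: "inv (?a \<otimes> ?b \<otimes> inv ?a) = ?a \<otimes> inv ?b \<otimes> inv ?a"
      by (simp add: inv_mult_group m_assoc)
    \<comment> \<open>With \<open>c = a b a^-1\<close> and \<open>c' = [a,b] a^-1\<close>,
      cancellation gives \<open>c^-1 c' = (a b)^-1\<close>; afterwards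
      \<open>c^-1 (a b) = a\<close>.\<close>
    have "inv (inv (?a \<otimes> ?b \<otimes> inv ?a) \<otimes> (commutator S ?a ?b \<otimes> inv ?a)) \<in> ?H"
      by (rule H.m_inv_closed[OF H.m_closed[OF H.m_inv_closed[OF c] c']])
    also have "inv (?a \<otimes> ?b \<otimes> inv ?a) \<otimes> (commutator S ?a ?b \<otimes> inv ?a) = inv (?a \<otimes> ?b)"
      unfolding eq commutator_def by (simp add: inv_mult_group m_assoc inv_cancel)
    finally have ab: "?a \<otimes> ?b \<in> ?H"
      by simp
    have "inv (?a \<otimes> ?b \<otimes> inv ?a) \<otimes> (?a \<otimes> ?b) \<in> ?H"
      by (rule H.m_closed[OF H.m_inv_closed[OF c] ab])
    also have "inv (?a \<otimes> ?b \<otimes> inv ?a) \<otimes> (?a \<otimes> ?b) = ?a"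
      unfolding eq by (simp add: m_assoc inv_cancel)
    finally have a: "?a \<in> ?H" .
    have "inv ?a \<otimes> (?a \<otimes> ?b) \<in> ?H"
      by (rule H.m_closed[OF H.m_inv_closed[OF a] ab])
    also have "inv ?a \<otimes> (?a \<otimes> ?b) = ?b"
      by (simp add: inv_cancel)
    finally show ?thesis
      using a by (simp add: Alpha)
  next
    case (Gamma i)
    have "s (Gamma i) \<in> ?H"
    proof (rule in_H)
      fix m assume m: "m \<in> M"
      then have "0(Gamma i := m - act (s (Gamma i)) m) \<in> lifts s (letters w)"
        using Gamma by (intro lifts_single) auto
      then show "\<exists>v\<in>lifts s (letters w). m - act (s (Gamma i)) m = fox_factor s v w"
        by (rule rev_bexI) (simp add: Gamma)
    qed simp
    then show ?thesis
      by (simp add: Gamma)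
  next
    case (Delta i)
    have "s (Delta i) \<in> ?H"
    proof (rule in_H)
      fix m assume m: "m \<in> M"
      then have "0(Delta i := m - act (s (Delta i)) m) \<in> lifts s (letters w)"
        using Delta by (intro lifts_single) auto
      then show "\<exists>v\<in>lifts s (letters w). m - act (s (Delta i)) m = fox_factor s v w"
        by (rule rev_bexI) (simp add: Delta)
    qed simp
    then show ?thesis
      by (simp add: Delta)
  qed (use separated_Cons[OF sep] in simp)
qed

text \<open>By induction a later generator is reached up to conjugation by the first block. That
  block lies in the subgroup too, so the conjugation can be undone.\<close>

lemma letters_in_span_group:
  assumes s: "range s \<subseteq> carrier S" and sep: "separated ws" and y: "y \<in> word_letters ws"
  shows "s y \<in> span_group s ws"
  using sep y
proof (induction ws arbitrary: y)
  case (Cons w ws)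
  note sep = separated_Cons[OF Cons.prems(1)]
  let ?H = "span_group s (w # ws)"
  interpret H: subgroup ?H S
    by (rule subgroup_span_group)
  note letters = letters_in_span_group_Cons[OF s Cons.prems(1)]
  show ?case
  proof (cases "y \<in> letters w")
    case False
    let ?f = "factor S s w"
    have f: "?f \<in> ?H"
      using letters by (intro factor_in_subgroup subgroup_span_group) auto
    have "s y \<in> span_group s ws"
      using Cons False sep by auto
    from span_group_conj[OF Cons.prems(1) s this]
    have "inv ?f \<otimes> (?f \<otimes> s y \<otimes> inv ?f) \<otimes> ?f \<in> ?H"
      using H.m_closed[OF H.m_closed[OF H.m_inv_closed[OF f]] f] by simp
    also have "inv ?f \<otimes> (?f \<otimes> s y \<otimes> inv ?f) \<otimes> ?f = s y"
    proof -
      have "s y \<in> carrier S" "?f \<in> carrier S"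
        using s by auto
      then show ?thesis
        by (simp add: m_assoc inv_cancel)
    qed
    finally show ?thesis .
  qed (use letters in auto)
qed simp

text \<open>The subgroup contains every entry of a generating tuple. Hence every
  \<open>m - act h m\<close> is a Fox value of some lift.\<close>

lemma span_group_eq_carrier:
  assumes sys: "system S g r os s" and gen: "generating S s"
  shows "span_group s (relator_word g r (length os)) = carrier S"
proof -
  let ?ws = "relator_word g r (length os)"
  interpret H: subgroup "span_group s ?ws" S
    by (rule subgroup_span_group)
  have "s y \<in> span_group s ?ws" for y
    using letters_in_span_group[OF _ separated_relator_word, of s y g r "length os"] sys
    by (cases "y \<in> F_gens g r (length os)") (auto simp: system_def word_letters_relator_word)
  then have "generate S (range s) \<subseteq> span_group s ?ws"
    by (intro generate_subgroup_incl subgroup_span_group) auto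
  then show ?thesis
    using gen H.subset by (auto simp: generating_def)
qed

text \<open>Only the block \<open>Delta k\<close> sees the change, and its contribution is
  multiplied by the product t of the blocks before it.\<close>

lemma fox_single_Delta:
  assumes "range s \<subseteq> carrier S" "m \<in> M" "separated ws" "Delta k \<in> set ws"
  shows "\<exists>t\<in>carrier S. fox s (0(Delta k := m)) ws = act t m"
  using assms(3,4)
proof (induction ws)
  case (Cons w ws)
  note sep = separated_Cons[OF Cons.prems(1)]
  have w: "factor S s w \<in> carrier S"
    using assms(1) by simp
  show ?case
  proof (cases "w = Delta k")
    case True
    then have "fox s (0(Delta k := m)) ws = 0"
      using sep by (intro fox_eq_0) auto
    then have "fox s (0(Delta k := m)) (w # ws) = act \<one> m"
      unfolding fox.simps True using assms(2) by simp
    then show ?thesis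
      by blast
  next
    case False
    then have f: "fox_factor s (0(Delta k := m)) w = 0"
      using sep by (cases w) (auto intro!: fox_factor_eq_0)
    obtain t where t: "t \<in> carrier S" "fox s (0(Delta k := m)) ws = act t m"
      using Cons.IH Cons.prems(2) False sep by (metis set_ConsD)
    have "fox s (0(Delta k := m)) (w # ws) = act (factor S s w \<otimes> t) m"
      by (simp only: fox.simps f t(2) add_0 act_mult[OF w t(1)])
    then show ?thesis
      using w t(1) by (metis m_closed)
  qed
qed simp

lemma derived_sd_trivial:
  assumes "K \<subseteq> M \<times> {\<one>}"
  shows "derived sd K = {\<one>\<^bsub>sd\<^esub>}"
proof -
  have "a \<otimes>\<^bsub>sd\<^esub> b \<otimes>\<^bsub>sd\<^esub> inv\<^bsub>sd\<^esub> a \<otimes>\<^bsub>sd\<^esub> inv\<^bsub>sd\<^esub> b = \<one>\<^bsub>sd\<^esub>" if "a \<in> K" "b \<in> K" for a b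
  proof -
    have "a \<in> M \<times> {\<one>}" "b \<in> M \<times> {\<one>}"
      using that assms by auto
    then obtain f g where "a = (f, \<one>)" "b = (g, \<one>)" "f \<in> M" "g \<in> M"
      by blast
    then show ?thesis
      by (simp add: inv_sd)
  qed
  then have "derived_set sd K \<subseteq> {\<one>\<^bsub>sd\<^esub>}"
    by auto
  from group.mono_generate[OF group_sd this] have "derived sd K \<subseteq> {\<one>\<^bsub>sd\<^esub>}"
    unfolding derived_def group.generate_one[OF group_sd] .
  moreover have "\<one>\<^bsub>sd\<^esub> \<in> derived sd K"
    unfolding derived_def by (rule generate.one)
  ultimately show ?thesis by blast
qed

text \<open>After d steps the projection to \<open>S\<close> is trivial, so what remains lies in the
  abelian kernel \<open>M\<close> and dies one step later.\<close>

lemma derived_series_sd: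
  assumes K: "subgroup K sd" "snd ` K = carrier S" and d: "(derived S ^^ d) (carrier S) = {\<one>}"
  shows "(derived sd ^^ Suc d) K = {\<one>\<^bsub>sd\<^esub>}"
proof -
  interpret p: group_hom sd S snd
    by (rule group_hom_snd)
  have Kc: "K \<subseteq> carrier sd"
    using K(1) subgroup.subset by blast
  have "snd ` ((derived sd ^^ d) K) = {\<one>}"
    using p.exp_of_derived_img[OF Kc, of d] K(2) d by simp
  moreover have "(derived sd ^^ d) K \<subseteq> carrier sd"
    by (rule p.G.exp_of_derived_in_carrier[OF Kc])
  ultimately have "(derived sd ^^ d) K \<subseteq> M \<times> {\<one>}"
    by (auto simp: image_subset_iff set_eq_iff image_iff) force+
  from derived_sd_trivial[OF this] show ?thesis
    by simp
qed

lemma snd_generate_lifts: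
  assumes "range v \<subseteq> M" "range s \<subseteq> carrier S" "generating S s"
  shows "snd ` generate sd (range (\<lambda>y. (v y, s y))) = carrier S"
proof -
  interpret p: group_hom sd S snd
    by (rule group_hom_snd)
  have "generate S (snd ` range (\<lambda>y. (v y, s y))) = snd ` generate sd (range (\<lambda>y. (v y, s y)))"
    using assms(1,2) by (intro p.generate_img) auto
  then show ?thesis
    using assms(3) by (simp add: generating_def image_image)
qed

end

section \<open>Raising the order of an elliptic generator\<close>

definition fun_act :: "('s, 'b) monoid_scheme \<Rightarrow> 's \<Rightarrow> ('s \<Rightarrow> circ) \<Rightarrow> 's \<Rightarrow> circ" where
  "fun_act S s f = (\<lambda>x. if x \<in> carrier S then f (inv\<^bsub>S\<^esub> s \<otimes>\<^bsub>S\<^esub> x) else 0)"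

text \<open>For finite \<open>S\<close> this is the group ring over Z/q, an element being its
  coefficient function; \<open>fun_act\<close> is left multiplication. Vanishing outside the carrier
  makes equality of elements plain equality of functions.\<close>

definition fun_mod :: "('s, 'b) monoid_scheme \<Rightarrow> nat \<Rightarrow> ('s \<Rightarrow> circ) set" where
  "fun_mod S q = {f. (\<forall>x. f x \<in> tors q) \<and> (\<forall>x. x \<notin> carrier S \<longrightarrow> f x = 0)}"

lemma fun_act_add: "fun_act S s (f + g) = fun_act S s f + fun_act S s g"
  by (auto simp: fun_act_def fun_eq_iff)

lemma (in group) fun_act_mult:
  "\<lbrakk>s \<in> carrier G; t \<in> carrier G\<rbrakk> \<Longrightarrow> fun_act G (s \<otimes> t) f = fun_act G s (fun_act G t f)"
  by (auto simp: fun_act_def fun_eq_iff inv_mult_group m_assoc)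

lemma (in group) fun_act_one: "f \<in> fun_mod G q \<Longrightarrow> fun_act G \<one> f = f"
  by (auto simp: fun_act_def fun_eq_iff fun_mod_def)

lemma (in group) fun_act_closed:
  "\<lbrakk>s \<in> carrier G; f \<in> fun_mod G q\<rbrakk> \<Longrightarrow> fun_act G s f \<in> fun_mod G q"
  by (auto simp: fun_act_def fun_mod_def tors_closed)

lemma fun_mod_diff: "\<lbrakk>f \<in> fun_mod S q; g \<in> fun_mod S q\<rbrakk> \<Longrightarrow> f - g \<in> fun_mod S q"
  by (auto simp: fun_mod_def tors_closed)

lemma fun_mod_zero: "0 \<in> fun_mod S q"
  by (auto simp: fun_mod_def tors_closed)

lemma (in group) group_action_on_fun_mod: "group_action_on_module G (fun_mod G q) (fun_act G)"
  by unfold_locales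
     (auto simp: fun_act_add fun_act_mult fun_act_one fun_act_closed fun_mod_diff fun_mod_zero)

lemma finite_fun_mod:
  assumes "finite (carrier S)" "q > 0"
  shows "finite (fun_mod S q)"
proof (rule finite_subset)
  show "fun_mod S q \<subseteq> {f. \<forall>x. (x \<in> carrier S \<longrightarrow> f x \<in> tors q) \<and> (x \<notin> carrier S \<longrightarrow> f x = 0)}"
    by (auto simp: fun_mod_def)
  show "finite {f. \<forall>x. (x \<in> carrier S \<longrightarrow> f x \<in> tors q) \<and> (x \<notin> carrier S \<longrightarrow> f x = 0)}"
    using assms finite_tors by (intro finite_set_of_finite_funs)
qed

definition point :: "nat \<Rightarrow> 's \<Rightarrow> 's \<Rightarrow> circ" where
  "point q x = (\<lambda>y. if y = x then unit_frac q else 0)"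

lemma point_in_fun_mod: "\<lbrakk>x \<in> carrier S; q > 0\<rbrakk> \<Longrightarrow> point q x \<in> fun_mod S q"
  by (auto simp: point_def fun_mod_def unit_frac_in_tors tors_closed)

lemma (in group) fun_act_point:
  "\<lbrakk>s \<in> carrier G; x \<in> carrier G\<rbrakk> \<Longrightarrow> fun_act G s (point q x) = point q (s \<otimes> x)"
  by (auto simp: fun_act_def point_def fun_eq_iff inv_solve_left')

lemma (in group_action_on_module) sum_closed: "(\<And>i. i \<in> I \<Longrightarrow> f i \<in> M) \<Longrightarrow> sum f I \<in> M"
  by (induction I rule: infinite_finite_induct) auto

text \<open>Besides the conjugation part, powers accumulate the partial norm
  \<open>b + s b + ... + s^(n-1) b\<close>.\<close>

lemma (in group_action_on_module) lift_pow:
  assumes "s \<in> carrier S" "f \<in> M" "b \<in> M"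
  shows "(f - act s f + b, s) [^]\<^bsub>sd\<^esub> (n::nat)
    = (f - act (s [^] n) f + (\<Sum>i<n. act (s [^] i) b), s [^] n)"
  using assms by (induction n) (simp_all add: act_diff act_add act_mult)

lemma sum_fun_apply: "(\<Sum>i\<in>I. f i) x = (\<Sum>i\<in>I. f i x)" for f :: "'i \<Rightarrow> 'a \<Rightarrow> 'b::ab_group_add"
  by (induction I rule: infinite_finite_induct) simp_all

lemma sum_mult_lessThan:
  fixes h :: "nat \<Rightarrow> circ"
  assumes "\<And>i. h (i + e) = h i"
  shows "(\<Sum>i<e * j. h i) = smul j (\<Sum>i<e. h i)"
proof (induction j)
  case (Suc j)
  have "h (i + e * j) = h i" for i
    by (induction j) (use assms in \<open>simp_all add: add.assoc[symmetric] add.commute[of e]\<close>)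
  then have "(\<Sum>i=e * j..<e * j + e. h i) = (\<Sum>i<e. h i)"
    using sum.shift_bounds_nat_ivl[of h 0 "e * j" e] by (simp add: atLeast0LessThan add.commute)
  moreover have "(\<Sum>i<e * Suc j. h i) = (\<Sum>i<e * j. h i) + (\<Sum>i=e * j..<e * j + e. h i)"
    by (simp add: sum.atLeastLessThan_concat lessThan_atLeast0 add.commute[of e])
  ultimately show ?case
    by (simp add: Suc smul_Suc add.commute)
qed simp

lemma system_order_pos:
  fixes S (structure)
  assumes "system S g r os s" "k < length os"
  shows "0 < os ! k"
proof -
  interpret group S using assms by (simp add: system_def)
  have "s (Delta k) \<in> carrier S" "finite (carrier S)"
    using assms(1) by (auto simp: system_def)
  then have "s (Delta k) [^] order S = \<one>" "order S > 0"
    by (simp_all add: pow_order_eq_1 order_gt_0_iff_finite)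
  then have "os ! k dvd order S"
    using assms by (simp add: system_def)
  with \<open>order S > 0\<close> show ?thesis
    by (auto elim: dvdE)
qed

text \<open>The cardinality assumption supplies y outside the cyclic group of
  \<open>Delta k\<close>. Changing \<open>Delta k\<close> by \<open>1 - y\<close> spoils the product
  relation by an error that lifts can correct, and the norm of \<open>1 - y\<close> under
  \<open>Delta k\<close> has additive order q.\<close>

lemma raise_order:
  fixes S :: "('s, 'b) monoid_scheme" (structure)
  assumes sys: "system S g r os s" and gen: "generating S s"
    and d: "(derived S ^^ d) (carrier S) = {\<one>\<^bsub>S\<^esub>}"
    and k: "k < length os" and q: "2 \<le> q" and card: "os ! k < card (carrier S)"
  obtains S' :: "nat monoid" and s' where
    "system S' g r (os[k := os ! k * q]) s'" "generating S' s'"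
    "(derived S' ^^ Suc d) (carrier S') = {\<one>\<^bsub>S'\<^esub>}" "card (carrier S) < card (carrier S')"
proof -
  interpret group S using sys by (simp add: system_def)
  define M where "M = fun_mod S q"
  interpret group_action_on_module S M "fun_act S"
    unfolding M_def by (rule group_action_on_fun_mod)
  let ?X = "F_gens g r (length os)" and ?W = "relator_word g r (length os)"
  define e where "e = os ! k"
  define \<delta> where "\<delta> = s (Delta k)"
  have sc: "range s \<subseteq> carrier S" and fin: "finite (carrier S)"
    and s1: "\<And>y. y \<notin> ?X \<Longrightarrow> s y = \<one>" and ev: "eval_word S s ?W = \<one>"
    and ord: "\<And>l n. l < length os \<Longrightarrow> s (Delta l) [^] (n::nat) = \<one> \<longleftrightarrow> os ! l dvd n"
    using sys by (simp_all add: system_def)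
  have \<delta>: "\<delta> \<in> carrier S" and ord\<delta>: "\<And>n. \<delta> [^] (n::nat) = \<one> \<longleftrightarrow> e dvd n"
    using sc k ord by (auto simp: \<delta>_def e_def)
  have e: "0 < e"
    using system_order_pos[OF sys k] by (simp add: e_def)
  \<comment> \<open>The powers of delta form at most e elements, fewer than the group has, so some y
    is not among them.\<close>
  have "\<delta> [^] n \<in> (\<lambda>i. \<delta> [^] i) ` {..<e}" for n :: nat
  proof -
    have "\<delta> [^] n = \<delta> [^] (e * (n div e)) \<otimes> \<delta> [^] (n mod e)"
      using \<delta> by (simp add: nat_pow_mult)
    also have "\<delta> [^] (e * (n div e)) = \<one>"
      by (simp add: ord\<delta>)
    finally show ?thesis
      using \<delta> e by auto
  qed
  moreover have "card ((\<lambda>i. \<delta> [^] i) ` {..<e}) < card (carrier S)"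
    using card card_image_le[of "{..<e}" "\<lambda>i. \<delta> [^] i"] by (simp add: e_def)
  ultimately obtain y where y: "y \<in> carrier S" "\<And>n::nat. \<delta> [^] n \<noteq> y"
    using \<delta> card_mono[of "(\<lambda>i. \<delta> [^] i) ` {..<e}" "carrier S"]
    by (metis finite_imageI finite_lessThan not_le subsetI)
  define b where "b = point q \<one> - point q y"
  have b: "b \<in> M"
    using y q by (simp add: b_def M_def fun_mod_diff point_in_fun_mod)
  have "Delta k \<in> set ?W"
    using k by (simp add: relator_word_def)
  then obtain t where t: "t \<in> carrier S" "fox s (0(Delta k := b)) ?W = fun_act S t b"
    using fox_single_Delta[OF sc b separated_relator_word] by blast
  \<comment> \<open>Since h t = t y, the error \<open>t (1 - y)\<close> equals
    \<open>(1 - h) t\<close>, which lies in the image of the Fox map.\<close>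
  define h where "h = t \<otimes> y \<otimes> inv t"
  have h: "h \<in> span_group s ?W"
    using span_group_eq_carrier[OF sys gen] t y by (simp add: h_def)
  have pt: "point q t \<in> M"
    using t q by (simp add: M_def point_in_fun_mod)
  have "fun_act S t b = point q t - fun_act S h (point q t)"
    using t y by (simp add: b_def act_diff fun_act_point h_def m_assoc)
  then have "- fun_act S t b \<in> fox_span s ?W"
    using h pt fox_span_minus by (simp add: span_group_def del: minus_diff_eq)
  then obtain v where v: "v \<in> lifts s ?X" "fox s v ?W = - fun_act S t b"
    by (auto simp: fox_span_def word_letters_relator_word)
  \<comment> \<open>The Fox value of v cancels the error of b, so u has Fox value 0. Away from
    \<open>Delta k\<close> it is an ordinary lift.\<close>
  define u where "u = v + 0(Delta k := b)"
  have u: "u y = (if y = Delta k then v y + b else v y)" for y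
    by (simp add: u_def)
  have uM: "range u \<subseteq> M"
    using liftsD(1)[OF v(1)] b by (auto simp: u)
  define x where "x = (\<lambda>y. (u y, s y))"
  obtain f where f: "f \<in> M" "v (Delta k) = f - fun_act S \<delta> f"
    using liftsD(3)[OF v(1), of k] by (auto simp: \<delta>_def)
  have xk: "x (Delta k) = (f - fun_act S \<delta> f + b, \<delta>)"
    by (simp add: x_def u f \<delta>_def)
  define N where "N n = (\<Sum>i<n. fun_act S (\<delta> [^] i) b)" for n :: nat
  have N_period: "N (e * j) z = smul j (N e z)" for j z
  proof -
    have "fun_act S (\<delta> [^] (i + e)) b = fun_act S (\<delta> [^] i) b" for i
      using \<delta> ord\<delta>[of e] by (simp add: nat_pow_mult[symmetric])
    then show ?thesis
      using sum_mult_lessThan[of "\<lambda>i. fun_act S (\<delta> [^] i) b z" e j] by (simp add: N_def sum_fun_apply)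
  qed
  have "N n \<in> M" for n
    unfolding N_def using \<delta> b by (intro sum_closed) simp
  then have N_tors: "smul q (N n z) = 0" for n z
    by (simp add: M_def fun_mod_def tors_def)
  \<comment> \<open>At the identity, \<open>\<delta>^i\<close> contributes only for i = 0 and
    \<open>\<delta>^i y\<close> never does, since y is not a power of delta. So \<open>N e\<close>
    has additive order exactly q.\<close>
  have N_one: "N e \<one> = unit_frac q"
  proof -
    have "fun_act S (\<delta> [^] i) b \<one> = (if i = 0 then unit_frac q else 0)" if i: "i < e" for i
    proof -
      have "inv (\<delta> [^] i) = \<delta> [^] (e - i)"
        using \<delta> i ord\<delta>[of e] by (intro inv_equality) (simp_all add: nat_pow_mult)
      moreover have "\<delta> [^] (e - i) = \<one> \<longleftrightarrow> i = 0"
        using i by (auto simp: ord\<delta> dest: dvd_imp_le)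
      ultimately show ?thesis
        using y(2) \<delta> by (auto simp: fun_act_def b_def point_def)
    qed
    then have "N e \<one> = (\<Sum>i<e. if i = 0 then unit_frac q else 0)"
      unfolding N_def sum_fun_apply by (intro sum.cong) auto
    then show ?thesis
      using e by (simp add: sum.delta)
  qed
  have ordk: "x (Delta k) [^]\<^bsub>sd\<^esub> (n::nat) = \<one>\<^bsub>sd\<^esub> \<longleftrightarrow> e * q dvd n" for n
  proof (cases "e dvd n")
    case True
    then obtain j where j: "n = e * j" by blast
    have "x (Delta k) [^]\<^bsub>sd\<^esub> n = (N (e * j), \<one>)"
      using f(1) \<delta> b j ord\<delta>[of n] by (simp add: xk lift_pow N_def)
    then have "x (Delta k) [^]\<^bsub>sd\<^esub> n = \<one>\<^bsub>sd\<^esub> \<longleftrightarrow> (\<forall>z. smul j (N e z) = 0)"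
      by (simp add: fun_eq_iff N_period)
    also have "\<dots> \<longleftrightarrow> q dvd j"
    proof
      assume "\<forall>z. smul j (N e z) = 0"
      then have "smul j (N e \<one>) = 0" by blast
      then show "q dvd j"
        using q by (simp add: N_one smul_unit_frac_eq_0_iff)
    next
      assume "q dvd j"
      then show "\<forall>z. smul j (N e z) = 0"
        by (auto elim!: dvdE simp: mult.commute[of q] smul_mult N_tors)
    qed
    finally show ?thesis
      using j e by simp
  next
    case False
    then have "\<delta> [^] n \<noteq> \<one>"
      by (simp add: ord\<delta>)
    then show ?thesis
      using False f(1) \<delta> b dvd_mult_left[of e q n] by (auto simp: xk lift_pow)
  qed
  have vM: "range v \<subseteq> M"
    using liftsD(1)[OF v(1)] by auto
  have "fox s u ?W = 0"
    unfolding u_def fox_add t(2) v(2) by simp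
  then have ev_x: "eval_word sd x ?W = \<one>\<^bsub>sd\<^esub>"
    using eval_word_sd[OF sc uM] ev by (simp add: x_def)
  have finM: "finite M"
    using fin q by (simp add: M_def finite_fun_mod)
  have sys_x: "system sd g r (os[k := os ! k * q]) x"
    unfolding system_def length_list_update
  proof (intro conjI allI impI)
    fix y assume y: "y \<notin> ?X"
    then have "y \<noteq> Delta k"
      using k by (auto simp: F_gens_def)
    then show "x y = \<one>\<^bsub>sd\<^esub>"
      using s1[OF y] liftsD(2)[OF v(1) y] by (simp add: x_def u)
  next
    fix l n assume l: "l < length os"
    show "x (Delta l) [^]\<^bsub>sd\<^esub> (n::nat) = \<one>\<^bsub>sd\<^esub> \<longleftrightarrow> os[k := os ! k * q] ! l dvd n"
    proof (cases "l = k")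
      case True
      then show ?thesis
        using l by (simp add: ordk e_def del: one_sd)
    next
      case False
      obtain m where "m \<in> M" "v (Delta l) = m - fun_act S (s (Delta l)) m"
        using liftsD(3)[OF v(1), of l] by auto
      moreover have "s (Delta l) \<in> carrier S"
        using sc by auto
      ultimately show ?thesis
        using conj_pow_eq_one_iff[of "s (Delta l)" m n] False l ord[OF l] by (simp add: x_def u del: one_sd)
    qed
  qed (use group_sd fin finM ev_x sc uM in \<open>auto simp: x_def\<close>)
  define K where "K = generate sd (range x)"
  have xsd: "range x \<subseteq> carrier sd"
    using sc uM by (auto simp: x_def)
  have K: "subgroup K sd"
    unfolding K_def by (rule group.generate_is_subgroup[OF group_sd xsd])
  have sndK: "snd ` K = carrier S"
    unfolding K_def x_def by (rule snd_generate_lifts[OF uM sc gen])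
  have finK: "finite K"
    using subgroup.subset[OF K] finM fin by (metis carrier_sd finite_SigmaI finite_subset)
  \<comment> \<open>With equal cardinalities the projection to \<open>S\<close> would be injective
    on K, but the e-th power of \<open>x (Delta k)\<close> is a nontrivial element over the
    identity.\<close>
  have "card (carrier S) \<noteq> card K"
  proof
    assume "card (carrier S) = card K"
    then have inj: "inj_on snd K"
      using sndK finK by (simp add: eq_card_imp_inj_on)
    have "x (Delta k) \<in> K"
      unfolding K_def by (rule generate.incl) simp
    then have inK: "x (Delta k) [^]\<^bsub>sd\<^esub> e \<in> K"
      using group.subgroupE(4)[OF group_sd K]
      by (induction e) (use subgroup.one_closed[OF K] in \<open>auto simp: nat_pow_0 nat_pow_Suc\<close>)
    have "snd (x (Delta k) [^]\<^bsub>sd\<^esub> e) = snd \<one>\<^bsub>sd\<^esub>"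
      using f(1) \<delta> b ord\<delta>[of e] by (simp add: xk lift_pow)
    then have "x (Delta k) [^]\<^bsub>sd\<^esub> e = \<one>\<^bsub>sd\<^esub>"
      by (rule inj_onD[OF inj _ inK subgroup.one_closed[OF K]])
    then show False
      using ordk[of e] e q by (auto dest: dvd_imp_le)
  qed
  moreover have "card (carrier S) \<le> card K"
    using card_image_le[OF finK, of snd] by (simp add: sndK)
  ultimately have cardK: "card (carrier S) < card K"
    by simp
  obtain S' :: "nat monoid" and s' where S': "system S' g r (os[k := os ! k * q]) s'" "generating S' s'"
    "card (carrier S') = card K"
    "\<And>n. (derived S' ^^ n) (carrier S') = {\<one>\<^bsub>S'\<^esub>} \<longleftrightarrow> (derived sd ^^ n) K = {\<one>\<^bsub>sd\<^esub>}"
    unfolding K_def by (rule system_transport[OF sys_x]) blast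
  have "(derived S' ^^ Suc d) (carrier S') = {\<one>\<^bsub>S'\<^esub>}"
    unfolding S'(4) by (rule derived_series_sd[OF K sndK d])
  with S' cardK show thesis
    by (intro that[of S' s']) simp_all
qed

section \<open>Extending the derived length\<close>

text \<open>Conjugation by an element of K is an endomorphism mapping K onto K, so it preserves
  every term of the derived series of K.\<close>

lemma (in group) derived_series_conj:
  assumes K: "subgroup K G" and x: "x \<in> K" and y: "y \<in> (derived G ^^ n) K"
  shows "x \<otimes> y \<otimes> inv x \<in> (derived G ^^ n) K"
proof -
  have xc: "x \<in> carrier G" and Kc: "K \<subseteq> carrier G"
    using K x by (auto simp: subgroup.subset subgroup.mem_carrier)
  interpret c: group_hom G G "\<lambda>z. x \<otimes> z \<otimes> inv x"
    using xc by unfold_locales (auto simp: hom_def m_assoc inv_cancel)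
  have "(\<lambda>z. x \<otimes> z \<otimes> inv x) ` K = K"
  proof (intro equalityI subsetI)
    fix z assume z: "z \<in> K"
    have "z = x \<otimes> (inv x \<otimes> z \<otimes> x) \<otimes> inv x"
      using xc z Kc by (simp add: m_assoc inv_cancel subset_iff)
    moreover have "inv x \<otimes> z \<otimes> x \<in> K"
      using K x z by (simp add: subgroup.m_closed subgroup.m_inv_closed)
    ultimately show "z \<in> (\<lambda>z. x \<otimes> z \<otimes> inv x) ` K"
      by blast
  qed (use K x in \<open>auto simp: subgroup.m_closed subgroup.m_inv_closed\<close>)
  then show ?thesis
    using c.exp_of_derived_img[OF Kc, of n] y by auto
qed

lemma (in group) derived_trivial_commute:
  assumes "derived G D = {\<one>}" "D \<subseteq> carrier G" "x \<in> D" "y \<in> D"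
  shows "x \<otimes> y = y \<otimes> x"
proof -
  have "x \<otimes> y \<otimes> inv x \<otimes> inv y \<in> derived G D"
    unfolding derived_def using assms(3,4) by (intro generate.incl) auto
  then have "x \<otimes> y \<otimes> inv x \<otimes> inv y = \<one>"
    using assms(1) by simp
  moreover have c: "x \<in> carrier G" "y \<in> carrier G"
    using assms by auto
  moreover have "x \<otimes> y = (x \<otimes> y \<otimes> inv x \<otimes> inv y) \<otimes> (y \<otimes> x)"
    using c by (simp add: m_assoc inv_cancel)
  ultimately show ?thesis
    by simp
qed

context group_action_on_module
begin

text \<open>If the derived length does not grow, the last derived subgroup of \<open>K\<close> is a complement of \<open>M\<close>
  in \<open>M \<rtimes> A\<close>; as \<open>H\<^sup>1(A, M) = 0\<close> it is conjugate to \<open>A\<close>, and so \<open>K\<close> is conjugate to \<open>S\<close>.\<close>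

lemma conjugate_complement:
  assumes K: "subgroup K sd" "snd ` K = carrier S"
    and triv: "(derived sd ^^ Suc d) K = {\<one>\<^bsub>sd\<^esub>}"
    and A: "A = (derived S ^^ d) (carrier S)"
    and fixed: "\<And>f. \<lbrakk>f \<in> M; \<And>a. a \<in> A \<Longrightarrow> act a f = f\<rbrakk> \<Longrightarrow> f = 0"
    and H1: "\<And>\<mu>. \<lbrakk>\<And>a. a \<in> A \<Longrightarrow> \<mu> a \<in> M; \<And>a b. \<lbrakk>a \<in> A; b \<in> A\<rbrakk> \<Longrightarrow> \<mu> (a \<otimes> b) = \<mu> a + act a (\<mu> b)\<rbrakk>
        \<Longrightarrow> \<exists>m\<in>M. \<forall>a\<in>A. \<mu> a = m - act a m"
  shows "\<exists>m\<in>M. \<forall>(f, s)\<in>K. f = m - act s m"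
proof -
  interpret sd: group sd by (rule group_sd)
  interpret p: group_hom sd S snd by (rule group_hom_snd)
  define D where "D = (derived sd ^^ d) K"
  have Kc: "K \<subseteq> carrier sd"
    by (rule subgroup.subset[OF K(1)])
  have D: "subgroup D sd"
    unfolding D_def by (rule sd.exp_of_derived_is_subgroup[OF K(1)])
  have Dc: "D \<subseteq> carrier sd"
    by (rule subgroup.subset[OF D])
  have comm: "x \<otimes>\<^bsub>sd\<^esub> y = y \<otimes>\<^bsub>sd\<^esub> x" if "x \<in> D" "y \<in> D" for x y
    using sd.derived_trivial_commute[OF _ Dc that] triv by (simp add: D_def)
  have sndD: "snd ` D = A"
    using p.exp_of_derived_img[OF Kc, of d] K(2) by (simp add: D_def A)
  have Ac: "A \<subseteq> carrier S"
    unfolding A by (rule exp_of_derived_in_carrier) simp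
  have A_conj: "s \<otimes> a \<otimes> inv s \<in> A" if "s \<in> carrier S" "a \<in> A" for s a
    using derived_series_conj[OF subgroup_self that(1)] that(2) by (simp add: A)
  \<comment> \<open>D is abelian, so an element of D over the identity commutes with some element
    over each a in A, which says that its module component is fixed by A.\<close>
  have D_one: "f = 0" if f: "(f, \<one>) \<in> D" for f
  proof (rule fixed)
    show fM: "f \<in> M"
      using f Dc by auto
    fix a assume "a \<in> A"
    then obtain e where e: "(e, a) \<in> D"
      using sndD by auto
    then have "e \<in> M" "a \<in> carrier S"
      using Dc by auto
    with comm[OF e f] fM show "act a f = f"
      by (simp add: add.commute[of f])
  qed
  have D_unique: "f = f'" if f: "(f, a) \<in> D" "(f', a) \<in> D" for f f' a
  proof -
    have c: "f \<in> M" "f' \<in> M" "a \<in> carrier S"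
      using f Dc by auto
    have "(f, a) \<otimes>\<^bsub>sd\<^esub> inv\<^bsub>sd\<^esub> (f', a) \<in> D"
      by (rule subgroup.m_closed[OF D f(1) subgroup.m_inv_closed[OF D f(2)]])
    then have "(f - f', \<one>) \<in> D"
      using c by (simp add: inv_sd act_minus)
    from D_one[OF this] show ?thesis by simp
  qed
  \<comment> \<open>D is thus the graph of a function on A; closure under multiplication makes that
    function a 1-cocycle.\<close>
  define \<mu> where "\<mu> a = (SOME f. (f, a) \<in> D)" for a
  have \<mu>: "(\<mu> a, a) \<in> D" if "a \<in> A" for a
  proof -
    have "\<exists>f. (f, a) \<in> D"
      using that sndD by auto
    then show ?thesis
      unfolding \<mu>_def by (rule someI_ex)
  qed
  have "\<exists>m\<in>M. \<forall>a\<in>A. \<mu> a = m - act a m"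
  proof (rule H1)
    show "\<mu> a \<in> M" if "a \<in> A" for a
      using \<mu>[OF that] Dc by auto
    fix a b assume ab: "a \<in> A" "b \<in> A"
    have "(\<mu> a, a) \<otimes>\<^bsub>sd\<^esub> (\<mu> b, b) \<in> D"
      using D \<mu>[OF ab(1)] \<mu>[OF ab(2)] by (rule subgroup.m_closed)
    then have prod: "(\<mu> a + act a (\<mu> b), a \<otimes> b) \<in> D"
      by simp
    then have "a \<otimes> b \<in> A"
      using sndD by force
    from D_unique[OF \<mu>[OF this] prod] show "\<mu> (a \<otimes> b) = \<mu> a + act a (\<mu> b)" .
  qed
  then obtain m where m: "m \<in> M" "\<And>a. a \<in> A \<Longrightarrow> \<mu> a = m - act a m"
    by blast
  have "f = m - act s m" if K_fs: "(f, s) \<in> K" for f s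
  proof -
    have f: "f \<in> M" and s: "s \<in> carrier S"
      using K_fs Kc by auto
    \<comment> \<open>Conjugation by \<open>(f, s)\<close> preserves D. Comparing module components
      over \<open>b = s a s^-1\<close> shows that this element is fixed by A.\<close>
    have "f + act s m - m = 0"
    proof (rule fixed)
      show "f + act s m - m \<in> M"
        using f s m(1) by simp
      fix b assume b: "b \<in> A"
      define a where "a = inv s \<otimes> b \<otimes> s"
      have bc: "b \<in> carrier S"
        using b Ac by auto
      have a: "a \<in> A"
        using A_conj[of "inv s" b] s b by (simp add: a_def)
      have ac: "a \<in> carrier S"
        using a Ac by auto
      have sa: "s \<otimes> a = b \<otimes> s"
        using s bc by (simp add: a_def m_assoc inv_cancel)
      have "(f, s) \<otimes>\<^bsub>sd\<^esub> (\<mu> a, a) \<otimes>\<^bsub>sd\<^esub> inv\<^bsub>sd\<^esub> (f, s) \<in> D"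
        unfolding D_def by (rule sd.derived_series_conj[OF K(1) K_fs \<mu>[OF a, unfolded D_def]])
      moreover have \<mu>aM: "\<mu> a \<in> M"
        using \<mu>[OF a] Dc by auto
      ultimately have "(f + act s (\<mu> a) - act b f, b) \<in> D"
        using f s ac bc sa by (simp add: inv_sd act_minus act_mult[symmetric] m_assoc)
      from D_unique[OF this \<mu>[OF b]] have "f + act s (m - act a m) - act b f = m - act b m"
        using m(2)[OF a] m(2)[OF b] by simp
      moreover have "act s (act a m) = act b (act s m)"
        using s ac bc by (simp add: act_mult[symmetric] sa)
      ultimately show "act b (f + act s m - m) = f + act s m - m"
        by (simp add: act_diff act_add algebra_simps)
    qed
    then show ?thesis
      by (simp add: algebra_simps)
  qed
  with m(1) show ?thesis
    by blast
qed

end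

text \<open>The nonempty fibres of f on V are translates of its kernel. V is a subset of a type and
  f is additive only there, so everything is phrased by differences.\<close>

lemma card_kernel_image:
  fixes f :: "'x::ab_group_add \<Rightarrow> 'y::ab_group_add"
  assumes fin: "finite V" and zero: "0 \<in> V" and diff: "\<And>v w. \<lbrakk>v \<in> V; w \<in> V\<rbrakk> \<Longrightarrow> v - w \<in> V"
    and hom: "\<And>v w. \<lbrakk>v \<in> V; w \<in> V\<rbrakk> \<Longrightarrow> f (v - w) = f v - f w"
  shows "card V = card {v \<in> V. f v = 0} * card (f ` V)"
proof -
  have add: "v + w \<in> V \<and> f (v + w) = f v + f w" if "v \<in> V" "w \<in> V" for v w
  proof -
    have "0 - w \<in> V" "f (0 - w) = f 0 - f w" "f (0 - 0) = f 0 - f 0"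
      using that zero diff hom by blast+
    then show ?thesis
      using that diff[of v "0 - w"] hom[of v "0 - w"] by simp
  qed
  have "card V = (\<Sum>y\<in>f ` V. card {v \<in> V. f v = y})"
    using sum.image_gen[OF fin, of "\<lambda>_. 1::nat" f] by simp
  also have "\<dots> = (\<Sum>y\<in>f ` V. card {v \<in> V. f v = 0})"
  proof (rule sum.cong)
    fix y assume "y \<in> f ` V"
    then obtain w where w: "w \<in> V" "f w = y" by auto
    have "bij_betw (\<lambda>v. v + w) {v \<in> V. f v = 0} {v \<in> V. f v = y}"
      by (rule bij_betw_byWitness[where f' = "\<lambda>v. v - w"]) (use w add diff hom in auto)
    then show "card {v \<in> V. f v = y} = card {v \<in> V. f v = 0}"
      using bij_betw_same_card by fastforce
  qed simp
  finally show ?thesis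
    by simp
qed

section \<open>Norm map, norm kernel and fixed points\<close>

context group_action_on_module
begin

definition norm_map :: "'s set \<Rightarrow> 'm \<Rightarrow> 'm" where
  "norm_map A f = (\<Sum>a\<in>A. act a f)"

definition norm_kernel :: "'s set \<Rightarrow> 'm set" where
  "norm_kernel A = {f \<in> M. norm_map A f = 0}"

definition fixed_points :: "'s set \<Rightarrow> 'm set" where
  "fixed_points A = {f \<in> M. \<forall>a\<in>A. act a f = f}"

lemma norm_map_diff: "norm_map A (f - g) = norm_map A f - norm_map A g"
  by (simp add: norm_map_def act_diff sum_subtractf)

lemma act_sum: "act s (sum f I) = (\<Sum>i\<in>I. act s (f i))"
  by (induction I rule: infinite_finite_induct) (simp_all add: act_add)

lemma norm_map_closed: "\<lbrakk>A \<subseteq> carrier S; f \<in> M\<rbrakk> \<Longrightarrow> norm_map A f \<in> M"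
  unfolding norm_map_def by (intro sum_closed) auto

text \<open>One has \<open>a s = s (s^-1 a s)\<close>, and conjugation permutes the normal subgroup
  A. This makes the norm kernel stable under \<open>S\<close>.\<close>

lemma norm_map_act:
  assumes "A \<lhd> S" "s \<in> carrier S"
  shows "norm_map A (act s f) = act s (norm_map A f)"
proof -
  interpret A: normal A S by fact
  have "norm_map A (act s f) = (\<Sum>a\<in>A. act s (act (inv s \<otimes> a \<otimes> s) f))"
    unfolding norm_map_def using assms(2) A.subset
    by (intro sum.cong) (auto simp: m_assoc inv_cancel simp flip: act_mult)
  also have "\<dots> = (\<Sum>a\<in>A. act s (act a f))"
  proof (rule sum.reindex_bij_betw)
    show "bij_betw (\<lambda>a. inv s \<otimes> a \<otimes> s) A A"
      by (rule bij_betw_byWitness[where f' = "\<lambda>a. s \<otimes> a \<otimes> inv s"])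
         (use assms(2) A.subset A.inv_op_closed1 A.inv_op_closed2
          in \<open>auto simp: m_assoc inv_cancel subset_iff\<close>)
  qed
  finally show ?thesis
    by (simp add: norm_map_def act_sum)
qed

lemma act_norm_map:
  assumes "subgroup A S" "a \<in> A"
  shows "act a (norm_map A f) = norm_map A f"
proof -
  interpret A: subgroup A S by fact
  have "act a (norm_map A f) = (\<Sum>b\<in>A. act (a \<otimes> b) f)"
    using A.subset assms(2) by (auto simp: norm_map_def act_sum act_mult intro!: sum.cong)
  also have "\<dots> = norm_map A f"
    unfolding norm_map_def
  proof (rule sum.reindex_bij_betw)
    show "bij_betw (\<lambda>b. a \<otimes> b) A A"
      by (rule bij_betw_byWitness[where f' = "\<lambda>b. inv a \<otimes> b"])
         (use assms(2) A.subset in \<open>auto simp: inv_cancel subset_iff\<close>)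
  qed
  finally show ?thesis .
qed

lemma group_action_on_norm_kernel:
  assumes "A \<lhd> S"
  shows "group_action_on_module S (norm_kernel A) act"
proof unfold_locales
  show "0 \<in> norm_kernel A"
    by (simp add: norm_kernel_def norm_map_def)
  show "f - g \<in> norm_kernel A" if "f \<in> norm_kernel A" "g \<in> norm_kernel A" for f g
    using that by (simp add: norm_kernel_def norm_map_diff)
  show "act s f \<in> norm_kernel A" if "s \<in> carrier S" "f \<in> norm_kernel A" for s f
    using that by (simp add: norm_kernel_def norm_map_act[OF assms])
  show "act \<one> f = f" if "f \<in> norm_kernel A" for f
    using that by (simp add: norm_kernel_def)
qed (simp_all add: act_add act_mult)

end

section \<open>Counting coboundaries and lifts\<close>

context group_action_on_module
begin

lemma fixed_points_generate:
  assumes "s \<in> carrier S"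
  shows "fixed_points (generate S {s}) = {f \<in> M. act s f = f}"
proof -
  have "act h f = f" if "h \<in> generate S {s}" "f \<in> M" "act s f = f" for h f
    using that(1)
  proof induction
    case (inv h)
    then show ?case
      using act_inv_cancel(2)[OF assms that(2)] that(3) by simp
  next
    case (eng h1 h2)
    then show ?case
      using generate_in_carrier[of "{s}"] assms by (simp add: act_mult)
  qed (use that in auto)
  moreover have "s \<in> generate S {s}"
    by (rule generate.incl) simp
  ultimately show ?thesis
    unfolding fixed_points_def by blast
qed

text \<open>Kernel and image of \<open>1 - s\<close>. An upper bound on fixed points becomes a lower
  bound on the number of \<open>M\<close>-conjugates of s.\<close>

lemma card_coboundaries:
  assumes "finite M" "s \<in> carrier S"
  shows "card M = card {f \<in> M. act s f = f} * card ((\<lambda>f. f - act s f) ` M)"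
proof -
  have "card M = card {f \<in> M. f - act s f = 0} * card ((\<lambda>f. f - act s f) ` M)"
    using assms by (intro card_kernel_image) (auto simp: act_diff)
  moreover have "{f \<in> M. f - act s f = 0} = {f \<in> M. act s f = f}"
    by auto
  ultimately show ?thesis by simp
qed

fun lift_values :: "(F_gen \<Rightarrow> 's) \<Rightarrow> F_gen \<Rightarrow> 'm set" where
  "lift_values s (Delta l) = (\<lambda>m. m - act (s (Delta l)) m) ` M"
| "lift_values s _ = M"

text \<open>The conditions on a lift concern one generator at a time, so lifts form a product of
  sets; extension by 0 inverts the restriction.\<close>

lemma bij_betw_lifts:
  assumes "range s \<subseteq> carrier S"
  shows "bij_betw (\<lambda>v. restrict v X) (lifts s X) (\<Pi>\<^sub>E y\<in>X. lift_values s y)"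
proof (rule bij_betw_byWitness[where f' = "\<lambda>g y. if y \<in> X then g y else 0"])
  have sub: "lift_values s y \<subseteq> M" for y
  proof (cases y)
    case (Delta l)
    have "s (Delta l) \<in> carrier S"
      using assms by auto
    then show ?thesis
      by (auto simp: Delta)
  qed simp_all
  have zero: "0 \<in> lift_values s y" for y
    by (cases y) (auto intro!: image_eqI[of _ _ 0])
  have D: "v (Delta l) \<in> lift_values s (Delta l)" if "v \<in> lifts s X" for v l
    using liftsD(3)[OF that] by simp
  have M: "v y \<in> lift_values s y" if "v \<in> lifts s X" for v y
    using liftsD(1)[OF that] D[OF that] by (cases y) simp_all
  show "(\<lambda>v. restrict v X) ` lifts s X \<subseteq> (\<Pi>\<^sub>E y\<in>X. lift_values s y)"
    using M by auto
  show "(\<lambda>g y. if y \<in> X then g y else 0) ` (\<Pi>\<^sub>E y\<in>X. lift_values s y) \<subseteq> lifts s X"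
  proof (rule image_subsetI)
    fix g assume g: "g \<in> (\<Pi>\<^sub>E y\<in>X. lift_values s y)"
    let ?v = "\<lambda>y. if y \<in> X then g y else 0"
    have v: "?v y \<in> lift_values s y" for y
      using g zero by auto
    show "?v \<in> lifts s X"
    proof (rule liftsI)
      show "?v y \<in> M" for y
        using v sub by blast
      show "?v (Delta l) \<in> (\<lambda>m. m - act (s (Delta l)) m) ` M" for l
        using v[of "Delta l"] by (simp only: lift_values.simps)
    qed simp
  qed
qed (auto dest: liftsD(2) simp: fun_eq_iff PiE_def extensional_def)

lemma card_lifts:
  assumes s: "range s \<subseteq> carrier S" and fin: "finite M"
  shows "card (lifts s (F_gens g r k)) = card M ^ (2 * g + r) * (\<Prod>l<k. card (lift_values s (Delta l)))"
proof -
  have "card (lifts s (F_gens g r k)) = (\<Prod>y\<in>F_gens g r k. card (lift_values s y))"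
    using bij_betw_same_card[OF bij_betw_lifts[OF s]] by (simp add: card_PiE)
  also have "\<dots> = (\<Prod>y\<in>Alpha ` {..<g}. card (lift_values s y)) * (\<Prod>y\<in>Beta ` {..<g}. card (lift_values s y))
      * (\<Prod>y\<in>Gamma ` {..<r}. card (lift_values s y)) * (\<Prod>y\<in>Delta ` {..<k}. card (lift_values s y))"
  proof -
    have "(Alpha ` {..<g}) \<inter> (Beta ` {..<g}) = {}"
      "(Alpha ` {..<g} \<union> Beta ` {..<g}) \<inter> (Gamma ` {..<r}) = {}"
      "(Alpha ` {..<g} \<union> Beta ` {..<g} \<union> Gamma ` {..<r}) \<inter> (Delta ` {..<k}) = {}"
      by auto
    then show ?thesis
      unfolding F_gens_def by (simp only: prod.union_disjoint finite_imageI finite_lessThan finite_Un)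
  qed
  also have "\<dots> = card M ^ g * card M ^ g * card M ^ r * (\<Prod>l<k. card (lift_values s (Delta l)))"
    by (simp add: prod.reindex inj_on_def)
  finally show ?thesis
    by (simp add: power_add mult_2)
qed

end

lemma (in group) system_ord:
  assumes "system G g r os s" "l < length os"
  shows "card (generate G {s (Delta l)}) = os ! l"
proof -
  have s: "s (Delta l) \<in> carrier G" and ord: "\<And>n. s (Delta l) [^] (n::nat) = \<one> \<longleftrightarrow> os ! l dvd n"
    using assms by (auto simp: system_def)
  have "ord (s (Delta l)) dvd n \<longleftrightarrow> os ! l dvd n" for n
    using pow_eq_id[OF s] ord by simp
  then have "ord (s (Delta l)) = os ! l"
    by (metis dvd_antisym dvd_refl)
  then show ?thesis
    using generate_pow_card[OF s] by simp
qed

text \<open>Averaging over subgroups needs the order of the group to be invertible modulo \<open>q\<close>.\<close>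

locale coprime_fun_mod = group S for S :: "('s, 'b) monoid_scheme" (structure) +
  fixes q :: nat
  assumes fin: "finite (carrier S)" and q: "q = Suc (order S)"
begin

sublocale group_action_on_module S "fun_mod S q" "fun_act S"
  by (rule group_action_on_fun_mod)

lemma q_pos: "q > 0" and q_ge_2: "q \<ge> 2"
  using fin q order_gt_0_iff_finite by auto

lemma finite_subset_fun_mod: "V \<subseteq> fun_mod S q \<Longrightarrow> finite V"
  using finite_fun_mod[OF fin q_pos] finite_subset by blast

definition fun_smul :: "nat \<Rightarrow> ('s \<Rightarrow> circ) \<Rightarrow> 's \<Rightarrow> circ" where
  "fun_smul c f = (\<lambda>x. smul c (f x))"

lemma fun_smul_closed: "f \<in> fun_mod S q \<Longrightarrow> fun_smul c f \<in> fun_mod S q"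
  by (auto simp: fun_smul_def fun_mod_def tors_closed)

lemma fun_smul_diff: "fun_smul c (f - g) = fun_smul c f - fun_smul c g"
  by (simp add: fun_smul_def fun_eq_iff smul_diff)

lemma fun_smul_zero: "fun_smul c 0 = 0"
  by (simp add: fun_smul_def fun_eq_iff)

lemma fun_smul_sum: "fun_smul c (sum f I) = (\<Sum>i\<in>I. fun_smul c (f i))"
  by (simp add: fun_smul_def fun_eq_iff sum_fun_apply smul_sum)

lemma act_fun_smul: "fun_act S s (fun_smul c f) = fun_smul c (fun_act S s f)"
  by (auto simp: fun_smul_def fun_eq_iff fun_act_def)

lemma norm_map_fun_smul: "norm_map A (fun_smul c f) = fun_smul c (norm_map A f)"
  by (simp add: norm_map_def act_fun_smul fun_smul_sum)

lemma sum_const_fun_smul: "(\<Sum>i\<in>I. f) = fun_smul (card I) f"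
  by (simp add: fun_smul_def fun_eq_iff sum_fun_apply sum_const_circ)

text \<open>With n = |S| and q = n + 1 the square of n is 1 modulo q, so n times the index of A is
  an inverse of |A|.\<close>

lemma ex_fun_smul_inverse:
  assumes "subgroup A S"
  shows "\<exists>c. \<forall>f\<in>fun_mod S q. fun_smul c (fun_smul (card A) f) = f"
proof -
  define n where "n = order S"
  have "card (rcosets A) * card A = n"
    unfolding n_def by (rule lagrange[OF assms])
  then have mult: "n * card (rcosets A) * card A = n * n"
    by (simp add: mult.assoc)
  obtain m where m: "n = Suc m"
    using fin order_gt_0_iff_finite gr0_implies_Suc unfolding n_def by blast
  then have nn: "n * n = Suc (m * q)"
    by (simp add: q n_def[symmetric])
  have "fun_smul (n * card (rcosets A)) (fun_smul (card A) f) = f" if f: "f \<in> fun_mod S q" for f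
  proof
    fix x
    have "smul q (f x) = 0"
      using f by (simp add: fun_mod_def tors_def)
    then have "smul (n * card (rcosets A) * card A) (f x) = f x"
      unfolding mult nn smul_Suc smul_mult by simp
    then show "fun_smul (n * card (rcosets A)) (fun_smul (card A) f) x = f x"
      by (simp add: fun_smul_def smul_mult)
  qed
  then show ?thesis by blast
qed

text \<open>A function is invariant under left translation by H exactly when it is constant on the
  right cosets of H.\<close>

lemma card_fixed_points:
  assumes H: "subgroup H S"
  shows "card (fixed_points H) = q ^ card (rcosets H)"
proof -
  interpret H: subgroup H S by fact
  have coset: "H #> x \<in> rcosets H" if "x \<in> carrier S" for x
    using that by (auto simp: RCOSETS_def)
  have coset_mult: "H #> (h \<otimes> x) = H #> x" if "h \<in> H" "x \<in> carrier S" for h x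
    using that H.subset by (simp add: coset_mult_assoc[symmetric] H.rcos_const subsetD)
  define \<Phi> where "\<Phi> F = (\<lambda>x. if x \<in> carrier S then F (H #> x) else (0::circ))" for F :: "'s set \<Rightarrow> circ"
  have "bij_betw \<Phi> (rcosets H \<rightarrow>\<^sub>E tors q) (fixed_points H)"
  proof (rule bij_betw_imageI)
    show "inj_on \<Phi> (rcosets H \<rightarrow>\<^sub>E tors q)"
    proof (rule inj_onI)
      fix F F' assume F: "F \<in> rcosets H \<rightarrow>\<^sub>E tors q" "F' \<in> rcosets H \<rightarrow>\<^sub>E tors q" "\<Phi> F = \<Phi> F'"
      have "F C = F' C" if "C \<in> rcosets H" for C
      proof -
        obtain x where "x \<in> carrier S" "C = H #> x"
          using \<open>C \<in> rcosets H\<close> by (auto simp: RCOSETS_def)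
        then show ?thesis
          using fun_cong[OF F(3), of x] by (simp add: \<Phi>_def)
      qed
      with F(1,2) show "F = F'"
        by (rule PiE_ext)
    qed
    show "\<Phi> ` (rcosets H \<rightarrow>\<^sub>E tors q) = fixed_points H"
    proof (intro equalityI subsetI)
      fix f assume "f \<in> \<Phi> ` (rcosets H \<rightarrow>\<^sub>E tors q)"
      then obtain F where F: "F \<in> rcosets H \<rightarrow>\<^sub>E tors q" "f = \<Phi> F" by auto
      have "f \<in> fun_mod S q"
        using F coset by (auto simp: \<Phi>_def fun_mod_def tors_closed)
      moreover have "fun_act S h f = f" if "h \<in> H" for h
      proof
        fix x show "fun_act S h f x = f x"
          using coset_mult[OF H.m_inv_closed[OF that]] that H.subset
          by (auto simp: fun_act_def F(2) \<Phi>_def subset_iff)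
      qed
      ultimately show "f \<in> fixed_points H"
        by (simp add: fixed_points_def)
    next
      fix f assume f: "f \<in> fixed_points H"
      define F where "F = (\<lambda>C\<in>rcosets H. f (SOME x. x \<in> C))"
      have val: "F (H #> x) = f x" if x: "x \<in> carrier S" for x
      proof -
        have "(SOME z. z \<in> H #> x) \<in> H #> x"
          using rcos_self[OF x H] by (rule someI)
        then obtain h where h: "h \<in> H" "(SOME z. z \<in> H #> x) = h \<otimes> x"
          by (auto simp: r_coset_def)
        have "fun_act S (inv h) f x = f x"
          using f h(1) by (simp add: fixed_points_def)
        then have "f (h \<otimes> x) = f x"
          using x h(1) H.subset by (simp add: fun_act_def subset_iff)
        then show ?thesis
          using coset[OF x] by (simp add: F_def h(2))
      qed
      have "f \<in> fun_mod S q"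
        using f by (simp add: fixed_points_def)
      then have f0: "f x \<in> tors q" "x \<notin> carrier S \<Longrightarrow> f x = 0" for x
        by (simp_all add: fun_mod_def)
      then have "f = \<Phi> F"
        using val by (simp add: \<Phi>_def fun_eq_iff)
      moreover have "F \<in> rcosets H \<rightarrow>\<^sub>E tors q"
        using f0(1) by (auto simp: F_def)
      ultimately show "f \<in> \<Phi> ` (rcosets H \<rightarrow>\<^sub>E tors q)"
        by blast
    qed
  qed
  then have "card (fixed_points H) = card (rcosets H \<rightarrow>\<^sub>E tors q)"
    using bij_betw_same_card by fastforce
  moreover have "finite (rcosets H)"
    using fin rcosets_part_G[OF H] finite_UnionD by metis
  ultimately show ?thesis
    by (simp add: card_PiE card_tors q_pos)
qed

lemma ln_card_fixed_points:
  assumes H: "subgroup H S"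
  shows "ln (card (fixed_points H)) = ln q * order S / card H"
proof -
  have "card H > 0"
    using H fin by (metis card_gt_0_iff empty_iff finite_subset subgroup.one_closed subgroup.subset)
  then have "real (card (rcosets H)) = real (order S) / real (card H)"
    using lagrange[OF H] by (metis nonzero_mult_div_cancel_right of_nat_0_less_iff of_nat_mult order_less_irrefl)
  then show ?thesis
    using q_pos by (simp add: card_fixed_points[OF H] ln_realpow)
qed

text \<open>Both bounds count the norm map on the C-fixed vectors. Its image consists of A-fixed
  vectors, and it contains every f fixed by A C, because f is the norm of f divided by |A|.\<close>

lemma card_norm_kernel_fixed_points:
  assumes A: "A \<lhd> S" and C: "subgroup C S"
  shows "card (norm_kernel A \<inter> fixed_points C) * card (fixed_points (A <#> C)) \<le> card (fixed_points C)"
    and "card (fixed_points C) \<le> card (norm_kernel A \<inter> fixed_points C) * card (fixed_points A)"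
proof -
  interpret A: normal A S by fact
  interpret C: subgroup C S by fact
  have AS: "subgroup A S" by (rule A.subgroup_axioms)
  let ?V = "fixed_points C"
  have V: "?V \<subseteq> fun_mod S q"
    by (auto simp: fixed_points_def)
  have eq: "card ?V = card {f \<in> ?V. norm_map A f = 0} * card (norm_map A ` ?V)"
    using finite_subset_fun_mod[OF V]
    by (intro card_kernel_image) (auto simp: fixed_points_def norm_map_diff act_diff)
  have ker: "{f \<in> ?V. norm_map A f = 0} = norm_kernel A \<inter> ?V"
    by (auto simp: norm_kernel_def fixed_points_def)
  have fin_img: "finite (norm_map A ` ?V)" "finite (fixed_points A)"
    using finite_subset_fun_mod[OF V] finite_subset_fun_mod[of "fixed_points A"]
    by (auto simp: fixed_points_def)
  have "fixed_points (A <#> C) \<subseteq> norm_map A ` ?V"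
  proof
    fix f assume f: "f \<in> fixed_points (A <#> C)"
    obtain c where c: "\<forall>f\<in>fun_mod S q. fun_smul c (fun_smul (card A) f) = f"
      using ex_fun_smul_inverse[OF AS] by blast
    have fM: "f \<in> fun_mod S q"
      using f by (simp add: fixed_points_def)
    have "a \<in> A <#> C" if "a \<in> A" for a
    proof -
      have "a \<otimes> \<one> \<in> A <#> C"
        using that C.one_closed unfolding set_mult_def by blast
      then show ?thesis
        using that A.subset by (simp add: subsetD)
    qed
    then have fA: "fun_act S a f = f" if "a \<in> A" for a
      using f that by (simp add: fixed_points_def)
    have "b \<in> A <#> C" if "b \<in> C" for b
    proof -
      have "\<one> \<otimes> b \<in> A <#> C"
        using that A.one_closed unfolding set_mult_def by blast
      then show ?thesis
        using that C.subset by (simp add: subsetD)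
    qed
    then have fC: "fun_act S b f = f" if "b \<in> C" for b
      using f that by (simp add: fixed_points_def)
    have "norm_map A f = fun_smul (card A) f"
      using fA by (simp add: norm_map_def sum_const_fun_smul)
    then have "norm_map A (fun_smul c f) = fun_smul c (fun_smul (card A) f)"
      by (simp add: norm_map_fun_smul)
    also have "\<dots> = f"
      using c fM by blast
    finally have "f = norm_map A (fun_smul c f)" ..
    moreover have "fun_smul c f \<in> ?V"
      using fC fM by (simp add: fixed_points_def fun_smul_closed act_fun_smul)
    ultimately show "f \<in> norm_map A ` ?V"
      by blast
  qed
  then have "card (fixed_points (A <#> C)) \<le> card (norm_map A ` ?V)"
    using fin_img by (intro card_mono)
  then show "card (norm_kernel A \<inter> ?V) * card (fixed_points (A <#> C)) \<le> card ?V"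
    unfolding eq ker by (rule mult_left_mono) simp
  have "norm_map A ` ?V \<subseteq> fixed_points A"
    using V norm_map_closed[OF A.subset] act_norm_map[OF AS] by (auto simp: fixed_points_def)
  then have "card (norm_map A ` ?V) \<le> card (fixed_points A)"
    using fin_img by (intro card_mono)
  then show "card ?V \<le> card (norm_kernel A \<inter> ?V) * card (fixed_points A)"
    unfolding eq ker by (rule mult_left_mono) simp
qed

lemma card_pos_of_zero: "0 \<in> V \<Longrightarrow> V \<subseteq> fun_mod S q \<Longrightarrow> card V > 0"
  using finite_subset_fun_mod card_gt_0_iff by blast

lemma zero_in_fixed_points: "0 \<in> fixed_points H"
  by (simp add: fixed_points_def)

lemma zero_in_norm_kernel: "0 \<in> norm_kernel A"
  by (simp add: norm_kernel_def norm_map_def)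

text \<open>The case of trivial C: the whole module has q^|S| elements and its A-fixed part
  q^(|S|/|A|).\<close>

lemma ln_card_norm_kernel_ge:
  assumes A: "A \<lhd> S"
  shows "ln q * order S * (1 - 1 / card A) \<le> ln (card (norm_kernel A))"
proof -
  have AS: "subgroup A S"
    using A by (rule normal_imp_subgroup)
  have fix1: "fixed_points {\<one>} = fun_mod S q"
    by (auto simp: fixed_points_def)
  have sub: "norm_kernel A \<subseteq> fun_mod S q"
    by (auto simp: norm_kernel_def)
  then have "card (fixed_points {\<one>}) \<le> card (norm_kernel A) * card (fixed_points A)"
    using card_norm_kernel_fixed_points(2)[OF A triv_subgroup] by (simp add: fix1 Int_absorb2)
  moreover have pos: "card (norm_kernel A) > 0" "card (fixed_points A) > 0" "card (fixed_points {\<one>}) > 0"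
    using sub by (auto intro!: card_pos_of_zero zero_in_norm_kernel zero_in_fixed_points simp: fixed_points_def)
  ultimately have "real (card (fixed_points {\<one>})) \<le> real (card (norm_kernel A)) * real (card (fixed_points A))"
    by (metis of_nat_le_iff of_nat_mult)
  then have "ln (card (fixed_points {\<one>})) \<le> ln (real (card (norm_kernel A)) * real (card (fixed_points A)))"
    using pos by (intro ln_mono mult_pos_pos) simp_all
  then show ?thesis
    using pos by (simp add: ln_mult ln_card_fixed_points[OF AS] ln_card_fixed_points[OF triv_subgroup] algebra_simps)
qed

text \<open>This is \<open>|M^C| \<le> |M|^(1/|C|)\<close> for the norm kernel M. It rests on |A C|
  \<le> |A| |C|, which gives 1/|C| - 1/|A C| \<le> (1 - 1/|A|)/|C|.\<close>

lemma ln_card_norm_kernel_fixed_le: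
  assumes A: "A \<lhd> S" and C: "subgroup C S"
  shows "ln (card (norm_kernel A \<inter> fixed_points C)) \<le> ln (card (norm_kernel A)) / card C"
proof -
  have AS: "subgroup A S"
    using A by (rule normal_imp_subgroup)
  have AC: "subgroup (A <#> C) S"
    by (rule mult_norm_subgroup[OF A C])
  have finAC: "finite A" "finite C" "finite (A <#> C)"
    using fin AS C AC by (auto dest: subgroup.subset finite_subset)
  have pos: "card (norm_kernel A \<inter> fixed_points C) > 0" "card (fixed_points (A <#> C)) > 0"
    by (auto intro!: card_pos_of_zero zero_in_norm_kernel zero_in_fixed_points simp: fixed_points_def)
  have cpos: "card A > 0" "card C > 0" "card (A <#> C) > 0"
    using finAC AS C AC subgroup.one_closed by (metis card_gt_0_iff empty_iff)+
  have "A <#> C = (\<lambda>(a, c). a \<otimes> c) ` (A \<times> C)"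
    by (auto simp: set_mult_def)
  then have "card (A <#> C) \<le> card A * card C"
    using card_image_le[of "A \<times> C" "\<lambda>(a, c). a \<otimes> c"] finAC by (simp add: card_cartesian_product)
  then have "real (card (A <#> C)) \<le> real (card A) * real (card C)"
    by (metis of_nat_le_iff of_nat_mult)
  then have inv: "1 / (real (card A) * real (card C)) \<le> 1 / real (card (A <#> C))"
    using cpos by (intro frac_le) simp_all
  let ?a = "card (norm_kernel A \<inter> fixed_points C)" and ?b = "card (fixed_points (A <#> C))"
  have "real ?a * real ?b \<le> real (card (fixed_points C))"
    using card_norm_kernel_fixed_points(1)[OF A C] by (metis of_nat_le_iff of_nat_mult)
  then have "ln (real ?a * real ?b) \<le> ln (card (fixed_points C))"
    using pos by (intro ln_mono mult_pos_pos) simp_all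
  then have "ln (card (norm_kernel A \<inter> fixed_points C))
      \<le> ln q * order S / card C - ln q * order S / card (A <#> C)"
    using pos by (simp add: ln_mult ln_card_fixed_points[OF C] ln_card_fixed_points[OF AC])
  also have "\<dots> = ln q * order S * (1 / card C - 1 / card (A <#> C))"
    by (simp add: algebra_simps)
  also have "\<dots> \<le> ln q * order S * (1 / card C - 1 / (real (card A) * real (card C)))"
    using inv q_pos by (intro mult_left_mono) auto
  also have "\<dots> = (ln q * order S * (1 - 1 / card A)) / card C"
    using cpos by (simp add: field_simps)
  also have "\<dots> \<le> ln (card (norm_kernel A)) / card C"
    using ln_card_norm_kernel_ge[OF A] by (intro divide_right_mono) auto
  finally show ?thesis .
qed

text \<open>The norm multiplies an A-fixed vector by |A|, which is invertible modulo q.\<close>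

lemma norm_kernel_fixed_eq_0:
  assumes A: "subgroup A S" and f: "f \<in> norm_kernel A" "\<And>a. a \<in> A \<Longrightarrow> fun_act S a f = f"
  shows "f = 0"
proof -
  obtain c where c: "\<forall>f\<in>fun_mod S q. fun_smul c (fun_smul (card A) f) = f"
    using ex_fun_smul_inverse[OF A] by blast
  have "norm_map A f = fun_smul (card A) f"
    using f(2) by (simp add: norm_map_def sum_const_fun_smul)
  then have "fun_smul (card A) f = 0"
    using f(1) by (simp add: norm_kernel_def)
  moreover have "fun_smul c (fun_smul (card A) f) = f"
    using c f(1) by (simp add: norm_kernel_def)
  ultimately show ?thesis
    by (simp add: fun_smul_zero)
qed

text \<open>Vanishing of H^1 by averaging: m is the mean of the values of \<open>\<mu>\<close>, and
  the cocycle identity is summed over its second argument.\<close>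

lemma norm_kernel_cocycle:
  assumes A: "subgroup A S"
    and \<mu>: "\<And>a. a \<in> A \<Longrightarrow> \<mu> a \<in> norm_kernel A"
      "\<And>a b. \<lbrakk>a \<in> A; b \<in> A\<rbrakk> \<Longrightarrow> \<mu> (a \<otimes> b) = \<mu> a + fun_act S a (\<mu> b)"
  shows "\<exists>m\<in>norm_kernel A. \<forall>a\<in>A. \<mu> a = m - fun_act S a m"
proof -
  interpret A: subgroup A S by fact
  obtain c where c: "\<forall>f\<in>fun_mod S q. fun_smul c (fun_smul (card A) f) = f"
    using ex_fun_smul_inverse[OF A] by blast
  define m where "m = fun_smul c (\<Sum>b\<in>A. \<mu> b)"
  have "(\<Sum>b\<in>A. \<mu> b) \<in> fun_mod S q"
    using \<mu>(1) by (intro sum_closed) (simp add: norm_kernel_def)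
  moreover have "norm_map A (\<Sum>b\<in>A. \<mu> b) = (\<Sum>b\<in>A. norm_map A (\<mu> b))"
    unfolding norm_map_def act_sum by (rule sum.swap)
  then have "norm_map A (\<Sum>b\<in>A. \<mu> b) = 0"
    using \<mu>(1) by (simp add: norm_kernel_def)
  ultimately have "m \<in> norm_kernel A"
    by (simp add: m_def norm_kernel_def fun_smul_closed norm_map_fun_smul fun_smul_zero)
  moreover have "\<mu> a = m - fun_act S a m" if a: "a \<in> A" for a
  proof -
    have "(\<Sum>b\<in>A. \<mu> (a \<otimes> b)) = (\<Sum>b\<in>A. \<mu> b)"
    proof (rule sum.reindex_bij_betw)
      show "bij_betw (\<lambda>b. a \<otimes> b) A A"
        by (rule bij_betw_byWitness[where f' = "\<lambda>b. inv a \<otimes> b"])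
           (use a A.subset in \<open>auto simp: inv_cancel subset_iff\<close>)
    qed
    then have "(\<Sum>b\<in>A. \<mu> b) = (\<Sum>b\<in>A. \<mu> a) + fun_act S a (\<Sum>b\<in>A. \<mu> b)"
      using a \<mu>(2) by (simp add: act_sum sum.distrib)
    then have "(\<Sum>b\<in>A. \<mu> b) - fun_act S a (\<Sum>b\<in>A. \<mu> b) = fun_smul (card A) (\<mu> a)"
      by (metis add_diff_cancel_right' sum_const_fun_smul)
    moreover have "m - fun_act S a m = fun_smul c ((\<Sum>b\<in>A. \<mu> b) - fun_act S a (\<Sum>b\<in>A. \<mu> b))"
      by (simp only: m_def act_fun_smul fun_smul_diff)
    moreover have "fun_smul c (fun_smul (card A) (\<mu> a)) = \<mu> a"
      using c \<mu>(1)[OF a] by (simp add: norm_kernel_def)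
    ultimately show ?thesis
      by simp
  qed
  ultimately show ?thesis by blast
qed

end

definition hyperbolic :: "nat \<Rightarrow> nat \<Rightarrow> nat list \<Rightarrow> bool" where
  "hyperbolic g r os \<longleftrightarrow> 2 - 2 * real g - real r - (\<Sum>n\<leftarrow>os. 1 - 1 / real n) < 0"

section \<open>Counting lifts that are not conjugate to the given tuple\<close>

context coprime_fun_mod
begin

text \<open>Hyperbolicity gives more than |M|^2 lifts. The relation takes values in M, so more than
  |M| lifts solve it, while conjugates of the given tuple account for at most |M|.\<close>

lemma ex_nonconjugate_lift:
  assumes sys: "system S g r os s" and hyp: "hyperbolic g r os"
    and A: "A \<lhd> S" "card A \<ge> 2"
  shows "\<exists>v\<in>group_action_on_module.lifts (norm_kernel A) (fun_act S) s (F_gens g r (length os)).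
    fox s v (relator_word g r (length os)) = 0 \<and>
    \<not> (\<exists>m\<in>norm_kernel A. \<forall>y. v y = m - fun_act S (s y) m)"
proof -
  define M where "M = norm_kernel A"
  interpret N: group_action_on_module S M "fun_act S"
    unfolding M_def by (rule group_action_on_norm_kernel[OF A(1)])
  let ?X = "F_gens g r (length os)" and ?W = "relator_word g r (length os)"
  have sc: "range s \<subseteq> carrier S"
    using sys by (simp add: system_def)
  have Msub: "M \<subseteq> fun_mod S q"
    by (auto simp: M_def norm_kernel_def)
  have finM: "finite M"
    by (rule finite_subset_fun_mod[OF Msub])
  define L where "L = ln (real (card M))"
  have "card A \<le> order S"
    using A fin unfolding order_def by (intro card_mono) (auto dest: normal_imp_subgroup subgroup.subset)
  then have "0 < ln (real q) * order S * (1 - 1 / card A)"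
    using q_ge_2 A(2) by (intro mult_pos_pos) auto
  with ln_card_norm_kernel_ge[OF A(1)] have L: "L > 0"
    by (simp add: L_def M_def)
  have cardM: "card M > 0"
    using card_pos_of_zero[OF N.zero_closed Msub] .
  let ?V = "N.lifts s ?X"
  \<comment> \<open>An elliptic generator of order n has at least |M|^(1 - 1/n) lifts; logarithms
    turn the fractional exponents into a linear estimate.\<close>
  have cob: "L * (1 - 1 / (os ! l)) \<le> ln (card (N.lift_values s (Delta l))) \<and> card (N.lift_values s (Delta l)) > 0"
    if l: "l < length os" for l
  proof -
    let ?s = "s (Delta l)"
    have s: "?s \<in> carrier S"
      using sc by auto
    let ?C = "generate S {?s}"
    have C: "subgroup ?C S"
      using s by (intro generate_is_subgroup) simp
    have fixed: "{f \<in> M. fun_act S ?s f = f} = norm_kernel A \<inter> fixed_points ?C"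
      using fixed_points_generate[OF s] Msub by (auto simp: M_def)
    have eq: "card M = card (norm_kernel A \<inter> fixed_points ?C) * card (N.lift_values s (Delta l))"
      using N.card_coboundaries[OF finM s] by (simp add: fixed)
    then have pos: "card (norm_kernel A \<inter> fixed_points ?C) > 0" "card (N.lift_values s (Delta l)) > 0"
      using cardM by (auto intro!: Nat.gr0I)
    then have "L = ln (card (norm_kernel A \<inter> fixed_points ?C)) + ln (card (N.lift_values s (Delta l)))"
      unfolding L_def eq by (simp add: ln_mult)
    moreover have "ln (card (norm_kernel A \<inter> fixed_points ?C)) \<le> L / (os ! l)"
      using ln_card_norm_kernel_fixed_le[OF A(1) C] system_ord[OF sys l] by (simp add: L_def M_def)
    moreover have "L * (1 - 1 / (os ! l)) = L - L / (os ! l)"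
      by (simp add: right_diff_distrib)
    ultimately have "L * (1 - 1 / (os ! l)) \<le> ln (card (N.lift_values s (Delta l)))"
      by linarith
    with pos show ?thesis by blast
  qed
  let ?c = "\<lambda>l. real (card (N.lift_values s (Delta l)))"
  have eq_V: "real (card ?V) = real (card M) ^ (2 * g + r) * (\<Prod>l<length os. ?c l)"
    by (simp add: N.card_lifts[OF sc finM])
  have ln_P: "ln (\<Prod>l<length os. ?c l) = (\<Sum>l<length os. ln (?c l))"
    using cob by (intro ln_prod) auto
  have P_pos: "(\<Prod>l<length os. ?c l) > 0"
    using cob by (intro prod_pos) (auto simp del: N.lift_values.simps)
  have M_pos: "real (card M) ^ (2 * g + r) > 0"
    using cardM by simp
  have lnV: "ln (card ?V) = real (2 * g + r) * L + (\<Sum>l<length os. ln (?c l))"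
    unfolding eq_V ln_mult_pos[OF M_pos P_pos] ln_P using cardM by (simp add: ln_realpow L_def)
  have "real (card ?V) > 0"
    unfolding eq_V using M_pos P_pos by (rule mult_pos_pos)
  then have cardV: "card ?V > 0"
    by simp
  have "(\<Sum>l<length os. L * (1 - 1 / (os ! l))) = L * (\<Sum>n\<leftarrow>os. 1 - 1 / real n)"
    by (simp add: sum_list_sum_nth sum_distrib_left atLeast0LessThan)
  moreover have "(\<Sum>l<length os. L * (1 - 1 / (os ! l)))
      \<le> (\<Sum>l<length os. ln (card (N.lift_values s (Delta l))))"
    using cob by (intro sum_mono) auto
  \<comment> \<open>Hyperbolicity multiplied by the positive number L.\<close>
  moreover have "2 * L < L * (real (2 * g + r) + (\<Sum>n\<leftarrow>os. 1 - 1 / real n))"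
    using hyp L by (simp add: hyperbolic_def)
  ultimately have lnV2: "2 * L < ln (card ?V)"
    unfolding lnV by (simp add: algebra_simps)
  have finV: "finite ?V"
    using cardV card_gt_0_iff by blast
  define Z where "Z = {v \<in> ?V. fox s v ?W = 0}"
  define I where "I = (\<lambda>v. fox s v ?W) ` ?V"
  define B where "B = (\<lambda>m y. m - fun_act S (s y) m) ` M"
  have eqV: "card ?V = card Z * card I"
    unfolding Z_def I_def
    by (rule card_kernel_image[OF finV N.lifts_zero]; rule N.lifts_diff fox_diff; assumption?)
  have "I \<subseteq> M"
    unfolding I_def
  proof (rule image_subsetI)
    fix v assume "v \<in> ?V"
    then have "range v \<subseteq> M"
      using N.liftsD(1) by blast
    then show "fox s v ?W \<in> M"
      by (rule N.fox_closed[OF sc])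
  qed
  then have "card I \<le> card M"
    by (rule card_mono[OF finM])
  then have "card ?V \<le> card Z * card M"
    unfolding eqV by (rule mult_left_mono) simp
  then have "real (card ?V) \<le> real (card Z) * real (card M)"
    by (metis of_nat_le_iff of_nat_mult)
  then have "ln (card ?V) \<le> ln (real (card Z) * real (card M))"
    using cardV by (intro ln_mono) simp_all
  moreover have Zpos: "card Z > 0"
    using cardV unfolding eqV by simp
  ultimately have "ln (card ?V) \<le> ln (card Z) + L"
    unfolding L_def using cardM by (simp add: ln_mult_pos)
  with lnV2 have "ln (real (card M)) < ln (real (card Z))"
    by (simp add: L_def)
  then have "card M < card Z"
    using cardM Zpos by simp
  moreover have "card B \<le> card M"
    unfolding B_def by (rule card_image_le[OF finM])
  moreover have "finite B"
    unfolding B_def by (rule finite_imageI[OF finM])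
  ultimately have "\<not> Z \<subseteq> B"
    using card_mono[of B Z] by linarith
  then obtain v where "v \<in> Z" "v \<notin> B"
    by blast
  then have v: "v \<in> ?V" "fox s v ?W = 0" "v \<notin> (\<lambda>m y. m - fun_act S (s y) m) ` M"
    unfolding Z_def B_def by blast+
  then have "\<not> (\<exists>m\<in>M. \<forall>y. v y = m - fun_act S (s y) m)"
    by (metis (no_types, lifting) ext image_eqI)
  with v(1,2) show ?thesis
    unfolding M_def by blast
qed

end

lemma (in group) derived_series_normal: "(derived G ^^ n) (carrier G) \<lhd> G"
  by (induction n) (simp_all add: normal_self derived_is_normal)

text \<open>The module is the norm kernel of the last nontrivial derived subgroup A. If the derived
  length did not grow, \<open>conjugate_complement\<close> would make the lifted tuple conjugate to
  the old one, against its choice.\<close>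

lemma extend_derived_length:
  fixes S :: "('s, 'b) monoid_scheme" (structure)
  assumes sys: "system S g r os s" and gen: "generating S s" and hyp: "hyperbolic g r os"
    and d: "(derived S ^^ Suc d) (carrier S) = {\<one>}" "(derived S ^^ d) (carrier S) \<noteq> {\<one>}"
  obtains S' :: "nat monoid" and s' where
    "system S' g r os s'" "generating S' s'"
    "(derived S' ^^ Suc (Suc d)) (carrier S') = {\<one>\<^bsub>S'\<^esub>}"
    "(derived S' ^^ Suc d) (carrier S') \<noteq> {\<one>\<^bsub>S'\<^esub>}"
proof -
  interpret group S using sys by (simp add: system_def)
  have fin: "finite (carrier S)" and sc: "range s \<subseteq> carrier S"
    and s1: "\<And>y. y \<notin> F_gens g r (length os) \<Longrightarrow> s y = \<one>"
    and ev: "eval_word S s (relator_word g r (length os)) = \<one>"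
    and ord: "\<And>l n. l < length os \<Longrightarrow> s (Delta l) [^] (n::nat) = \<one> \<longleftrightarrow> os ! l dvd n"
    using sys by (simp_all add: system_def)
  interpret coprime_fun_mod S "Suc (order S)"
    by unfold_locales (rule fin, rule refl)
  let ?q = "Suc (order S)"
  define A where "A = (derived S ^^ d) (carrier S)"
  have A: "A \<lhd> S" and AS: "subgroup A S"
    unfolding A_def using derived_series_normal normal_imp_subgroup by auto
  have finA: "finite A"
    using AS fin subgroup.subset finite_subset by metis
  have "A \<noteq> {\<one>}" "\<one> \<in> A"
    using d(2) subgroup.one_closed[OF AS] by (auto simp: A_def)
  then obtain a where "a \<in> A" "a \<noteq> \<one>"
    by blast
  then have cardA: "card A \<ge> 2"
    using card_mono[OF finA, of "{\<one>, a}"] \<open>\<one> \<in> A\<close> by simp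
  define M where "M = norm_kernel A"
  interpret N: group_action_on_module S M "fun_act S"
    unfolding M_def by (rule group_action_on_norm_kernel[OF A])
  have finM: "finite M"
    using finite_subset_fun_mod[of M] by (auto simp: M_def norm_kernel_def)
  obtain v where v: "v \<in> N.lifts s (F_gens g r (length os))" "fox s v (relator_word g r (length os)) = 0"
    and nconj: "\<not> (\<exists>m\<in>M. \<forall>y. v y = m - fun_act S (s y) m)"
    using ex_nonconjugate_lift[OF sys hyp A cardA] unfolding M_def by blast
  have vM: "range v \<subseteq> M"
    using N.liftsD(1)[OF v(1)] by auto
  define x where "x = (\<lambda>y. (v y, s y))"
  have xsd: "range x \<subseteq> carrier N.sd"
    using sc vM by (auto simp: x_def)
  have sys_x: "system N.sd g r os x"
    unfolding system_def
  proof (intro conjI allI impI)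
    show "x y = \<one>\<^bsub>N.sd\<^esub>" if "y \<notin> F_gens g r (length os)" for y
      using s1[OF that] N.liftsD(2)[OF v(1) that] by (simp add: x_def)
    show "eval_word N.sd x (relator_word g r (length os)) = \<one>\<^bsub>N.sd\<^esub>"
      using N.eval_word_sd[OF sc vM] v(2) ev by (simp add: x_def)
    fix l n assume l: "l < length os"
    obtain m where "m \<in> M" "v (Delta l) = m - fun_act S (s (Delta l)) m"
      using N.liftsD(3)[OF v(1), of l] by auto
    moreover have "s (Delta l) \<in> carrier S"
      using sc by auto
    ultimately show "x (Delta l) [^]\<^bsub>N.sd\<^esub> (n::nat) = \<one>\<^bsub>N.sd\<^esub> \<longleftrightarrow> os ! l dvd n"
      using N.conj_pow_eq_one_iff[of "s (Delta l)" m n] ord[OF l] by (simp add: x_def del: N.one_sd)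
  qed (use N.group_sd fin finM xsd in auto)
  define K where "K = generate N.sd (range x)"
  have K: "subgroup K N.sd"
    unfolding K_def by (rule group.generate_is_subgroup[OF N.group_sd xsd])
  have sndK: "snd ` K = carrier S"
    unfolding K_def x_def by (rule N.snd_generate_lifts[OF vM sc gen])
  have "(derived N.sd ^^ Suc d) K \<noteq> {\<one>\<^bsub>N.sd\<^esub>}"
  proof
    assume triv: "(derived N.sd ^^ Suc d) K = {\<one>\<^bsub>N.sd\<^esub>}"
    have "\<exists>m\<in>M. \<forall>(f, s)\<in>K. f = m - fun_act S s m"
    proof (rule N.conjugate_complement[OF K sndK triv A_def])
      show "f = 0" if "f \<in> M" "\<And>a. a \<in> A \<Longrightarrow> fun_act S a f = f" for f
        using norm_kernel_fixed_eq_0[OF AS] that unfolding M_def by blast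
      show "\<exists>m\<in>M. \<forall>a\<in>A. \<mu> a = m - fun_act S a m"
        if "\<And>a. a \<in> A \<Longrightarrow> \<mu> a \<in> M"
          "\<And>a b. \<lbrakk>a \<in> A; b \<in> A\<rbrakk> \<Longrightarrow> \<mu> (a \<otimes> b) = \<mu> a + fun_act S a (\<mu> b)" for \<mu>
        using norm_kernel_cocycle[OF AS that[unfolded M_def]] unfolding M_def by blast
    qed
    then obtain m where m: "m \<in> M" "\<And>f s. (f, s) \<in> K \<Longrightarrow> f = m - fun_act S s m"
      by blast
    have "x y \<in> K" for y
      unfolding K_def by (rule generate.incl) simp
    then have "v y = m - fun_act S (s y) m" for y
      using m(2)[of "v y" "s y"] by (simp add: x_def)
    with m(1) nconj show False by blast
  qed
  moreover obtain S' :: "nat monoid" and s' where S': "system S' g r os s'" "generating S' s'"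
    "\<And>n. (derived S' ^^ n) (carrier S') = {\<one>\<^bsub>S'\<^esub>} \<longleftrightarrow> (derived N.sd ^^ n) K = {\<one>\<^bsub>N.sd\<^esub>}"
    unfolding K_def by (rule system_transport[OF sys_x]) blast
  moreover have "(derived S' ^^ Suc (Suc d)) (carrier S') = {\<one>\<^bsub>S'\<^esub>}"
    unfolding S'(3) by (rule N.derived_series_sd[OF K sndK d(1)])
  ultimately show thesis
    using that[OF S'(1,2)] by blast
qed

section \<open>Solvable quotients of hyperbolic F-groups\<close>

definition solvable_system :: "('s, 'b) monoid_scheme \<Rightarrow> nat \<Rightarrow> nat \<Rightarrow> nat list \<Rightarrow> (F_gen \<Rightarrow> 's) \<Rightarrow> bool" where
  "solvable_system S g r os s \<longleftrightarrow> system S g r os s \<and> generating S s \<and>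
     (\<exists>d. (derived S ^^ d) (carrier S) = {\<one>\<^bsub>S\<^esub>})"

lemma solvable_system_raise:
  fixes S :: "('s, 'b) monoid_scheme"
  assumes "solvable_system S g r os s" "k < length os" "2 \<le> q" "os ! k < card (carrier S)"
  obtains S' :: "nat monoid" and s' where "solvable_system S' g r (os[k := os ! k * q]) s'"
    "card (carrier S) < card (carrier S')"
  using assms raise_order[of S g r os s _ k q] unfolding solvable_system_def by metis

text \<open>Wrong orders are corrected one at a time. An order can be raised while it is below the
  size of the group, and as the group grows at each step this bound survives for the remaining
  ones.\<close>

lemma solvable_system_raise_all:
  fixes S :: "nat monoid"
  assumes "solvable_system S g r os s" "length ns = length os"
    and "\<And>l. l < length os \<Longrightarrow> os ! l dvd ns ! l \<and> 0 < ns ! l \<and> (os ! l \<noteq> ns ! l \<longrightarrow> os ! l < card (carrier S))"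
    and "1 < card (carrier S)"
  shows "\<exists>(S'::nat monoid) s'. solvable_system S' g r ns s' \<and> 1 < card (carrier S')"
  using assms
proof (induction "card {l. l < length os \<and> os ! l \<noteq> ns ! l}" arbitrary: S s os)
  case 0
  then have "os = ns"
    by (intro nth_equalityI) auto
  with 0 show ?case by blast
next
  case (Suc n)
  then have "{l. l < length os \<and> os ! l \<noteq> ns ! l} \<noteq> {}"
    by (metis card.empty nat.distinct(1))
  then obtain k where k: "k < length os" "os ! k \<noteq> ns ! k"
    by blast
  note os = Suc.prems(3)
  obtain q where q: "ns ! k = os ! k * q"
    using os[OF k(1)] by blast
  have "q \<noteq> 0" "q \<noteq> 1"
    using q k os[OF k(1)] by auto
  then have "2 \<le> q" by simp
  moreover have "os ! k < card (carrier S)"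
    using os k by blast
  ultimately obtain S' :: "nat monoid" and s' where S': "solvable_system S' g r (os[k := ns ! k]) s'"
    "card (carrier S) < card (carrier S')"
    using solvable_system_raise[OF Suc.prems(1) k(1)] q by metis
  have "{l. l < length os \<and> os ! l \<noteq> ns ! l}
      = insert k {l. l < length os \<and> os[k := ns ! k] ! l \<noteq> ns ! l}"
    using k by (auto simp: nth_list_update)
  moreover have "k \<notin> {l. l < length os \<and> os[k := ns ! k] ! l \<noteq> ns ! l}"
    using k by simp
  ultimately have "n = card {l. l < length (os[k := ns ! k]) \<and> os[k := ns ! k] ! l \<noteq> ns ! l}"
    using Suc.hyps(2) by simp
  then show ?case
  proof (rule Suc.hyps(1)[OF _ S'(1)])
    fix l assume "l < length (os[k := ns ! k])"
    then show "os[k := ns ! k] ! l dvd ns ! l \<and> 0 < ns ! l \<and>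
        (os[k := ns ! k] ! l \<noteq> ns ! l \<longrightarrow> os[k := ns ! k] ! l < card (carrier S'))"
      using os[of l] S'(2) k by (cases "l = k") auto
  qed (use Suc.prems S'(2) in auto)
qed

lemma system_order_le_card:
  assumes "system S g r os s" "l < length os"
  shows "os ! l \<le> card (carrier S)"
proof -
  interpret group S using assms(1) by (simp add: system_def)
  have "s (Delta l) \<in> carrier S" and fin: "finite (carrier S)"
    using assms(1) by (auto simp: system_def)
  then have "generate S {s (Delta l)} \<subseteq> carrier S"
    by (intro generate_incl) auto
  then show ?thesis
    using card_mono[OF fin] system_ord[OF assms] by metis
qed

text \<open>The subgroup generated by the tuple is abelian, and the nontrivial entry makes it
  nontrivial.\<close>

lemma solvable_system_of_comm_group:
  fixes G :: "('a, 'b) monoid_scheme"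
  assumes "comm_group G" and sys: "system G g r os x" and "x y \<noteq> \<one>\<^bsub>G\<^esub>"
  shows "\<exists>(S::nat monoid) s. solvable_system S g r os s \<and> 1 < card (carrier S)"
proof -
  interpret comm_group G by fact
  let ?K = "generate G (range x)"
  have xc: "range x \<subseteq> carrier G" and fin: "finite (carrier G)"
    using sys by (auto simp: system_def)
  have K: "subgroup ?K G"
    by (rule generate_is_subgroup[OF xc])
  obtain S :: "nat monoid" and s where S: "system S g r os s" "generating S s"
    "card (carrier S) = card ?K"
    "\<And>n. (derived S ^^ n) (carrier S) = {\<one>\<^bsub>S\<^esub>} \<longleftrightarrow> (derived G ^^ n) ?K = {\<one>\<^bsub>G\<^esub>}"
    by (rule system_transport[OF sys]) blast
  have "{\<one>\<^bsub>G\<^esub>, x y} \<subseteq> ?K"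
    using subgroup.one_closed[OF K] by (auto intro: generate.incl)
  moreover have "finite ?K"
    using fin subgroup.subset[OF K] finite_subset by blast
  ultimately have "1 < card ?K"
    using assms(3) card_mono[of ?K "{\<one>\<^bsub>G\<^esub>, x y}"] by simp
  moreover have "(derived S ^^ 1) (carrier S) = {\<one>\<^bsub>S\<^esub>}"
    unfolding S(4) using derived_eq_singleton[OF subgroup.subset[OF K]] by simp
  ultimately show ?thesis
    using S(1-3) unfolding solvable_system_def by metis
qed

section \<open>Cyclic starting quotients\<close>

lemma (in comm_group) commutator_eq_one:
  "\<lbrakk>a \<in> carrier G; b \<in> carrier G\<rbrakk> \<Longrightarrow> commutator G a b = \<one>"
  by (simp add: commutator_def m_comm[of a b] m_assoc inv_cancel)

lemma eval_word_integer_mod_group: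
  assumes "range x \<subseteq> carrier (integer_mod_group p)"
  shows "eval_word (integer_mod_group p) x ws
    = (\<Sum>w\<leftarrow>ws. if \<exists>i. w = Alpha i then 0 else x w) mod int p"
proof (induction ws)
  case (Cons w ws)
  have "factor (integer_mod_group p) x w = (if \<exists>i. w = Alpha i then 0 else x w)"
    using assms comm_group.commutator_eq_one[OF abelian_integer_mod_group]
    by (cases w) (auto simp: image_subset_iff)
  then show ?case
    by (simp add: Cons mod_add_right_eq)
qed simp

lemma finite_integer_mod_group: "0 < p \<Longrightarrow> finite (carrier (integer_mod_group p))"
  by (simp add: carrier_integer_mod_group)

text \<open>In the cyclic group of order p, u goes to 1, w to -1 (represented by
  \<open>int p - 1\<close>) and everything else to 0, so the product relation holds.\<close>

lemma cyclic_system_pair: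
  assumes p: "2 \<le> p" and uw: "u \<noteq> w" "u \<in> set (relator_word g r k)" "w \<in> set (relator_word g r k)"
    and not_Alpha: "\<And>i. u \<noteq> Alpha i" "\<And>i. w \<noteq> Alpha i"
  shows "\<exists>(S::nat monoid) s.
    solvable_system S g r (map (\<lambda>l. if Delta l = u \<or> Delta l = w then p else 1) [0..<k]) s \<and> 1 < card (carrier S)"
proof -
  let ?os = "map (\<lambda>l. if Delta l = u \<or> Delta l = w then p else 1) [0..<k]"
  define x where "x y = (if y = u then 1 else if y = w then int p - 1 else 0)" for y
  have xc: "range x \<subseteq> carrier (integer_mod_group p)"
    using p by (auto simp: x_def carrier_integer_mod_group)
  have "(\<Sum>y\<leftarrow>relator_word g r k. if \<exists>i. y = Alpha i then 0 else x y)
      = (\<Sum>y\<in>set (relator_word g r k). if \<exists>i. y = Alpha i then 0 else x y)"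
    using separated_relator_word by (intro sum_list_distinct_conv_sum_set) (simp add: separated_def)
  also have "\<dots> = (\<Sum>y\<in>{u, w}. x y)"
    using uw not_Alpha by (intro sum.mono_neutral_cong_right) (auto simp: x_def)
  also have "\<dots> = int p"
    using uw by (simp add: x_def)
  finally have ev: "eval_word (integer_mod_group p) x (relator_word g r k) = 0"
    by (simp add: eval_word_integer_mod_group[OF xc])
  have uwX: "u \<in> F_gens g r k" "w \<in> F_gens g r k"
    using uw by (auto simp: relator_word_def F_gens_def)
  have "(int n * (int p - 1)) mod int p = 0 \<longleftrightarrow> p dvd n" for n
  proof -
    have "int n * (int p - 1) = int p * int n + (- int n)"
      by (simp add: algebra_simps)
    then show ?thesis
      by (simp add: mod_eq_0_iff_dvd dvd_add_right_iff del: add_uminus_conv_diff)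
  qed
  then have "x (Delta l) [^]\<^bsub>integer_mod_group p\<^esub> (n::nat) = 0 \<longleftrightarrow> ?os ! l dvd n" if "l < k" for l n
    using that uw(1) by (auto simp: x_def mod_eq_0_iff_dvd)
  then have "system (integer_mod_group p) g r ?os x"
    using p xc ev uwX by (auto simp: system_def finite_integer_mod_group x_def)
  moreover have "x u \<noteq> \<one>\<^bsub>integer_mod_group p\<^esub>"
    by (simp add: x_def)
  ultimately show ?thesis
    by (rule solvable_system_of_comm_group[OF abelian_integer_mod_group])
qed

text \<open>Commutators vanish in an abelian group, so \<open>Alpha 0\<close> may go to the nonzero
  element of Z/2 and everything else to 0.\<close>

lemma cyclic_system_genus:
  assumes "0 < g"
  shows "\<exists>(S::nat monoid) s. solvable_system S g r (replicate k 1) s \<and> 1 < card (carrier S)"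
proof -
  define x where "x y = (if y = Alpha 0 then 1 else 0::int)" for y
  have xc: "range x \<subseteq> carrier (integer_mod_group 2)"
    by (auto simp: x_def carrier_integer_mod_group)
  have "(\<Sum>y\<leftarrow>relator_word g r k. if \<exists>i. y = Alpha i then 0 else x y) = (\<Sum>y\<leftarrow>relator_word g r k. 0)"
    by (intro arg_cong[of _ _ sum_list] map_cong) (auto simp: x_def)
  then have "eval_word (integer_mod_group 2) x (relator_word g r k) = 0"
    by (simp add: eval_word_integer_mod_group[OF xc])
  moreover have "Alpha 0 \<in> F_gens g r k"
    using assms by (simp add: F_gens_def)
  ultimately have "system (integer_mod_group 2) g r (replicate k 1) x"
    using xc by (auto simp: system_def finite_integer_mod_group x_def)
  moreover have "x (Alpha 0) \<noteq> \<one>\<^bsub>integer_mod_group 2\<^esub>"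
    by (simp add: x_def)
  ultimately show ?thesis
    by (rule solvable_system_of_comm_group[OF abelian_integer_mod_group])
qed

text \<open>A cyclic quotient is chosen according to which generators exist, and then the orders are
  raised to \<open>ns\<close>. Each case has to arrange that the group is larger than every order
  still to be raised.\<close>

lemma ex_solvable_system:
  assumes hyp: "hyperbolic g r ns" and ns: "\<And>n. n \<in> set ns \<Longrightarrow> 2 \<le> n"
    and not_coprime: "g = 0 \<Longrightarrow> r = 0 \<Longrightarrow>
      \<exists>i<length ns. \<exists>j<length ns. i \<noteq> j \<and> \<not> coprime (ns ! i) (ns ! j)"
  shows "\<exists>(S::nat monoid) s. solvable_system S g r ns s \<and> 1 < card (carrier S)"
proof -
  let ?k = "length ns"
  have ns2: "2 \<le> ns ! l" if "l < ?k" for l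
    using ns that by simp
  \<comment> \<open>Orders equal to 1 lie below the size of any nontrivial group.\<close>
  have from_trivial: ?thesis
    if "\<exists>(S::nat monoid) s. solvable_system S g r (replicate ?k 1) s \<and> 1 < card (carrier S)"
  proof -
    obtain S :: "nat monoid" and s where S: "solvable_system S g r (replicate ?k 1) s" "1 < card (carrier S)"
      using \<open>\<exists>(S::nat monoid) s. solvable_system S g r (replicate ?k 1) s \<and> 1 < card (carrier S)\<close> by blast
    show ?thesis
      by (rule solvable_system_raise_all[OF S(1)]) (use S(2) ns2 in \<open>auto intro: order_less_le_trans[of 0 2]\<close>)
  qed
  consider "g > 0" | "g = 0" "r \<ge> 2" | "g = 0" "r = 1" | "g = 0" "r = 0"
    by linarith
  then show ?thesis
  proof cases
    case 1
    then show ?thesis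
      by (intro from_trivial cyclic_system_genus)
  next
    case 2
    then have "\<exists>(S::nat monoid) s. solvable_system S g r
        (map (\<lambda>l. if Delta l = Gamma 0 \<or> Delta l = Gamma 1 then 2 else 1) [0..<?k]) s \<and> 1 < card (carrier S)"
      by (intro cyclic_system_pair) (auto simp: relator_word_def)
    then show ?thesis
      by (intro from_trivial) (simp add: map_replicate_const)
  next
    case 3
    \<comment> \<open>Without elliptic generators the hyperbolicity expression would be 2 - 1 = 1,
      which is not negative.\<close>
    have k: "0 < ?k"
      using hyp 3 by (cases ns) (auto simp: hyperbolic_def)
    let ?os = "map (\<lambda>l. if Delta l = Delta 0 \<or> Delta l = Gamma 0 then ns ! 0 else 1) [0..<?k]"
    obtain S :: "nat monoid" and s where S: "solvable_system S g r ?os s" "1 < card (carrier S)"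
      using cyclic_system_pair[of "ns ! 0" "Delta 0" "Gamma 0" g r ?k] ns2[OF k] k 3
      by (auto simp: relator_word_def)
    show ?thesis
      by (rule solvable_system_raise_all[OF S(1)])
         (use S(2) ns2 in \<open>auto intro: order_less_le_trans[of 0 2]\<close>)
  next
    case 4
    obtain i j where ij: "i < ?k" "j < ?k" "i \<noteq> j" "\<not> coprime (ns ! i) (ns ! j)"
      using not_coprime[OF 4] by blast
    \<comment> \<open>Two elliptic generators can cancel each other in a cyclic group whose order
      divides both of their orders.\<close>
    define p where "p = gcd (ns ! i) (ns ! j)"
    have "p \<noteq> 1"
      using ij(4) by (simp add: p_def coprime_iff_gcd_eq_1)
    moreover have "p \<noteq> 0"
      using ns2[OF ij(1)] by (simp add: p_def)
    ultimately have "2 \<le> p"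
      by linarith
    moreover have "p dvd ns ! i" "p dvd ns ! j"
      by (simp_all add: p_def)
    ultimately have p: "2 \<le> p" "p dvd ns ! i" "p dvd ns ! j"
      by blast+
    \<comment> \<open>The sum is at most the number of elliptic generators and exceeds 2, so a third
      generator exists.\<close>
    have "(\<Sum>n\<leftarrow>ns. 1 - 1 / real n) \<le> (\<Sum>n\<leftarrow>ns. 1)"
      by (rule sum_list_mono) simp
    then have "?k \<ge> 3"
      using hyp 4 by (simp add: hyperbolic_def sum_list_triv)
    then have "\<not> {..<?k} \<subseteq> {i, j}"
      using card_mono[of "{i, j}" "{..<?k}"] ij(3) by auto
    then obtain k where k: "k < ?k" "k \<noteq> i" "k \<noteq> j"
      by auto
    let ?os = "map (\<lambda>l. if Delta l = Delta i \<or> Delta l = Delta j then p else 1) [0..<?k]"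
    obtain S :: "nat monoid" and s where S: "solvable_system S g r ?os s" "1 < card (carrier S)"
      using cyclic_system_pair[of p "Delta i" "Delta j" g r ?k] p ij by (auto simp: relator_word_def)
    have pS: "p \<le> card (carrier S)"
      using system_order_le_card[of S g r ?os s i] S(1) ij(1) by (simp add: solvable_system_def)
    \<comment> \<open>The group may have exactly p elements, and then an order p cannot be raised at
      once. Raising the order 1 of the third generator first makes the group larger than p.\<close>
    obtain S' :: "nat monoid" and s' where S': "solvable_system S' g r (?os[k := ?os ! k * ns ! k]) s'"
      "card (carrier S) < card (carrier S')"
      using solvable_system_raise[OF S(1), of k "ns ! k"] k ns2[OF k(1)] S(2) by auto
    have "\<exists>(S''::nat monoid) s''. solvable_system S'' g r ns s'' \<and> 1 < card (carrier S'')"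
    proof (rule solvable_system_raise_all[OF S'(1)])
      fix l assume "l < length (?os[k := ?os ! k * ns ! k])"
      then have l: "l < ?k" by simp
      then show "?os[k := ?os ! k * ns ! k] ! l dvd ns ! l \<and> 0 < ns ! l \<and>
          (?os[k := ?os ! k * ns ! k] ! l \<noteq> ns ! l \<longrightarrow> ?os[k := ?os ! k * ns ! k] ! l < card (carrier S'))"
        using ns2[OF l] pS S'(2) S(2) k p by (cases "l = k"; cases "l = i"; cases "l = j") auto
    qed (use S(2) S'(2) in auto)
    then show ?thesis .
  qed
qed

text \<open>Any nontrivial solvable system starts the induction, and each step raises the derived
  length d + 1 by one.\<close>

lemma ex_system_derived_length:
  assumes hyp: "hyperbolic g r ns" and ns: "\<And>n. n \<in> set ns \<Longrightarrow> 2 \<le> n"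
    and not_coprime: "g = 0 \<Longrightarrow> r = 0 \<Longrightarrow>
      \<exists>i<length ns. \<exists>j<length ns. i \<noteq> j \<and> \<not> coprime (ns ! i) (ns ! j)"
  shows "\<exists>(S::nat monoid) s d. system S g r ns s \<and> generating S s \<and> k \<le> d \<and>
    (derived S ^^ Suc d) (carrier S) = {\<one>\<^bsub>S\<^esub>} \<and> (derived S ^^ d) (carrier S) \<noteq> {\<one>\<^bsub>S\<^esub>}"
proof (induction k)
  case 0
  obtain S :: "nat monoid" and s where S: "solvable_system S g r ns s" "1 < card (carrier S)"
    using ex_solvable_system[OF assms] by blast
  define d where "d = (LEAST d. (derived S ^^ d) (carrier S) = {\<one>\<^bsub>S\<^esub>})"
  obtain d0 where d0: "(derived S ^^ d0) (carrier S) = {\<one>\<^bsub>S\<^esub>}"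
    using S(1) by (auto simp: solvable_system_def)
  then have d: "(derived S ^^ d) (carrier S) = {\<one>\<^bsub>S\<^esub>}"
    unfolding d_def by (rule LeastI)
  have "d \<noteq> 0"
  proof
    assume "d = 0"
    then have "carrier S = {\<one>\<^bsub>S\<^esub>}"
      using d by simp
    then show False
      using S(2) by simp
  qed
  then obtain d' where d': "d = Suc d'"
    using not0_implies_Suc by blast
  then have "(derived S ^^ d') (carrier S) \<noteq> {\<one>\<^bsub>S\<^esub>}"
    using not_less_Least[of d' "\<lambda>d. (derived S ^^ d) (carrier S) = {\<one>\<^bsub>S\<^esub>}"]
    unfolding d_def[symmetric] by blast
  then show ?case
    using S(1) d d' unfolding solvable_system_def by blast
next
  case (Suc k)
  then obtain S :: "nat monoid" and s d where S: "system S g r ns s" "generating S s" "k \<le> d"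
    "(derived S ^^ Suc d) (carrier S) = {\<one>\<^bsub>S\<^esub>}" "(derived S ^^ d) (carrier S) \<noteq> {\<one>\<^bsub>S\<^esub>}"
    by blast
  obtain S' :: "nat monoid" and s' where "system S' g r ns s'" "generating S' s'"
    "(derived S' ^^ Suc (Suc d)) (carrier S') = {\<one>\<^bsub>S'\<^esub>}"
    "(derived S' ^^ Suc d) (carrier S') \<noteq> {\<one>\<^bsub>S'\<^esub>}"
    by (rule extend_derived_length[OF S(1,2) hyp S(4,5)])
  then show ?case
    using S(3) by (intro exI[of _ S'] exI[of _ s'] exI[of _ "Suc d"]) simp
qed

section \<open>Derived series of topological groups\<close>

context topological_group
begin

lemma continuous_map_mult:
  "\<lbrakk>continuous_map X T f; continuous_map X T g\<rbrakk> \<Longrightarrow> continuous_map X T (\<lambda>x. f x \<otimes> g x)"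
  using continuous_map_compose[OF continuous_map_pairedI continuous_mult] by (simp add: o_def)

lemma subgroup_closure_of:
  assumes H: "subgroup H G"
  shows "subgroup (T closure_of H) G"
proof
  interpret H: subgroup H G by fact
  have sub: "H \<subseteq> T closure_of H"
    using H.subset topspace_eq by (intro closure_of_subset) simp
  show "T closure_of H \<subseteq> carrier G"
    using closure_of_subset_topspace topspace_eq by metis
  show "\<one> \<in> T closure_of H"
    using sub H.one_closed by blast
  show "x \<otimes> y \<in> T closure_of H" if "x \<in> T closure_of H" "y \<in> T closure_of H" for x y
  proof -
    have "(\<lambda>(x, y). x \<otimes> y) ` (prod_topology T T closure_of (H \<times> H)) \<subseteq> T closure_of ((\<lambda>(x, y). x \<otimes> y) ` (H \<times> H))"
      by (rule continuous_map_image_closure_subset[OF continuous_mult])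
    also have "\<dots> \<subseteq> T closure_of H"
      by (rule closure_of_mono) auto
    finally show ?thesis
      using that by (auto simp: closure_of_Times)
  qed
  show "inv x \<in> T closure_of H" if "x \<in> T closure_of H" for x
  proof -
    have "(\<lambda>x. inv x) ` (T closure_of H) \<subseteq> T closure_of ((\<lambda>x. inv x) ` H)"
      by (rule continuous_map_image_closure_subset[OF continuous_inv])
    also have "\<dots> \<subseteq> T closure_of H"
      by (rule closure_of_mono) auto
    finally show ?thesis
      using that by auto
  qed
qed

lemma normal_closure_of:
  assumes H: "H \<lhd> G"
  shows "T closure_of H \<lhd> G"
proof -
  interpret H: normal H G by fact
  have "g \<otimes> x \<otimes> inv g \<in> T closure_of H" if g: "g \<in> carrier G" and x: "x \<in> T closure_of H" for g x
  proof -
    have "continuous_map T T (\<lambda>x. g \<otimes> x \<otimes> inv g)"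
      using g topspace_eq by (intro continuous_map_mult) simp_all
    then have "(\<lambda>x. g \<otimes> x \<otimes> inv g) ` (T closure_of H) \<subseteq> T closure_of ((\<lambda>x. g \<otimes> x \<otimes> inv g) ` H)"
      by (rule continuous_map_image_closure_subset)
    also have "\<dots> \<subseteq> T closure_of H"
      using H.inv_op_closed2[OF g] by (intro closure_of_mono) auto
    finally show ?thesis
      using x by auto
  qed
  then show ?thesis
    using subgroup_closure_of[OF H.subgroup_axioms] by (simp add: normal_inv_iff)
qed

lemma derived_term_normal: "derived_term G T m \<lhd> G"
  by (induction m) (simp_all add: normal_self normal_closure_of derived_is_normal)

lemma derived_term_subgroup: "subgroup (derived_term G T m) G"
  using derived_term_normal normal_imp_subgroup by blast

lemma derived_term_subset: "derived_term G T m \<subseteq> carrier G"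
  using derived_term_subgroup subgroup.subset by blast

lemma closedin_derived_term: "closedin T (derived_term G T m)"
  by (cases m) (simp_all add: topspace_eq[symmetric])

lemma derived_term_Suc_subset: "derived_term G T (Suc m) \<subseteq> derived_term G T m"
  using closure_of_minimal[OF derived_incl[OF _ derived_term_subgroup] closedin_derived_term] by simp

lemma derived_term_antimono: "m \<le> n \<Longrightarrow> derived_term G T n \<subseteq> derived_term G T m"
  by (induction rule: dec_induct) (use derived_term_Suc_subset in blast)+

lemma derived_term_stable:
  assumes "derived_term G T (Suc m) = derived_term G T m" "m \<le> n"
  shows "derived_term G T (Suc n) = derived_term G T n"
  using assms(2) by (induction rule: dec_induct) (use assms(1) in simp_all)

text \<open>Perfectness of a term uses its own multiplication and subspace topology. Commutators and
  their closure computed there agree with those of the whole group, so it says that the series is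
  stationary at m.\<close>

lemma m_derived_perfect_iff:
  "m_derived_perfect m G T \<longleftrightarrow> derived_term G T (Suc m) = derived_term G T m"
proof -
  let ?D = "derived_term G T m"
  have "derived (G\<lparr>carrier := ?D\<rparr>) ?D = derived G ?D"
    by (rule derived_consistent[OF order_refl derived_term_subgroup])
  moreover have "derived G ?D \<subseteq> ?D"
    by (rule derived_incl[OF order_refl derived_term_subgroup])
  ultimately show ?thesis
    using derived_term_Suc_subset[of m]
    by (auto simp: m_derived_perfect_def perfect_def closure_of_subtopology Int_absorb1)
qed

lemma derived_series_subset: "(derived G ^^ m) (carrier G) \<subseteq> derived_term G T m"
proof (induction m)
  case (Suc m)
  have "derived G ((derived G ^^ m) (carrier G)) \<subseteq> derived G (derived_term G T m)"
    by (rule mono_derived[OF Suc])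
  also have "\<dots> \<subseteq> T closure_of derived G (derived_term G T m)"
    using derived_in_carrier[OF derived_term_subset] by (intro closure_of_subset) (simp add: topspace_eq)
  finally show ?case by simp
qed simp

text \<open>The closedness hypothesis is continuity for the discrete topology on S. The closure of a
  set then lies in the preimage of its image, so closures do not enlarge images.\<close>

lemma derived_term_image:
  assumes h: "group_hom G S h" "h ` carrier G = carrier S"
    and closed: "\<And>B. closedin T {x \<in> carrier G. h x \<in> B}"
  shows "h ` derived_term G T m = (derived S ^^ m) (carrier S)"
proof (induction m)
  case (Suc m)
  interpret h: group_hom G S h by fact
  let ?D = "derived G (derived_term G T m)"
  have Dc: "?D \<subseteq> carrier G"
    by (rule derived_in_carrier[OF derived_term_subset])
  have "T closure_of ?D \<subseteq> {x \<in> carrier G. h x \<in> h ` ?D}"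
    using Dc by (intro closure_of_minimal closed) auto
  moreover have "?D \<subseteq> T closure_of ?D"
    using Dc by (intro closure_of_subset) (simp add: topspace_eq)
  ultimately have "h ` (T closure_of ?D) = h ` ?D"
    by auto
  also have "\<dots> = derived S (h ` derived_term G T m)"
    using h.derived_img[OF derived_term_subset] by simp
  finally show ?case
    by (simp add: Suc)
qed (simp add: h)

text \<open>For j up to k the terms contain N, hence are unions of cosets. A quotient map takes such
  closed sets to closed sets, so closure commutes with passing to the quotient.\<close>

lemma derived_term_quotient:
  fixes k
  defines "N \<equiv> derived_term G T k"
  assumes "j \<le> k"
  shows "derived_term (G Mod N) (factor_topology G T N) j = (\<lambda>x. N #> x) ` derived_term G T j"
  using assms(2)
proof (induction j)
  case 0
  show ?case
    by (auto simp: FactGroup_def RCOSETS_def)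
next
  case (Suc j)
  let ?\<pi> = "\<lambda>x. N #> x" and ?D = "derived G (derived_term G T j)"
  interpret N: normal N G
    unfolding N_def by (rule derived_term_normal)
  interpret p: group_hom G "G Mod N" ?\<pi>
    by (intro group_hom.intro group_hom_axioms.intro N.factorgroup_is_group N.r_coset_hom_Mod) (rule group_axioms)
  have q: "quotient_map T (factor_topology G T N) ?\<pi>"
    unfolding factor_topology_def by (rule quotient_map_quotient_topology)
  have Dc: "?D \<subseteq> carrier G"
    by (rule derived_in_carrier[OF derived_term_subset])
  let ?C = "T closure_of ?D"
  have C: "?C = derived_term G T (Suc j)"
    by simp
  have NC: "N \<subseteq> ?C"
    unfolding C N_def by (rule derived_term_antimono[OF Suc.prems])
  interpret C: subgroup ?C G
    unfolding C by (rule derived_term_subgroup)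
  have "{x \<in> topspace T. ?\<pi> x \<in> ?\<pi> ` ?C} = ?C"
  proof (intro equalityI subsetI)
    fix x assume "x \<in> {x \<in> topspace T. ?\<pi> x \<in> ?\<pi> ` ?C}"
    then obtain c where x: "x \<in> carrier G" "c \<in> ?C" "N #> x = N #> c"
      by (auto simp: topspace_eq)
    then have "x \<in> N #> c"
      using rcos_self[OF x(1) N.subgroup_axioms] by simp
    then obtain n where "n \<in> N" "x = n \<otimes> c"
      by (auto simp: r_coset_def)
    then show "x \<in> ?C"
      using NC x(2) C.m_closed by blast
  qed (use C.subset topspace_eq in auto)
  then have "closedin T {x \<in> topspace T. ?\<pi> x \<in> ?\<pi> ` ?C}"
    by simp
  moreover have "?\<pi> ` ?C \<subseteq> topspace (factor_topology G T N)"
    using C.subset unfolding factor_topology_def topspace_quotient_topology topspace_eq by blast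
  ultimately have "closedin (factor_topology G T N) (?\<pi> ` ?C)"
    using q unfolding quotient_map_closedin by blast
  moreover have "?D \<subseteq> ?C"
    using Dc by (intro closure_of_subset) (simp add: topspace_eq)
  ultimately have "factor_topology G T N closure_of (?\<pi> ` ?D) \<subseteq> ?\<pi> ` ?C"
    by (intro closure_of_minimal) auto
  moreover have "?\<pi> ` ?C \<subseteq> factor_topology G T N closure_of (?\<pi> ` ?D)"
    by (rule continuous_map_image_closure_subset[OF quotient_imp_continuous_map[OF q]])
  ultimately have "factor_topology G T N closure_of (?\<pi> ` ?D) = ?\<pi> ` ?C"
    by blast
  then show ?case
    using Suc p.derived_img[OF derived_term_subset] by simp
qed

text \<open>N is the k-th derived term. If the quotient collapsed earlier, the j-th term would lie
  in the k-th for some j < k, against strictness.\<close>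

lemma has_derived_length_quotient:
  assumes strict: "\<And>m. derived_term G T (Suc m) \<noteq> derived_term G T m"
  shows "\<exists>N. N \<lhd> G \<and> closedin T N \<and> solvable (G Mod N) \<and>
    has_derived_length (G Mod N) (factor_topology G T N) k"
proof -
  define N where "N = derived_term G T k"
  let ?\<pi> = "\<lambda>x. N #> x"
  interpret N: normal N G
    unfolding N_def by (rule derived_term_normal)
  interpret p: group_hom G "G Mod N" ?\<pi>
    by (intro group_hom.intro group_hom_axioms.intro N.factorgroup_is_group N.r_coset_hom_Mod) (rule group_axioms)
  have one: "\<one>\<^bsub>G Mod N\<^esub> = N"
    by (simp add: FactGroup_def)
  have \<pi>N: "?\<pi> ` N = {N}"
  proof -
    have "?\<pi> ` N = (\<lambda>x. N) ` N"
      by (rule image_cong) (simp_all add: N.rcos_const)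
    then show ?thesis
      using N.one_closed by (auto simp del: N.one_closed)
  qed
  have len: "has_derived_length (G Mod N) (factor_topology G T N) k"
    unfolding has_derived_length_def
  proof (intro conjI allI impI)
    show "derived_term (G Mod N) (factor_topology G T N) k = {\<one>\<^bsub>G Mod N\<^esub>}"
      using derived_term_quotient[of k k] \<pi>N one unfolding N_def[symmetric] by simp
    fix j assume j: "j < k"
    show "derived_term (G Mod N) (factor_topology G T N) j \<noteq> {\<one>\<^bsub>G Mod N\<^esub>}"
    proof
      assume "derived_term (G Mod N) (factor_topology G T N) j = {\<one>\<^bsub>G Mod N\<^esub>}"
      then have "?\<pi> ` derived_term G T j = {N}"
        using derived_term_quotient[of j k] j one unfolding N_def[symmetric] by simp
      then have "N #> x = N" if "x \<in> derived_term G T j" for x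
        using that by blast
      then have "derived_term G T j \<subseteq> N"
        using rcos_self[OF _ N.subgroup_axioms] derived_term_subset[of j] by blast
      also have "N \<subseteq> derived_term G T (Suc j)"
        unfolding N_def using j by (intro derived_term_antimono) simp
      finally show False
        using strict[of j] derived_term_Suc_subset[of j] by blast
    qed
  qed
  \<comment> \<open>\<open>solvable\<close> refers to the derived series without closures, whose
    terms lie in the closed ones.\<close>
  have "(derived (G Mod N) ^^ k) (carrier (G Mod N)) = ?\<pi> ` ((derived G ^^ k) (carrier G))"
  proof -
    have "carrier (G Mod N) = ?\<pi> ` carrier G"
      by (auto simp: FactGroup_def RCOSETS_def)
    then show ?thesis
      using p.exp_of_derived_img[of "carrier G" k] by simp
  qed
  also have "\<dots> \<subseteq> ?\<pi> ` N"
    unfolding N_def by (intro image_mono derived_series_subset)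
  finally have "(derived (G Mod N) ^^ k) (carrier (G Mod N)) \<subseteq> {\<one>\<^bsub>G Mod N\<^esub>}"
    by (simp add: \<pi>N one)
  moreover have "\<one>\<^bsub>G Mod N\<^esub> \<in> (derived (G Mod N) ^^ k) (carrier (G Mod N))"
    by (intro subgroup.one_closed p.H.exp_of_derived_is_subgroup p.H.subgroup_self)
  ultimately have "solvable (G Mod N)"
    using p.H.solvable_iff_trivial_derived_seq by blast
  then show ?thesis
    using len N.normal_axioms closedin_derived_term[of k] unfolding N_def by blast
qed

end

section \<open>Profinite completions\<close>

context group
begin

lemma finite_index_normalD:
  "N \<in> finite_index_normal G \<Longrightarrow> N \<lhd> G" "N \<in> finite_index_normal G \<Longrightarrow> finite (rcosets N)"
  by (simp_all add: finite_index_normal_def)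

lemma carrier_in_finite_index_normal: "carrier G \<in> finite_index_normal G"
proof -
  have "rcosets (carrier G) \<subseteq> {carrier G}"
    using subgroup.rcos_const[OF subgroup_self group_axioms] by (auto simp: RCOSETS_def)
  then show ?thesis
    using normal_self finite_subset by (auto simp: finite_index_normal_def)
qed

lemma finite_index_normal_Int:
  assumes "M \<in> finite_index_normal G" "N \<in> finite_index_normal G"
  shows "M \<inter> N \<in> finite_index_normal G"
proof -
  note MN = finite_index_normalD[OF assms(1)] finite_index_normalD[OF assms(2)]
  have "M \<inter> N \<lhd> G"
    using MN by (intro normal_subgroup_intersect)
  moreover have "rcosets (M \<inter> N) \<subseteq> (\<lambda>(A, B). A \<inter> B) ` ((rcosets M) \<times> (rcosets N))"
  proof
    fix C assume "C \<in> rcosets (M \<inter> N)"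
    then obtain x where x: "x \<in> carrier G" "C = (M \<inter> N) #> x"
      by (auto simp: RCOSETS_def)
    have "C = (M #> x) \<inter> (N #> x)"
    proof (intro equalityI subsetI)
      fix z assume "z \<in> (M #> x) \<inter> (N #> x)"
      then obtain m n where mn: "m \<in> M" "n \<in> N" "z = m \<otimes> x" "z = n \<otimes> x"
        by (auto simp: r_coset_def)
      then have "m \<in> carrier G" "n \<in> carrier G"
        using MN normal_imp_subgroup subgroup.mem_carrier by metis+
      then have "m = n"
        using mn x(1) by simp
      then show "z \<in> C"
        using mn x(2) by (auto simp: r_coset_def)
    qed (use x(2) in \<open>auto simp: r_coset_def\<close>)
    then show "C \<in> (\<lambda>(A, B). A \<inter> B) ` ((rcosets M) \<times> (rcosets N))"
      using x(1) by (auto simp: RCOSETS_def)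
  qed
  then have "finite (rcosets (M \<inter> N))"
    by (rule finite_subset) (use MN in simp)
  ultimately show ?thesis
    by (simp add: finite_index_normal_def)
qed

lemma finite_index_normal_Inter:
  assumes "finite \<N>" "\<N> \<subseteq> finite_index_normal G"
  shows "\<exists>N\<in>finite_index_normal G. \<forall>M\<in>\<N>. N \<subseteq> M"
  using assms
proof (induction \<N>)
  case empty
  then show ?case using carrier_in_finite_index_normal by blast
next
  case (insert M \<N>)
  then obtain N where "N \<in> finite_index_normal G" "\<forall>M\<in>\<N>. N \<subseteq> M"
    by blast
  then show ?case
    using insert.prems finite_index_normal_Int[of M N] by blast
qed

lemma carrier_profinite_completion:
  "carrier (profinite_completion G) = {f \<in> \<Pi>\<^sub>E N\<in>finite_index_normal G. rcosets N.
     \<forall>M\<in>finite_index_normal G. \<forall>N\<in>finite_index_normal G. M \<subseteq> N \<longrightarrow> f M \<subseteq> f N}"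
  by (simp add: profinite_completion_def)

text \<open>Cosets are multiplied and inverted setwise, hence monotonically for inclusion, so
  compatible families form a subgroup of the product.\<close>

lemma group_profinite_completion: "group (profinite_completion G)"
proof -
  let ?I = "finite_index_normal G" and ?P = "product_group (finite_index_normal G) (\<lambda>N. G Mod N)"
  have Q: "group (G Mod N)" if "N \<in> ?I" for N
    using finite_index_normalD(1)[OF that] normal.factorgroup_is_group by blast
  have P: "group ?P"
    using Q by simp
  have carrier_Q: "carrier (G Mod N) = rcosets N" for N
    by (simp add: FactGroup_def)
  have carrier_P: "carrier ?P = (\<Pi>\<^sub>E N\<in>?I. rcosets N)"
    by (simp add: carrier_Q)
  let ?C = "carrier (profinite_completion G)"
  have "subgroup ?C ?P"
  proof (rule group.subgroupI[OF P])
    show "?C \<subseteq> carrier ?P"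
      by (auto simp: carrier_profinite_completion carrier_Q)
    have "(\<lambda>N\<in>?I. N) \<in> ?C"
      using finite_index_normalD(1) subgroup.subgroup_in_rcosets[OF normal_imp_subgroup group_axioms]
      by (auto simp: carrier_profinite_completion)
    then show "?C \<noteq> {}" by blast
  next
    fix f assume f: "f \<in> ?C"
    then have fP: "f \<in> carrier ?P"
      by (auto simp: carrier_profinite_completion carrier_Q)
    have inv: "inv\<^bsub>?P\<^esub> f = (\<lambda>N\<in>?I. inv\<^bsub>G Mod N\<^esub> (f N))"
      using fP Q by (simp add: inv_product_group)
    have "inv\<^bsub>G Mod N\<^esub> (f N) = set_inv (f N)" if "N \<in> ?I" for N
      using f that finite_index_normalD(1)[OF that] normal.inv_FactGroup[of N G "f N"]
      by (auto simp: carrier_profinite_completion carrier_Q)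
    moreover have "set_inv A \<subseteq> set_inv B" if "A \<subseteq> B" for A B
      using that by (auto simp: SET_INV_def)
    ultimately have "(inv\<^bsub>?P\<^esub> f) M \<subseteq> (inv\<^bsub>?P\<^esub> f) N" if "M \<in> ?I" "N \<in> ?I" "M \<subseteq> N" for M N
      using f that by (simp add: inv carrier_profinite_completion)
    then show "inv\<^bsub>?P\<^esub> f \<in> ?C"
      using group.inv_closed[OF P fP] by (simp only: carrier_profinite_completion mem_Collect_eq carrier_P) blast
  next
    fix f g assume fg: "f \<in> ?C" "g \<in> ?C"
    then have fgP: "f \<in> carrier ?P" "g \<in> carrier ?P"
      by (auto simp: carrier_profinite_completion carrier_Q)
    have "(f \<otimes>\<^bsub>?P\<^esub> g) M \<subseteq> (f \<otimes>\<^bsub>?P\<^esub> g) N" if "M \<in> ?I" "N \<in> ?I" "M \<subseteq> N" for M N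
      using fg that mono_set_mult[of "f M" "f N" "g M" "g N" G]
      by (simp add: FactGroup_def carrier_profinite_completion)
    then show "f \<otimes>\<^bsub>?P\<^esub> g \<in> ?C"
      using monoid.m_closed[OF group.is_monoid[OF P] fgP] by (simp only: carrier_profinite_completion mem_Collect_eq carrier_P) blast
  qed
  from group.subgroup_imp_group[OF P this] show ?thesis
    by (simp add: profinite_completion_def)
qed

lemma mult_profinite_completion:
  "f \<otimes>\<^bsub>profinite_completion G\<^esub> g = (\<lambda>N\<in>finite_index_normal G. f N <#> g N)"
  by (simp add: profinite_completion_def FactGroup_def)

lemma completion_map_closed:
  assumes x: "x \<in> carrier G"
  shows "completion_map G x \<in> carrier (profinite_completion G)"
  using x by (auto simp: carrier_profinite_completion completion_map_def RCOSETS_def r_coset_def)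

lemma completion_map_hom: "completion_map G \<in> hom G (profinite_completion G)"
proof (rule homI)
  fix x y assume xy: "x \<in> carrier G" "y \<in> carrier G"
  have "(N #> x) <#> (N #> y) = N #> (x \<otimes> y)" if "N \<in> finite_index_normal G" for N
    using normal.rcos_sum[OF finite_index_normalD(1)[OF that] xy] .
  then show "completion_map G (x \<otimes> y) = completion_map G x \<otimes>\<^bsub>profinite_completion G\<^esub> completion_map G y"
    unfolding completion_map_def mult_profinite_completion by (intro restrict_ext) simp
qed (rule completion_map_closed)

lemma group_hom_completion_map: "group_hom G (profinite_completion G) (completion_map G)"
  by (intro group_hom.intro group_hom_axioms.intro group_axioms group_profinite_completion completion_map_hom)

lemma topspace_completion_topology: "topspace (completion_topology G) = carrier (profinite_completion G)"
  by (auto simp: completion_topology_def carrier_profinite_completion)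

lemma continuous_map_completion_component:
  assumes "N \<in> finite_index_normal G"
  shows "continuous_map (completion_topology G) (discrete_topology (rcosets N)) (\<lambda>f. f N)"
  unfolding completion_topology_def
  using continuous_map_product_projection[OF assms, of "\<lambda>N. discrete_topology (rcosets N)"]
  by (rule continuous_map_from_subtopology)

text \<open>Each compatibility condition involves two discrete coordinates and is closed, so the
  completion is closed in a product of finite discrete spaces.\<close>

lemma compact_completion_topology: "compact_space (completion_topology G)"
proof -
  let ?I = "finite_index_normal G"
  let ?P = "product_topology (\<lambda>N. discrete_topology (rcosets N)) ?I"
  have "compact_space ?P"
    using finite_index_normalD(2) by (auto simp: compact_space_product_topology compact_space_discrete_topology)
  have closed: "closedin ?P {f \<in> topspace ?P. f M \<subseteq> f N}" if MN: "M \<in> ?I" "N \<in> ?I" for M N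
  proof -
    let ?R = "discrete_topology ((rcosets M) \<times> (rcosets N))"
    have "continuous_map ?P ?R (\<lambda>f. (f M, f N))"
      using continuous_map_pairedI[OF continuous_map_product_projection[OF MN(1)] continuous_map_product_projection[OF MN(2)]]
      by (simp add: prod_topology_discrete_topology)
    then have "closedin ?P {f \<in> topspace ?P. (f M, f N) \<in> {(A, B) \<in> (rcosets M) \<times> (rcosets N). A \<subseteq> B}}"
      by (rule closedin_continuous_map_preimage) auto
    moreover have "{f \<in> topspace ?P. (f M, f N) \<in> {(A, B) \<in> (rcosets M) \<times> (rcosets N). A \<subseteq> B}}
        = {f \<in> topspace ?P. f M \<subseteq> f N}"
      using MN by (auto simp: PiE_iff)
    ultimately show ?thesis by simp
  qed
  define \<K> where "\<K> = (\<lambda>(M, N). {f \<in> topspace ?P. M \<subseteq> N \<longrightarrow> f M \<subseteq> f N}) ` (?I \<times> ?I)"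
  have "closedin ?P (\<Inter>\<K>)"
  proof (rule closedin_Inter)
    show "\<K> \<noteq> {}"
      using carrier_in_finite_index_normal by (auto simp: \<K>_def)
    fix K assume "K \<in> \<K>"
    then obtain M N where MN: "M \<in> ?I" "N \<in> ?I" "K = {f \<in> topspace ?P. M \<subseteq> N \<longrightarrow> f M \<subseteq> f N}"
      by (auto simp: \<K>_def)
    then show "closedin ?P K"
      using closed[OF MN(1,2)] closedin_topspace[of ?P] by (cases "M \<subseteq> N") simp_all
  qed
  moreover have "\<Inter>\<K> = carrier (profinite_completion G)"
    using carrier_in_finite_index_normal
    by (auto simp: \<K>_def carrier_profinite_completion)
  ultimately have "compactin ?P (carrier (profinite_completion G))"
    using closedin_compact_space[OF \<open>compact_space ?P\<close>] by simp
  then show ?thesis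
    by (simp add: completion_topology_def compact_space_subtopology)
qed

text \<open>A basic open set around f restricts finitely many coordinates. If N lies below all of
  them, a representative x of \<open>f N\<close> agrees with f in each restricted
  coordinate.\<close>

lemma completion_map_dense:
  assumes closed: "closedin (completion_topology G) P" and sub: "completion_map G ` carrier G \<subseteq> P"
  shows "P = carrier (profinite_completion G)"
proof (rule ccontr)
  let ?I = "finite_index_normal G" and ?C = "carrier (profinite_completion G)"
  assume "P \<noteq> ?C"
  moreover have "P \<subseteq> ?C"
    using closedin_subset[OF closed] by (simp add: topspace_completion_topology)
  ultimately obtain f where f: "f \<in> ?C" "f \<notin> P"
    by blast
  have "openin (completion_topology G) (?C - P)"
    using closed by (simp add: closedin_def topspace_completion_topology)
  then obtain U where U: "openin (product_topology (\<lambda>N. discrete_topology (rcosets N)) ?I) U" "?C - P = U \<inter> ?C"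
    by (auto simp: completion_topology_def openin_subtopology)
  have "f \<in> U"
    using f U(2) by blast
  then obtain V where V: "finite {N \<in> ?I. V N \<noteq> rcosets N}"
    "f \<in> Pi\<^sub>E ?I V" "Pi\<^sub>E ?I V \<subseteq> U"
    using U(1) by (auto simp: openin_product_topology_alt)
  obtain N where N: "N \<in> ?I" "\<And>M. M \<in> ?I \<Longrightarrow> V M \<noteq> rcosets M \<Longrightarrow> N \<subseteq> M"
    using finite_index_normal_Inter[OF V(1)] by auto
  have "f N \<in> rcosets N"
    using f(1) N(1) by (auto simp: carrier_profinite_completion)
  then obtain x where x: "x \<in> carrier G" "f N = N #> x"
    by (auto simp: RCOSETS_def)
  have NG: "subgroup N G"
    using finite_index_normalD(1)[OF N(1)] normal_imp_subgroup by blast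
  have "completion_map G x \<in> Pi\<^sub>E ?I V"
  proof (rule PiE_I)
    fix M assume M: "M \<in> ?I"
    have MG: "subgroup M G"
      using finite_index_normalD(1)[OF M] normal_imp_subgroup by blast
    show "completion_map G x M \<in> V M"
    proof (cases "V M = rcosets M")
      case True
      then show ?thesis
        using x M by (auto simp: completion_map_def RCOSETS_def)
    next
      case False
      then have "f N \<subseteq> f M"
        using N f(1) M by (simp add: carrier_profinite_completion)
      then have "x \<in> f M"
        using rcos_self[OF x(1) NG] x(2) by blast
      moreover have "f M \<in> rcosets M"
        using f(1) M by (auto simp: carrier_profinite_completion)
      ultimately have "f M = M #> x"
        using repr_independence[OF _ _ MG] by (auto simp: RCOSETS_def)
      then show ?thesis
        using PiE_mem[OF V(2) M] M by (simp add: completion_map_def)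
    qed
  qed (simp add: completion_map_def)
  then have "completion_map G x \<in> ?C - P"
    using V(3) U(2) completion_map_closed[OF x(1)] by blast
  then show False
    using sub x(1) by blast
qed

end

section \<open>The universal property of free profinite groups\<close>

definition word_value :: "('a, 'b) monoid_scheme \<Rightarrow> ('x \<Rightarrow> 'a) \<Rightarrow> ('x \<times> bool) list \<Rightarrow> 'a" where
  "word_value S s w = foldr (\<lambda>a z. (if snd a then s (fst a) else inv\<^bsub>S\<^esub> (s (fst a))) \<otimes>\<^bsub>S\<^esub> z) w \<one>\<^bsub>S\<^esub>"

context group
begin

lemma word_value_simps [simp]:
  "word_value G s [] = \<one>"
  "word_value G s (a # w) = (if snd a then s (fst a) else inv (s (fst a))) \<otimes> word_value G s w"
  by (simp_all add: word_value_def)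

lemma word_value_closed [simp]: "range s \<subseteq> carrier G \<Longrightarrow> word_value G s w \<in> carrier G"
  by (induction w) auto

lemma word_value_reduced_cons:
  assumes s: "range s \<subseteq> carrier G"
  shows "word_value G s (reduced_cons a w) = (if snd a then s (fst a) else inv (s (fst a))) \<otimes> word_value G s w"
proof -
  have "s (fst a) \<in> carrier G"
    using s by auto
  then show ?thesis
    using s by (cases w) (auto simp: inv_cancel)
qed

lemma word_value_hom:
  assumes s: "range s \<subseteq> carrier G"
  shows "word_value G s \<in> hom (free_group X) G"
proof -
  have "s x \<in> carrier G" for x
    using s by auto
  then have "word_value G s (foldr reduced_cons v w) = word_value G s v \<otimes> word_value G s w" for v w
    using s by (induction v) (simp_all add: word_value_reduced_cons m_assoc)
  then show ?thesis
    using s by (auto simp: hom_def free_group_def)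
qed

end

lemma free_group_generate:
  "carrier (free_group X) = generate (free_group X) ((\<lambda>x. [(x, True)]) ` X)"
proof
  interpret F: group "free_group X" by (rule group_free_group)
  let ?g = "(\<lambda>x. [(x, True)]) ` X"
  have gc: "?g \<subseteq> carrier (free_group X)"
    by (auto simp: free_group_def)
  show "generate (free_group X) ?g \<subseteq> carrier (free_group X)"
    by (rule F.generate_incl[OF gc])
  show "carrier (free_group X) \<subseteq> generate (free_group X) ?g"
  proof
    fix w assume "w \<in> carrier (free_group X)"
    then show "w \<in> generate (free_group X) ?g"
    proof (induction w)
      case Nil
      then show ?case
        using generate.one[of "free_group X" ?g] by (simp add: free_group_def)
    next
      case (Cons a w)
      have w: "w \<in> carrier (free_group X)" and a: "fst a \<in> X"
        using Cons.prems reduced_Cons_D[of a w] by (auto simp: free_group_def)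
      have gen: "[(fst a, True)] \<in> generate (free_group X) ?g"
        using a by (auto intro: generate.incl)
      have "inv\<^bsub>free_group X\<^esub> [(fst a, True)] = [(fst a, False)]"
        by (rule F.inv_equality) (use a in \<open>auto simp: free_group_def\<close>)
      then have "[(fst a, False)] \<in> generate (free_group X) ?g"
        using a generate.inv[of "[(fst a, True)]" ?g "free_group X"] by auto
      with gen have "[a] \<in> generate (free_group X) ?g"
        by (cases a; cases "snd a") auto
      from generate.eng[OF this Cons.IH[OF w]]
      have "[a] \<otimes>\<^bsub>free_group X\<^esub> w \<in> generate (free_group X) ?g" .
      moreover have "[a] \<otimes>\<^bsub>free_group X\<^esub> w = a # w"
        using Cons.prems by (cases w) (auto simp: free_group_def)
      ultimately show ?case by simp
    qed
  qed
qed

text \<open>The generators generate the image of the free group, which is dense.\<close>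

lemma closed_subgroup_free_profinite:
  assumes P: "subgroup P (free_profinite_group X)" and closed: "closedin (free_profinite_topology X) P"
    and gen: "\<And>x. x \<in> X \<Longrightarrow> free_profinite_gen X x \<in> P"
  shows "P = carrier (free_profinite_group X)"
proof -
  interpret F: group "free_group X" by (rule group_free_group)
  interpret c: group_hom "free_group X" "free_profinite_group X" "completion_map (free_group X)"
    by (rule F.group_hom_completion_map)
  let ?g = "(\<lambda>x. [(x, True)]) ` X"
  have "?g \<subseteq> carrier (free_group X)"
    by (auto simp: free_group_def)
  then have "completion_map (free_group X) ` carrier (free_group X)
      = generate (free_profinite_group X) (completion_map (free_group X) ` ?g)"
    by (simp add: c.generate_img free_group_generate[of X, symmetric])
  also have "\<dots> \<subseteq> P"
    using gen by (intro c.H.generate_subgroup_incl P) (auto simp: free_profinite_gen_def)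
  finally show ?thesis
    by (rule F.completion_map_dense[OF closed])
qed

lemma free_profinite_gen_closed: "x \<in> X \<Longrightarrow> free_profinite_gen X x \<in> carrier (free_profinite_group X)"
  unfolding free_profinite_gen_def
  by (intro group.completion_map_closed group_free_group) (simp add: free_group_def)

text \<open>The induced map on the free group has a kernel N of finite index because
  \<open>S\<close> is finite. Its extension reads off the coordinate at N and embeds the quotient by
  N into \<open>S\<close>; depending on one discrete coordinate, it is continuous.\<close>

lemma free_profinite_hom:
  fixes S :: "('s, 'b) monoid_scheme"
  assumes S: "group S" "finite (carrier S)" and s: "range s \<subseteq> carrier S"
  obtains \<theta> where "group_hom (free_profinite_group X) S \<theta>"
    "\<And>x. x \<in> X \<Longrightarrow> \<theta> (free_profinite_gen X x) = s x"
    "\<And>B. closedin (free_profinite_topology X) {f \<in> carrier (free_profinite_group X). \<theta> f \<in> B}"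
proof -
  interpret F: group "free_group X" by (rule group_free_group)
  interpret S: group S by fact
  define \<phi> where "\<phi> = word_value S s"
  interpret \<phi>: group_hom "free_group X" S \<phi>
    unfolding \<phi>_def
    by (intro group_hom.intro group_hom_axioms.intro S.word_value_hom s F.group_axioms S.group_axioms)
  define N where "N = kernel (free_group X) S \<phi>"
  have N: "N \<lhd> free_group X"
    unfolding N_def by (rule \<phi>.normal_kernel)
  interpret N: normal N "free_group X" by fact
  define e where "e = (\<lambda>C. the_elem (\<phi> ` C))"
  have e_hom: "e \<in> hom (free_group X Mod N) S"
    unfolding e_def N_def by (rule \<phi>.FactGroup_hom)
  have e_inj: "inj_on e (carrier (free_group X Mod N))"
    unfolding e_def N_def by (rule \<phi>.FactGroup_inj_on)
  have e_coset: "e (N #>\<^bsub>free_group X\<^esub> w) = \<phi> w" if w: "w \<in> carrier (free_group X)" for w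
  proof -
    have "\<phi> ` (N #>\<^bsub>free_group X\<^esub> w) = {\<phi> w}"
    proof (intro equalityI subsetI)
      fix z assume "z \<in> \<phi> ` (N #>\<^bsub>free_group X\<^esub> w)"
      then obtain n where "n \<in> N" "z = \<phi> (n \<otimes>\<^bsub>free_group X\<^esub> w)"
        by (auto simp: r_coset_def)
      moreover from this have "n \<in> carrier (free_group X)" "\<phi> n = \<one>\<^bsub>S\<^esub>"
        unfolding N_def kernel_def by blast+
      ultimately show "z \<in> {\<phi> w}"
        using w by simp
    next
      fix z assume "z \<in> {\<phi> w}"
      then show "z \<in> \<phi> ` (N #>\<^bsub>free_group X\<^esub> w)"
        using F.rcos_self[OF w N.subgroup_axioms] by blast
    qed
    then show ?thesis
      by (simp add: e_def)
  qed
  have "e ` carrier (free_group X Mod N) \<subseteq> carrier S"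
    using hom_in_carrier[OF e_hom] by blast
  then have "finite (e ` carrier (free_group X Mod N))"
    using S(2) finite_subset by blast
  then have "finite (carrier (free_group X Mod N))"
    using e_inj finite_imageD by blast
  then have NI: "N \<in> finite_index_normal (free_group X)"
    using N by (simp add: finite_index_normal_def FactGroup_def)
  define \<theta> where "\<theta> f = e (f N)" for f
  have comp: "f N \<in> carrier (free_group X Mod N)" if "f \<in> carrier (free_profinite_group X)" for f
    using that NI by (auto simp: F.carrier_profinite_completion FactGroup_def)
  have "\<theta> \<in> hom (free_profinite_group X) S"
  proof (rule homI)
    fix f g assume fg: "f \<in> carrier (free_profinite_group X)" "g \<in> carrier (free_profinite_group X)"
    have "(f \<otimes>\<^bsub>free_profinite_group X\<^esub> g) N = f N \<otimes>\<^bsub>free_group X Mod N\<^esub> g N"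
      using NI by (simp add: F.mult_profinite_completion FactGroup_def)
    then show "\<theta> (f \<otimes>\<^bsub>free_profinite_group X\<^esub> g) = \<theta> f \<otimes>\<^bsub>S\<^esub> \<theta> g"
      unfolding \<theta>_def using hom_mult[OF e_hom comp[OF fg(1)] comp[OF fg(2)]] by simp
  next
    fix f assume "f \<in> carrier (free_profinite_group X)"
    from comp[OF this] show "\<theta> f \<in> carrier S"
      unfolding \<theta>_def using e_hom hom_in_carrier by metis
  qed
  then have hom: "group_hom (free_profinite_group X) S \<theta>"
    by (intro group_hom.intro group_hom_axioms.intro F.group_profinite_completion S.group_axioms)
  have gen: "\<theta> (free_profinite_gen X x) = s x" if "x \<in> X" for x
  proof -
    have x: "[(x, True)] \<in> carrier (free_group X)"
      using that by (simp add: free_group_def)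
    have "\<theta> (free_profinite_gen X x) = \<phi> [(x, True)]"
      using e_coset[OF x] NI by (simp add: \<theta>_def free_profinite_gen_def completion_map_def)
    also have "\<dots> = s x"
      using s by (simp add: \<phi>_def image_subset_iff)
    finally show ?thesis .
  qed
  have "closedin (free_profinite_topology X) {f \<in> carrier (free_profinite_group X). \<theta> f \<in> B}" for B
  proof -
    have "closedin (free_profinite_topology X) {f \<in> topspace (free_profinite_topology X).
        f N \<in> {C \<in> rcosets\<^bsub>free_group X\<^esub> N. e C \<in> B}}"
      by (rule closedin_continuous_map_preimage[OF F.continuous_map_completion_component[OF NI]]) auto
    moreover have "{f \<in> topspace (free_profinite_topology X). f N \<in> {C \<in> rcosets\<^bsub>free_group X\<^esub> N. e C \<in> B}}
        = {f \<in> carrier (free_profinite_group X). \<theta> f \<in> B}"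
      using comp by (auto simp: F.topspace_completion_topology \<theta>_def FactGroup_def)
    ultimately show ?thesis by simp
  qed
  with hom gen show thesis
    by (rule that)
qed

section \<open>Quotients of profinite F-groups\<close>

text \<open>Extended by the identity to all letters, like the tuples in \<open>system\<close>, so
  that \<open>eval_word\<close> and its homomorphism lemmas apply.\<close>

definition presentation_gen :: "nat \<Rightarrow> nat \<Rightarrow> nat \<Rightarrow> F_gen \<Rightarrow> F_gen free_profinite" where
  "presentation_gen g r k y = (if y \<in> F_gens g r k then free_profinite_gen (F_gens g r k) y
     else \<one>\<^bsub>free_profinite_group (F_gens g r k)\<^esub>)"

lemma range_presentation_gen:
  "range (presentation_gen g r k) \<subseteq> carrier (free_profinite_group (F_gens g r k))"
proof -
  interpret F: group "free_profinite_group (F_gens g r k)"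
    by (rule group.group_profinite_completion[OF group_free_group])
  show ?thesis
    by (auto simp: presentation_gen_def free_profinite_gen_closed)
qed

lemma F_relators_eq:
  fixes g r and ns :: "nat list"
  defines "F \<equiv> free_profinite_group (F_gens g r (length ns))" and "x \<equiv> presentation_gen g r (length ns)"
  shows "F_relators g r ns = insert (eval_word F x (relator_word g r (length ns)))
    {x (Delta l) [^]\<^bsub>F\<^esub> (ns ! l) | l. l < length ns}"
proof -
  let ?X = "F_gens g r (length ns)"
  let ?gen = "free_profinite_gen ?X"
  have x: "x (Alpha i) = ?gen (Alpha i)" "x (Beta i) = ?gen (Beta i)" if "i < g" for i
    using that by (simp_all add: x_def presentation_gen_def F_gens_def)
  have x': "x (Gamma j) = ?gen (Gamma j)" if "j < r" for j
    using that by (simp add: x_def presentation_gen_def F_gens_def)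
  have x'': "x (Delta l) = ?gen (Delta l)" if "l < length ns" for l
    using that by (simp add: x_def presentation_gen_def F_gens_def)
  have "map (factor F x) (relator_word g r (length ns))
      = map (\<lambda>i. commutator F (?gen (Alpha i)) (?gen (Beta i))) [0..<g]
        @ map (\<lambda>j. ?gen (Gamma j)) [0..<r] @ map (\<lambda>l. ?gen (Delta l)) [0..<length ns]"
    by (simp add: relator_word_def x x' x'')
  moreover have "{x (Delta l) [^]\<^bsub>F\<^esub> (ns ! l) | l. l < length ns}
      = {?gen (Delta l) [^]\<^bsub>F\<^esub> (ns ! l) | l. l < length ns}"
    using x'' by force
  ultimately show ?thesis
    by (simp add: F_relators_def Let_def eval_word_def F_def)
qed

lemma F_presentationE:
  assumes "F_presentation G T g r ns"
  obtains p where "p \<in> epi (free_profinite_group (F_gens g r (length ns))) G"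
    "continuous_map (free_profinite_topology (F_gens g r (length ns))) T p"
    "kernel (free_profinite_group (F_gens g r (length ns))) G p =
       closed_normal_closure (free_profinite_group (F_gens g r (length ns)))
         (free_profinite_topology (F_gens g r (length ns))) (F_relators g r ns)"
  using assms by (auto simp: F_presentation_def topological_presentation_def)

lemma (in group) eval_word_trivial:
  "(\<And>w. w \<in> set ws \<Longrightarrow> factor G x w = \<one>) \<Longrightarrow> eval_word G x ws = \<one>"
  by (induction ws) simp_all

lemma (in group) eval_word_single:
  assumes "range x \<subseteq> carrier G" "distinct ws" "w \<in> set ws"
    and "\<And>w'. w' \<in> set ws \<Longrightarrow> w' \<noteq> w \<Longrightarrow> factor G x w' = \<one>"
  shows "eval_word G x ws = factor G x w"
  using assms(2-4)
proof (induction ws)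
  case (Cons a ws)
  show ?case
  proof (cases "a = w")
    case True
    then have "eval_word G x ws = \<one>"
      using Cons.prems by (intro eval_word_trivial) auto
    then show ?thesis
      using True assms(1) by simp
  next
    case False
    then have "eval_word G x ws = factor G x w"
      using Cons by auto
    moreover have "factor G x a = \<one>"
      using Cons.prems(3) False by simp
    ultimately show ?thesis
      using assms(1) by simp
  qed
qed simp

text \<open>Raising to the product of the other orders is an endomorphism that kills all generators
  but the i-th. The product relation then yields a second exponent for that generator, coprime to
  \<open>ns ! i\<close>.\<close>

lemma (in comm_group) coprime_relations_trivial:
  fixes ns :: "nat list"
  assumes x: "range x \<subseteq> carrier G"
    and rel: "eval_word G x (relator_word 0 0 (length ns)) = \<one>"
    and pow: "\<And>l. l < length ns \<Longrightarrow> x (Delta l) [^] (ns ! l) = \<one>"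
    and coprime: "\<And>i j. \<lbrakk>i < length ns; j < length ns; i \<noteq> j\<rbrakk> \<Longrightarrow> coprime (ns ! i) (ns ! j)"
    and i: "i < length ns"
  shows "x (Delta i) = \<one>"
proof -
  let ?m = "\<Prod>l\<in>{..<length ns} - {i}. ns ! l"
  have xc: "x y \<in> carrier G" for y
    using x by auto
  interpret m: group_hom G G "\<lambda>z. z [^] ?m"
    by unfold_locales (auto simp: hom_def pow_mult_distrib m_comm nat_pow_closed)
  have pow_m: "x (Delta l) [^] ?m = \<one>" if "l < length ns" "l \<noteq> i" for l
  proof -
    have "ns ! l dvd ?m"
      using that by (intro dvd_prodI) auto
    then obtain k where "?m = ns ! l * k" ..
    then show ?thesis
      using pow[OF that(1)] xc by (simp add: nat_pow_pow[symmetric])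
  qed
  have "eval_word G ((\<lambda>z. z [^] ?m) \<circ> x) (relator_word 0 0 (length ns))
      = factor G ((\<lambda>z. z [^] ?m) \<circ> x) (Delta i)"
  proof (rule eval_word_single)
    show "range ((\<lambda>z. z [^] ?m) \<circ> x) \<subseteq> carrier G"
      using xc by auto
    show "distinct (relator_word 0 0 (length ns))"
      using separated_relator_word by (simp add: separated_def)
    show "Delta i \<in> set (relator_word 0 0 (length ns))"
      using i by (simp add: relator_word_def)
    fix w assume "w \<in> set (relator_word 0 0 (length ns))" "w \<noteq> Delta i"
    moreover from this obtain l where "l < length ns" "w = Delta l"
      by (auto simp: relator_word_def)
    ultimately show "factor G ((\<lambda>z. z [^] ?m) \<circ> x) w = \<one>"
      using pow_m by simp
  qed
  moreover have "eval_word G ((\<lambda>z. z [^] ?m) \<circ> x) (relator_word 0 0 (length ns)) = \<one>"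
    using m.hom_eval_word[OF x, of "relator_word 0 0 (length ns)"] rel by simp
  ultimately have "x (Delta i) [^] ?m = \<one>"
    by simp
  then have "ord (x (Delta i)) dvd ?m" "ord (x (Delta i)) dvd ns ! i"
    using pow[OF i] xc by (simp_all add: pow_eq_id)
  moreover have "coprime (ns ! i) ?m"
    using coprime i by (intro prod_coprime_right) auto
  ultimately have "ord (x (Delta i)) = 1"
    using coprime_common_divisor_nat by blast
  then show ?thesis
    using pow_ord_eq_1[OF xc[of "Delta i"]] xc by simp
qed

lemma (in normal) comm_group_Mod:
  assumes "derived G (carrier G) \<subseteq> H"
  shows "comm_group (G Mod H)"
proof (rule group.group_comm_groupI[OF factorgroup_is_group])
  fix A B assume "A \<in> carrier (G Mod H)" "B \<in> carrier (G Mod H)"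
  then obtain a b where ab: "a \<in> carrier G" "b \<in> carrier G" "A = H #> a" "B = H #> b"
    by (auto simp: FactGroup_def RCOSETS_def)
  have "a \<otimes> b \<otimes> inv a \<otimes> inv b \<in> derived G (carrier G)"
    unfolding derived_def using ab by (intro generate.incl) auto
  then have h: "a \<otimes> b \<otimes> inv a \<otimes> inv b \<in> H"
    using assms by blast
  have "a \<otimes> b = (a \<otimes> b \<otimes> inv a \<otimes> inv b) \<otimes> (b \<otimes> a)"
    using ab by (simp add: m_assoc inv_cancel)
  then have "a \<otimes> b \<in> H #> (b \<otimes> a)"
    using h unfolding r_coset_def by blast
  then have "H #> (b \<otimes> a) = H #> (a \<otimes> b)"
    using ab by (intro repr_independence[OF _ _ subgroup_axioms]) auto
  then show "A \<otimes>\<^bsub>G Mod H\<^esub> B = B \<otimes>\<^bsub>G Mod H\<^esub> A"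
    using ab by (simp add: FactGroup_def rcos_sum)
qed

text \<open>Modulo the closed commutator subgroup N all generators become trivial, so the preimage
  of N is a closed subgroup of the free profinite group containing its generators.\<close>

lemma (in topological_group) perfect_if_coprime:
  assumes pres: "F_presentation G T 0 0 ns"
    and coprime: "\<And>i j. \<lbrakk>i < length ns; j < length ns; i \<noteq> j\<rbrakk> \<Longrightarrow> coprime (ns ! i) (ns ! j)"
  shows "perfect G T"
proof -
  let ?X = "F_gens 0 0 (length ns)"
  let ?F = "free_profinite_group ?X" and ?x = "presentation_gen 0 0 (length ns)"
  obtain p where p: "p \<in> epi ?F G" "continuous_map (free_profinite_topology ?X) T p"
    "kernel ?F G p = closed_normal_closure ?F (free_profinite_topology ?X) (F_relators 0 0 ns)"
    by (rule F_presentationE[OF pres])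
  have F: "group ?F"
    by (rule group.group_profinite_completion[OF group_free_group])
  interpret p: group_hom ?F G p
    using p(1) F by (simp add: epi_def group_hom_def group_hom_axioms_def group_axioms)
  have xF: "range ?x \<subseteq> carrier ?F"
    by (rule range_presentation_gen)
  have "F_relators 0 0 ns \<subseteq> kernel ?F G p"
    unfolding p(3) closed_normal_closure_def by blast
  then have rel: "p (eval_word ?F ?x (relator_word 0 0 (length ns))) = \<one>"
    and pow: "\<And>l. l < length ns \<Longrightarrow> p (?x (Delta l) [^]\<^bsub>?F\<^esub> (ns ! l)) = \<one>"
    unfolding F_relators_eq kernel_def by blast+
  define N where "N = derived_term G T 1"
  interpret N: normal N G
    unfolding N_def by (rule derived_term_normal)
  have "derived G (carrier G) \<subseteq> N"
    using derived_series_subset[of 1] by (simp add: N_def)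
  then interpret Q: comm_group "G Mod N"
    by (rule N.comm_group_Mod)
  interpret \<pi>: group_hom G "G Mod N" "\<lambda>z. N #> z"
    by (intro group_hom.intro group_hom_axioms.intro N.r_coset_hom_Mod Q.is_group) (rule group_axioms)
  let ?y = "\<lambda>y. N #> p (?x y)"
  have px: "range (p \<circ> ?x) \<subseteq> carrier G"
    using xF by auto
  have y: "range ?y \<subseteq> carrier (G Mod N)"
    using px by (intro image_subsetI \<pi>.hom_closed) auto
  have y_one: "?y (Delta l) = \<one>\<^bsub>G Mod N\<^esub>" if l: "l < length ns" for l
  proof (rule Q.coprime_relations_trivial[OF y _ _ coprime l])
    have "eval_word (G Mod N) ((\<lambda>z. N #> z) \<circ> (p \<circ> ?x)) (relator_word 0 0 (length ns))
        = N #> eval_word G (p \<circ> ?x) (relator_word 0 0 (length ns))"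
      using \<pi>.hom_eval_word[OF px] by simp
    also have "eval_word G (p \<circ> ?x) (relator_word 0 0 (length ns)) = \<one>"
      using p.hom_eval_word[OF xF] rel by simp
    finally show "eval_word (G Mod N) ?y (relator_word 0 0 (length ns)) = \<one>\<^bsub>G Mod N\<^esub>"
      by (simp add: o_def \<pi>.hom_one del: coset_mult_one)
    fix l assume l: "l < length ns"
    have xl: "?x (Delta l) \<in> carrier ?F"
      using xF by auto
    have "?y (Delta l) [^]\<^bsub>G Mod N\<^esub> (ns ! l) = N #> p (?x (Delta l) [^]\<^bsub>?F\<^esub> (ns ! l))"
      using xl by (simp add: \<pi>.hom_nat_pow p.hom_nat_pow)
    also have "\<dots> = \<one>\<^bsub>G Mod N\<^esub>"
      unfolding pow[OF l] by (rule \<pi>.hom_one)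
    finally show "?y (Delta l) [^]\<^bsub>G Mod N\<^esub> (ns ! l) = \<one>\<^bsub>G Mod N\<^esub>" .
  qed
  have in_N: "z \<in> N" if "N #> z = \<one>\<^bsub>G Mod N\<^esub>" "z \<in> carrier G" for z
    using rcos_self[OF that(2) N.subgroup_axioms] that(1) by (simp add: FactGroup_def)
  have gens: "p (?x (Delta l)) \<in> N" if "l < length ns" for l
    by (rule in_N[OF y_one[OF that]]) (use xF in \<open>simp add: image_subset_iff\<close>)
  define P where "P = {f \<in> carrier ?F. p f \<in> N}"
  have "P = carrier ?F"
  proof (rule closed_subgroup_free_profinite)
    show "subgroup P ?F"
      unfolding P_def
      by (rule p.G.subgroupI) (use p.G.one_closed N.one_closed in \<open>auto intro!: exI[of _ "\<one>\<^bsub>?F\<^esub>"]\<close>)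
    have "P = {f \<in> topspace (free_profinite_topology ?X). p f \<in> N}"
      by (simp add: P_def group.topspace_completion_topology[OF group_free_group])
    then show "closedin (free_profinite_topology ?X) P"
      using closedin_continuous_map_preimage[OF p(2) closedin_derived_term[of 1]] by (simp only: N_def)
    fix y assume y: "y \<in> ?X"
    then obtain l where l: "l < length ns" "y = Delta l"
      by (auto simp: F_gens_def)
    then show "free_profinite_gen ?X y \<in> P"
      using gens[OF l(1)] y free_profinite_gen_closed[OF y] by (simp add: P_def presentation_gen_def)
  qed
  moreover have "p ` P \<subseteq> N"
    by (auto simp: P_def)
  ultimately have "carrier G \<subseteq> N"
    using p(1) by (simp add: epi_def)
  then show ?thesis
    using derived_term_subset[of 1] unfolding perfect_def N_def by blast
qed

text \<open>The homomorphism from the free profinite group determined by s kills the relators and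
  has closed normal kernel, so it factors through p.\<close>

lemma (in profinite_group) hom_of_system:
  fixes S :: "('s, 'c) monoid_scheme"
  assumes pres: "F_presentation G T g r ns" and sys: "system S g r ns s" and gen: "generating S s"
  obtains h where "group_hom G S h" "h ` carrier G = carrier S"
    "\<And>B. closedin T {z \<in> carrier G. h z \<in> B}"
proof -
  let ?X = "F_gens g r (length ns)"
  let ?F = "free_profinite_group ?X" and ?TF = "free_profinite_topology ?X"
    and ?x = "presentation_gen g r (length ns)"
  obtain p where p: "p \<in> epi ?F G" "continuous_map ?TF T p"
    "kernel ?F G p = closed_normal_closure ?F ?TF (F_relators g r ns)"
    by (rule F_presentationE[OF pres])
  have F: "group ?F"
    by (rule group.group_profinite_completion[OF group_free_group])
  have topF: "topspace ?TF = carrier ?F"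
    by (rule group.topspace_completion_topology[OF group_free_group])
  interpret p: group_hom ?F G p
    using p(1) F by (simp add: epi_def group_hom_def group_hom_axioms_def group_axioms)
  have p_surj: "p ` carrier ?F = carrier G"
    using p(1) by (simp add: epi_def)
  have S: "group S" "finite (carrier S)" "range s \<subseteq> carrier S"
    and s1: "\<And>y. y \<notin> ?X \<Longrightarrow> s y = \<one>\<^bsub>S\<^esub>"
    and rel: "eval_word S s (relator_word g r (length ns)) = \<one>\<^bsub>S\<^esub>"
    and pow: "\<And>l. l < length ns \<Longrightarrow> s (Delta l) [^]\<^bsub>S\<^esub> (ns ! l) = \<one>\<^bsub>S\<^esub>"
    using sys by (simp_all add: system_def)
  obtain \<theta> where \<theta>: "group_hom ?F S \<theta>" "\<And>y. y \<in> ?X \<Longrightarrow> \<theta> (free_profinite_gen ?X y) = s y"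
    "\<And>B. closedin ?TF {f \<in> carrier ?F. \<theta> f \<in> B}"
    by (rule free_profinite_hom[OF S]) blast
  interpret \<theta>: group_hom ?F S \<theta> by fact
  have xF: "range ?x \<subseteq> carrier ?F"
    by (rule range_presentation_gen)
  have \<theta>x: "\<theta> \<circ> ?x = s"
    using \<theta>(2) s1 by (auto simp: fun_eq_iff presentation_gen_def)
  then have \<theta>x': "\<theta> (?x y) = s y" for y
    by (auto simp: fun_eq_iff)
  have "F_relators g r ns \<subseteq> kernel ?F S \<theta>"
  proof -
    have "\<theta> (eval_word ?F ?x (relator_word g r (length ns))) = \<one>\<^bsub>S\<^esub>"
      using \<theta>.hom_eval_word[OF xF] rel by (simp add: \<theta>x)
    moreover have "\<theta> (?x (Delta l) [^]\<^bsub>?F\<^esub> (ns ! l)) = \<one>\<^bsub>S\<^esub>" if "l < length ns" for l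
      using xF pow[OF that] by (simp add: \<theta>.hom_nat_pow \<theta>x' image_subset_iff)
    ultimately show ?thesis
      using xF p.G.eval_word_closed[OF xF] unfolding F_relators_eq kernel_def
      by (auto simp: image_subset_iff)
  qed
  moreover have "kernel ?F S \<theta> \<lhd> ?F"
    by (rule \<theta>.normal_kernel)
  moreover have "closedin ?TF (kernel ?F S \<theta>)"
    using \<theta>(3)[of "{\<one>\<^bsub>S\<^esub>}"] by (simp add: kernel_def)
  ultimately have ker: "kernel ?F G p \<subseteq> kernel ?F S \<theta>"
    unfolding p(3) closed_normal_closure_def by blast
  have factor: "\<theta> f = \<theta> f'" if f: "f \<in> carrier ?F" "f' \<in> carrier ?F" "p f = p f'" for f f'
  proof -
    have "f \<otimes>\<^bsub>?F\<^esub> inv\<^bsub>?F\<^esub> f' \<in> kernel ?F G p"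
      using f by (simp add: kernel_def)
    then have "f \<otimes>\<^bsub>?F\<^esub> inv\<^bsub>?F\<^esub> f' \<in> kernel ?F S \<theta>"
      using ker by blast
    then have "\<theta> f \<otimes>\<^bsub>S\<^esub> inv\<^bsub>S\<^esub> \<theta> f' = \<one>\<^bsub>S\<^esub>"
      using f by (simp add: kernel_def)
    then show ?thesis
      using f \<theta>.H.inv_solve_right'[of "\<one>\<^bsub>S\<^esub>" "\<theta> f" "\<theta> f'"] by simp
  qed
  \<comment> \<open>Any preimage under p will do, as \<open>\<theta>\<close> is constant on the
    fibres of p.\<close>
  define h where "h z = \<theta> (inv_into (carrier ?F) p z)" for z
  have hp: "h (p f) = \<theta> f" if "f \<in> carrier ?F" for f
    unfolding h_def using inv_into_into[OF imageI[OF that], of p] that f_inv_into_f[OF imageI[OF that], of p]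
    by (rule factor)
  have "h \<in> hom G S"
  proof (rule homI)
    fix z z' assume "z \<in> carrier G" "z' \<in> carrier G"
    then obtain f f' where f: "f \<in> carrier ?F" "f' \<in> carrier ?F" "z = p f" "z' = p f'"
      using p_surj by blast
    then have "z \<otimes> z' = p (f \<otimes>\<^bsub>?F\<^esub> f')"
      by simp
    then have "h (z \<otimes> z') = \<theta> (f \<otimes>\<^bsub>?F\<^esub> f')"
      using f(1,2) hp[of "f \<otimes>\<^bsub>?F\<^esub> f'"] by simp
    then show "h (z \<otimes> z') = h z \<otimes>\<^bsub>S\<^esub> h z'"
      using f hp by simp
  next
    fix z assume "z \<in> carrier G"
    then obtain f where "f \<in> carrier ?F" "z = p f"
      using p_surj by blast
    then show "h z \<in> carrier S"
      using hp by simp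
  qed
  then have h: "group_hom G S h"
    by (intro group_hom.intro group_hom_axioms.intro S(1)) (rule group_axioms)
  have h_image: "h ` carrier G = \<theta> ` carrier ?F"
    unfolding p_surj[symmetric] image_image using hp by simp
  have "carrier S = generate S (range s)"
    using gen by (simp add: generating_def)
  also have "\<dots> \<subseteq> \<theta> ` carrier ?F"
    using xF \<theta>x' by (intro \<theta>.H.generate_subgroup_incl \<theta>.subgroup_img_is_subgroup p.G.subgroup_self)
       (auto simp flip: \<theta>x' intro!: imageI)
  finally have surj: "h ` carrier G = carrier S"
    unfolding h_image by auto
  \<comment> \<open>The preimage under h is the image under p of a closed, hence compact set, and
    compact sets are closed in a Hausdorff space.\<close>
  have "closedin T {z \<in> carrier G. h z \<in> B}" for B
  proof -
    have "compactin ?TF {f \<in> carrier ?F. \<theta> f \<in> B}"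
      by (rule closedin_compact_space[OF group.compact_completion_topology[OF group_free_group] \<theta>(3)])
    then have "compactin T (p ` {f \<in> carrier ?F. \<theta> f \<in> B})"
      using p(2) image_compactin by blast
    then have "closedin T (p ` {f \<in> carrier ?F. \<theta> f \<in> B})"
      by (rule compactin_imp_closedin[OF Hausdorff])
    moreover have "p ` {f \<in> carrier ?F. \<theta> f \<in> B} = {z \<in> carrier G. h z \<in> B}"
      using hp p_surj by (auto 0 3 simp: image_iff)
    ultimately show ?thesis by simp
  qed
  with h surj show thesis
    by (rule that)
qed

theorem proposition2p27:
  fixes \<Delta> :: "('a, 'b) monoid_scheme" and T :: "'a topology"
  assumes "hyperbolic_profinite_F_group \<Delta> T"
    and "\<not> perfect \<Delta> T"
  shows "\<not> derived_perfect \<Delta> T \<and>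
    (\<forall>k::nat. \<exists>N. N \<lhd> \<Delta> \<and> closedin T N \<and>
       solvable (\<Delta> Mod N) \<and>
       has_derived_length (\<Delta> Mod N) (factor_topology \<Delta> T N) k)"
proof -
  interpret profinite_group \<Delta> T
    using assms(1) by (simp add: hyperbolic_profinite_F_group_def profinite_F_group_def)
  obtain g r ns where pres: "F_presentation \<Delta> T g r ns" and hyp: "hyperbolic g r ns"
    using assms(1) by (auto simp: hyperbolic_profinite_F_group_def hyperbolic_def)
  have ns: "2 \<le> n" if "n \<in> set ns" for n
    using pres that by (simp add: F_presentation_def)
  \<comment> \<open>Otherwise the orders would be pairwise coprime and the group perfect.\<close>
  have not_coprime: "\<exists>i<length ns. \<exists>j<length ns. i \<noteq> j \<and> \<not> coprime (ns ! i) (ns ! j)"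
    if "g = 0" "r = 0"
    using perfect_if_coprime[of ns] pres that assms(2) by blast
  \<comment> \<open>A series stationary at m is stationary at every d beyond it. Its image in S
    would then identify the derived terms d and d + 1 of S, of which only the second is
    trivial.\<close>
  have strict: "derived_term \<Delta> T (Suc m) \<noteq> derived_term \<Delta> T m" for m
  proof
    assume stable: "derived_term \<Delta> T (Suc m) = derived_term \<Delta> T m"
    obtain S :: "nat monoid" and s d where S: "system S g r ns s" "generating S s" "m \<le> d"
      "(derived S ^^ Suc d) (carrier S) = {\<one>\<^bsub>S\<^esub>}" "(derived S ^^ d) (carrier S) \<noteq> {\<one>\<^bsub>S\<^esub>}"
      using ex_system_derived_length[OF hyp ns not_coprime, of m] by blast
    obtain h where "group_hom \<Delta> S h" "h ` carrier \<Delta> = carrier S"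
      "\<And>B. closedin T {z \<in> carrier \<Delta>. h z \<in> B}"
      using hom_of_system[OF pres S(1,2)] by blast
    note image = derived_term_image[OF this]
    have "(derived S ^^ Suc d) (carrier S) = (derived S ^^ d) (carrier S)"
      using derived_term_stable[OF stable S(3)] unfolding image[symmetric] by simp
    then show False
      using S(4,5) by simp
  qed
  then have "\<not> derived_perfect \<Delta> T"
    by (simp add: derived_perfect_def m_derived_perfect_iff del: derived_term.simps)
  moreover have "\<exists>N. N \<lhd> \<Delta> \<and> closedin T N \<and> solvable (\<Delta> Mod N) \<and>
      has_derived_length (\<Delta> Mod N) (factor_topology \<Delta> T N) k" for k
    by (rule has_derived_length_quotient[OF strict])
  ultimately show ?thesis
    by blast
qed

end
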